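(* Let $\underline{\mathbf d}=(d_1,\dots,d_k;n)$ be a dimension vector of length $k\le 4$. Then $\underline{\mathbf d}$ is sparse if and only if $k=4$ and $d_1+d_2+d_3+d_4=2n$.
   Context: Work over an algebraically closed field of arbitrary characteristic. $Gr(d;n)$ is the Grassmannian of $d$-dimensional linear subspaces of a fixed $n$-dimensional vector space, and $\mathbb{P}GL(n)$ acts diagonally on products of such Grassmannians. A dimension vector $\underline{\mathbf d}=(d_1,\dots,d_k;n)$ consists of integers $n$ and $d_i$ with $1\le d_i\le n-1$; its length is $k$. It is called dense if the diagonal action of $\mathbb{P}GL(n)$ on $\prod_{i=1}^k Gr(d_i;n)$ has a Zariski dense orbit, and sparse otherwise. *)

theory Defs
  imports
    "HOL-Algebra.Group_Action"
    "HOL-Analysis.Abstract_Topology"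
    "HOL-Library.Poly_Mapping"
    "HOL-Computational_Algebra.Polynomial"
    "Jordan_Normal_Form.VS_Connect"
    "Jordan_Normal_Form.DL_Submatrix"
begin

text \<open>
  A dimension vector (d_1,...,d_k; n) is represented by the list of the d_i together with n.
  The factors of the product of Grassmannians are indexed from 0.
\<close>

definition dimension_vector :: "nat list \<Rightarrow> nat \<Rightarrow> bool" where
  "dimension_vector ds n \<longleftrightarrow> (\<forall>d\<in>set ds. 1 \<le> d \<and> d \<le> n - 1)"

definition Grassmannian :: "nat \<Rightarrow> nat \<Rightarrow> 'a :: field vec set set" where
  "Grassmannian d n =
     {W. VectorSpace.subspace class_ring W (module_vec TYPE('a) n) \<and>
         vectorspace.dim class_ring ((module_vec TYPE('a) n)\<lparr>carrier := W\<rparr>) = d}"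

definition Gr_product :: "nat list \<Rightarrow> nat \<Rightarrow> (nat \<Rightarrow> 'a :: field vec set) set" where
  "Gr_product ds n = (\<Pi>\<^sub>E i\<in>{..<length ds}. Grassmannian (ds ! i) n)"


subsection \<open>The diagonal action of the projective linear group\<close>

definition GL :: "nat \<Rightarrow> 'a :: field mat monoid" where
  "GL n = units_of (ring_mat TYPE('a) n ())"

definition scalar_mats :: "nat \<Rightarrow> 'a :: field mat set" where
  "scalar_mats n = {c \<cdot>\<^sub>m 1\<^sub>m n | c. c \<noteq> 0}"

definition PGL :: "nat \<Rightarrow> 'a :: field mat set monoid" where
  "PGL n = GL n Mod scalar_mats n"

text \<open>
  An element of PGL(n) is a coset C of scalar matrices. All members of C map a subspace W to the
  same subspace, so the union below is the image of W under any representative of C.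
\<close>

definition PGL_image :: "'a :: field mat set \<Rightarrow> 'a vec set \<Rightarrow> 'a vec set" where
  "PGL_image C W = (\<Union>g\<in>C. (\<lambda>v. g *\<^sub>v v) ` W)"

definition diagonal_action ::
    "nat list \<Rightarrow> 'a :: field mat set \<Rightarrow> (nat \<Rightarrow> 'a vec set) \<Rightarrow> (nat \<Rightarrow> 'a vec set)" where
  "diagonal_action ds C W = (\<lambda>i\<in>{..<length ds}. PGL_image C (W i))"


subsection \<open>The Zariski topology on a product of Grassmannians\<close>

text \<open>
  A polynomial in variables indexed by \<open>'v\<close> is a finitely supported function from monomials
  (finitely supported exponent functions) to coefficients.
\<close>

type_synonym ('v, 'a) mpoly = "('v \<Rightarrow>\<^sub>0 nat) \<Rightarrow>\<^sub>0 'a"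

definition eval_mpoly :: "('v \<Rightarrow> 'a) \<Rightarrow> ('v, 'a :: field) mpoly \<Rightarrow> 'a" where
  "eval_mpoly x f =
     (\<Sum>m\<in>Poly_Mapping.keys f. Poly_Mapping.lookup f m *
        (\<Prod>v\<in>Poly_Mapping.keys m. x v ^ Poly_Mapping.lookup m v))"

text \<open>
  The columns of a basis matrix of W form a basis of W (the d columns span a space of
  dimension d); the Pluecker coordinates of W are its maximal minors, one for each d-element
  set I of rows, and are determined by W up to a common nonzero factor.
\<close>

definition basis_matrix :: "nat \<Rightarrow> nat \<Rightarrow> 'a :: field vec set \<Rightarrow> 'a mat \<Rightarrow> bool" where
  "basis_matrix d n W A \<longleftrightarrow>
     W \<in> Grassmannian d n \<and> A \<in> carrier_mat n d \<and> vec_space.col_space n A = W"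

definition pluecker :: "'a :: field mat \<Rightarrow> nat set \<Rightarrow> 'a" where
  "pluecker A I = det (submatrix A I UNIV)"

text \<open>
  The variable (i, I) stands for the I-th Pluecker coordinate of the i-th factor. Multihomogeneous
  means homogeneous (of degree e i) in the variables of each factor i separately.
\<close>

definition pluecker_variables :: "nat list \<Rightarrow> nat \<Rightarrow> (nat \<times> nat set) set" where
  "pluecker_variables ds n =
     {(i, I). i < length ds \<and> I \<subseteq> {..<n} \<and> card I = ds ! i}"

definition multihomogeneous ::
    "nat list \<Rightarrow> nat \<Rightarrow> (nat \<Rightarrow> nat) \<Rightarrow> (nat \<times> nat set, 'a :: field) mpoly \<Rightarrow> bool" where
  "multihomogeneous ds n e f \<longleftrightarrow>
     (\<forall>m\<in>Poly_Mapping.keys f.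
        Poly_Mapping.keys m \<subseteq> pluecker_variables ds n \<and>
        (\<forall>i<length ds. (\<Sum>v\<in>{v\<in>Poly_Mapping.keys m. fst v = i}. Poly_Mapping.lookup m v) = e i))"

text \<open>
  By multihomogeneity, whether f vanishes at a point does not depend on the chosen basis matrices.
\<close>

definition principal_open ::
    "nat list \<Rightarrow> nat \<Rightarrow> (nat \<times> nat set, 'a :: field) mpoly \<Rightarrow> (nat \<Rightarrow> 'a vec set) set" where
  "principal_open ds n f =
     {W \<in> Gr_product ds n.
        \<exists>A. (\<forall>i<length ds. basis_matrix (ds ! i) n (W i) (A i)) \<and>
            eval_mpoly (\<lambda>(i, I). pluecker (A i) I) f \<noteq> 0}"

text \<open>
  The topology induced by the Pluecker embedding into a product of projective spaces: the closed
  sets are the common zero sets of families of multihomogeneous polynomials. The principal open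
  sets form a base, since those of f and g intersect in that of f * g.
\<close>

definition zariski :: "nat list \<Rightarrow> nat \<Rightarrow> (nat \<Rightarrow> 'a :: field vec set) topology" where
  "zariski ds n =
     topology_generated_by {principal_open ds n f | f. \<exists>e. multihomogeneous ds n e f}"


subsection \<open>Dense and sparse dimension vectors\<close>

definition dense_dimension_vector :: "'a :: field itself \<Rightarrow> nat list \<Rightarrow> nat \<Rightarrow> bool" where
  "dense_dimension_vector _ ds n \<longleftrightarrow>
     (\<exists>W \<in> Gr_product ds n.
        Abstract_Topology.closure_of (zariski ds n :: (nat \<Rightarrow> 'a vec set) topology)
          (Group_Action.orbit (PGL n) (diagonal_action ds) W) = Gr_product ds n)"

definition sparse_dimension_vector :: "'a :: field itself \<Rightarrow> nat list \<Rightarrow> nat \<Rightarrow> bool" where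
  "sparse_dimension_vector K ds n \<longleftrightarrow> \<not> dense_dimension_vector K ds n"

end

theory Submission
  imports Defs "Jordan_Normal_Form.DL_Rank"
begin

text \<open>
Choose a basis matrix for every subspace. A point of the product of Grassmannians becomes a tuple of
matrices \<open>A\<^sub>i\<close> of size \<open>n \<times> d\<^sub>i\<close>, and two points lie in one orbit iff \<open>B\<^sub>i = g A\<^sub>i h\<^sub>i\<close> for invertible \<open>g\<close>
and \<open>h\<^sub>i\<close>. So the dimension vector is dense as soon as some Zariski dense set of matrix tuples consists
of equivalent tuples (\<open>generic_orbit\<close>, \<open>dense_if_generic_orbit\<close>). Density is tested against polynomial
functions on an affine space, where only one fact of algebraic geometry is needed: two polynomials that
do not vanish identically have a common point of nonvanishing.

The existence of a generic orbit is transported by two constructions, each of which replaces a matrix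
of full rank by a matrix whose rows span the orthogonal complement of its row space. Applied to every
\<open>A\<^sub>i\<^sup>T\<close> separately, it turns \<open>(d\<^sub>i; n)\<close> into \<open>(n - d\<^sub>i; n)\<close> (\<open>generic_orbit_dual\<close>). Applied to the wide
matrix \<open>[A\<^sub>1 | \<dots> | A\<^sub>k]\<close>, it turns \<open>(d\<^sub>i; n)\<close> into \<open>(d\<^sub>i; \<Sum>d\<^sub>i - n)\<close>, the passage to Gale dual
configurations (\<open>generic_orbit_gale\<close>). Such a complement can be written with minors of a bordered
matrix, hence polynomially, and every tuple of full rank arises in this way; this is why dense sets go
to dense sets. Both constructions change the sign of the defect \<open>2n - \<Sum>d\<^sub>i\<close> of four subspaces. If the
defect is positive, then \<open>\<Sum>d\<^sub>i - n < n\<close>, so their composition lowers \<open>n\<close> until the subspaces are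
independent, in which case the claim is immediate (\<open>four_subspaces_below\<close> also treats the case that
some \<open>d\<^sub>i\<close> exceeds the new \<open>n\<close>). A negative defect is made positive by duality. Fewer than four subspaces
are completed by zero spaces or, for the fourth, by the whole space, so that the defect becomes nonzero.

If \<open>k = 4\<close> and \<open>\<Sum>d\<^sub>i = 2n\<close>, then for every scalar \<open>\<mu>\<close> the block matrix with rows \<open>[A\<^sub>0, 0, A\<^sub>2, A\<^sub>3]\<close> and
\<open>[0, A\<^sub>1, A\<^sub>2, \<mu> A\<^sub>3]\<close> is square. Its determinant is a form in the Pluecker coordinates
(\<open>pluecker_form_det\<close>), and passing to an equivalent tuple multiplies it by a factor that does not depend
on \<open>\<mu>\<close> (\<open>pencil_det_equivariant\<close>). So the quotients of these determinants for different \<open>\<mu>\<close> are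
invariants. They generalize the cross-ratio of four points on a line. They are not constant: there is a
tuple for every \<open>\<nu>\<close> at which the determinant with parameter \<open>\<mu>\<close>, for \<open>\<mu>\<close> different from \<open>0\<close> and \<open>1\<close>,
vanishes only for \<open>\<mu> = \<nu>\<close>. Hence no orbit is dense (\<open>sparse_if_defect_zero\<close>).
\<close>

section \<open>Polynomial functions on affine space\<close>

text \<open>
Polynomials enter as functions on the space of all maps \<open>'v \<Rightarrow> 'a\<close>. In this form, closure under
substitution is a plain induction.
\<close>

inductive_set polyfuns :: "(('v \<Rightarrow> 'a :: comm_ring_1) \<Rightarrow> 'a) set" where
  const: "(\<lambda>_. c) \<in> polyfuns"
| coord: "(\<lambda>x. x v) \<in> polyfuns"
| add: "f \<in> polyfuns \<Longrightarrow> g \<in> polyfuns \<Longrightarrow> (\<lambda>x. f x + g x) \<in> polyfuns"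
| mult: "f \<in> polyfuns \<Longrightarrow> g \<in> polyfuns \<Longrightarrow> (\<lambda>x. f x * g x) \<in> polyfuns"

lemma polyfuns_sum: "(\<And>i. i \<in> I \<Longrightarrow> f i \<in> polyfuns) \<Longrightarrow> (\<lambda>x. \<Sum>i\<in>I. f i x) \<in> polyfuns"
  by (induction I rule: infinite_finite_induct) (auto intro: polyfuns.intros)

lemma polyfuns_prod: "(\<And>i. i \<in> I \<Longrightarrow> f i \<in> polyfuns) \<Longrightarrow> (\<lambda>x. \<Prod>i\<in>I. f i x) \<in> polyfuns"
  by (induction I rule: infinite_finite_induct) (auto intro: polyfuns.intros)

lemma polyfuns_power: "f \<in> polyfuns \<Longrightarrow> (\<lambda>x. f x ^ k) \<in> polyfuns"
  by (induction k) (auto intro: polyfuns.intros)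

lemma polyfuns_det:
  assumes "\<And>x. M x \<in> carrier_mat N N"
    and "\<And>i j. i < N \<Longrightarrow> j < N \<Longrightarrow> (\<lambda>x. M x $$ (i, j)) \<in> polyfuns"
  shows "(\<lambda>x. det (M x)) \<in> polyfuns"
proof -
  have "(\<lambda>x. \<Sum>p \<in> {p. p permutes {0..<N}}. signof p * (\<Prod>i = 0..<N. M x $$ (i, p i))) \<in> polyfuns"
    by (intro polyfuns_sum polyfuns.mult polyfuns.const polyfuns_prod assms(2)) (auto simp: permutes_in_image)
  then show ?thesis by (simp add: det_def'[OF assms(1)])
qed

lemma polyfuns_compose:
  assumes "f \<in> polyfuns" "\<And>v. (\<lambda>y. \<psi> y v) \<in> polyfuns"
  shows "(\<lambda>y. f (\<psi> y)) \<in> polyfuns"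
  using assms(1) by induction (auto intro: polyfuns.intros assms(2))

text \<open>
Restriction to a line turns questions about several variables into questions about the finitely many
roots of a univariate polynomial.
\<close>

lemma polyfun_on_line:
  assumes "f \<in> polyfuns"
  shows "\<exists>p. \<forall>t. poly p t = f (\<lambda>v. (1 - t) * x v + t * y v)"
  using assms
proof induction
  case (const c)
  show ?case by (rule exI[of _ "[:c:]"]) simp
next
  case (coord v)
  show ?case by (rule exI[of _ "[:x v, y v - x v:]"]) (simp add: algebra_simps)
next
  case (add f g)
  then obtain p q where "\<forall>t. poly p t = f (\<lambda>v. (1 - t) * x v + t * y v)"
    "\<forall>t. poly q t = g (\<lambda>v. (1 - t) * x v + t * y v)" by blast
  then show ?case by (intro exI[of _ "p + q"]) simp
next
  case (mult f g)
  then obtain p q where "\<forall>t. poly p t = f (\<lambda>v. (1 - t) * x v + t * y v)"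
    "\<forall>t. poly q t = g (\<lambda>v. (1 - t) * x v + t * y v)" by blast
  then show ?case by (intro exI[of _ "p * q"]) simp
qed

text \<open>
Over a finite field the polynomial \<open>1 + \<Prod>\<^sub>a (t - a)\<close> has no root.
\<close>

lemma alg_closed_infinite: "infinite (UNIV :: 'a :: alg_closed_field set)"
proof
  assume fin: "finite (UNIV :: 'a set)"
  define p where "p = (\<Prod>a\<in>(UNIV :: 'a set). [:- a, 1:]) + 1"
  have deg: "degree (\<Prod>a\<in>(UNIV :: 'a set). [:- a, 1:]) = card (UNIV :: 'a set)"
    by (subst degree_prod_eq_sum_degree) auto
  have pos: "card (UNIV :: 'a set) > 0" using fin by (simp add: card_gt_0_iff)
  have "degree p = card (UNIV :: 'a set)"
    unfolding p_def using deg pos by (subst degree_add_eq_left) auto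
  then obtain z where "poly p z = 0" using alg_closed_imp_poly_has_root[of p] pos by auto
  moreover have "(\<Prod>a\<in>UNIV. z - a) = 0" using fin by (intro prod_zero) auto
  ultimately show False by (simp add: p_def poly_prod)
qed

text \<open>
Affine space is irreducible: on the line through a nonvanishing point of \<open>f\<close> and one of \<open>g\<close>, the
product \<open>f g\<close> has only finitely many zeros.
\<close>

lemma polyfuns_mult_nonzero:
  fixes f g :: "('v \<Rightarrow> 'a :: alg_closed_field) \<Rightarrow> 'a"
  assumes "f \<in> polyfuns" "g \<in> polyfuns" "f x \<noteq> 0" "g y \<noteq> 0"
  shows "\<exists>z. f z \<noteq> 0 \<and> g z \<noteq> 0"
proof -
  obtain p q where p: "\<And>t. poly p t = f (\<lambda>v. (1 - t) * x v + t * y v)"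
    and q: "\<And>t. poly q t = g (\<lambda>v. (1 - t) * x v + t * y v)"
    using polyfun_on_line[OF assms(1)] polyfun_on_line[OF assms(2)] by metis
  have "p \<noteq> 0" using p[of 0] assms(3) by auto
  moreover have "q \<noteq> 0" using q[of 1] assms(4) by auto
  ultimately have "finite {t. poly (p * q) t = 0}" by (intro poly_roots_finite) auto
  then obtain t where "poly (p * q) t \<noteq> 0"
    using alg_closed_infinite ex_new_if_finite by blast
  then show ?thesis using p[of t] q[of t] by auto
qed

definition zdense :: "('v \<Rightarrow> 'a :: comm_ring_1) set \<Rightarrow> bool" where
  "zdense S \<longleftrightarrow> (\<forall>f\<in>polyfuns. (\<exists>x. f x \<noteq> 0) \<longrightarrow> (\<exists>x\<in>S. f x \<noteq> 0))"

lemma zdense_restrict: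
  fixes q :: "('v \<Rightarrow> 'a :: alg_closed_field) \<Rightarrow> 'a"
  assumes "zdense S" "q \<in> polyfuns" "q y \<noteq> 0"
  shows "zdense {x \<in> S. q x \<noteq> 0}"
  unfolding zdense_def
proof (intro ballI impI)
  fix f :: "('v \<Rightarrow> 'a) \<Rightarrow> 'a" assume f: "f \<in> polyfuns" "\<exists>x. f x \<noteq> 0"
  then obtain x where "f x * q x \<noteq> 0"
    using polyfuns_mult_nonzero[OF f(1) assms(2)] assms(3) by auto
  then show "\<exists>x\<in>{x \<in> S. q x \<noteq> 0}. f x \<noteq> 0"
    using assms(1)[unfolded zdense_def, rule_format, OF polyfuns.mult[OF f(1) assms(2)]] by auto
qed

lemma zdense_principal:
  fixes q :: "('v \<Rightarrow> 'a :: alg_closed_field) \<Rightarrow> 'a"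
  assumes "q \<in> polyfuns" "q y \<noteq> 0"
  shows "zdense {x. q x \<noteq> 0}"
  using zdense_restrict[of UNIV, OF _ assms] by (simp add: zdense_def)

text \<open>
Density passes along polynomial maps. The map \<open>\<psi>\<close> and the open set \<open>q \<noteq> 0\<close> may be chosen depending on
the point \<open>x\<close> that is to be approximated; it suffices that \<open>\<psi>\<close> hits \<open>x\<close> and carries the part of \<open>T\<close> in
that open set into \<open>S\<close>. The points \<open>x\<close> may themselves be restricted to a nonempty open set \<open>r \<noteq> 0\<close>.
\<close>

lemma zdense_transfer:
  fixes S :: "('v \<Rightarrow> 'a :: alg_closed_field) set" and T :: "('w \<Rightarrow> 'a) set"
  assumes T: "zdense T" and r: "r \<in> polyfuns" "r x0 \<noteq> 0"
    and \<psi>: "\<And>x. r x \<noteq> 0 \<Longrightarrow> \<exists>\<psi> q y. (\<forall>v. (\<lambda>y. \<psi> y v) \<in> polyfuns) \<and> q \<in> polyfuns \<and> q y \<noteq> 0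
      \<and> \<psi> y = x \<and> (\<forall>y\<in>T. q y \<noteq> 0 \<longrightarrow> \<psi> y \<in> S)"
  shows "zdense S"
  unfolding zdense_def
proof (intro ballI impI)
  fix f :: "('v \<Rightarrow> 'a) \<Rightarrow> 'a" assume f: "f \<in> polyfuns" "\<exists>x. f x \<noteq> 0"
  then obtain x where x: "f x \<noteq> 0" "r x \<noteq> 0" using polyfuns_mult_nonzero[OF f(1) r(1)] r(2) by auto
  from \<psi>[OF x(2)] obtain \<psi> q y where p: "\<forall>v. (\<lambda>y. \<psi> y v) \<in> polyfuns" "q \<in> polyfuns" "q y \<noteq> 0"
      "\<psi> y = x" "\<forall>y\<in>T. q y \<noteq> 0 \<longrightarrow> \<psi> y \<in> S"
    by (elim exE conjE) (rule that; assumption)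
  have "(\<lambda>y. f (\<psi> y) * q y) \<in> polyfuns"
    by (rule polyfuns.mult[OF polyfuns_compose[OF f(1) p(1)[rule_format]] p(2)])
  moreover have "f (\<psi> y) * q y \<noteq> 0" using x p(3,4) by simp
  then have "\<exists>y. f (\<psi> y) * q y \<noteq> 0" by (rule exI[of _ y])
  ultimately have "\<exists>z\<in>T. f (\<psi> z) * q z \<noteq> 0" by (rule T[unfolded zdense_def, rule_format])
  then obtain z where "z \<in> T" "f (\<psi> z) * q z \<noteq> 0" ..
  then show "\<exists>x\<in>S. f x \<noteq> 0" using p(5) by auto
qed


section \<open>Linear algebra of matrices of full rank\<close>

lemma det_nonzero_inverse:
  fixes g :: "'a :: field mat"
  assumes "g \<in> carrier_mat n n" "det g \<noteq> 0"
  obtains g' where "g' \<in> carrier_mat n n" "det g' \<noteq> 0" "g * g' = 1\<^sub>m n" "g' * g = 1\<^sub>m n"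
proof -
  have "g \<in> Units (ring_mat TYPE('a) n ())" by (rule det_non_zero_imp_unit[OF assms])
  then obtain g' where g': "g' \<in> carrier_mat n n" "g * g' = 1\<^sub>m n" "g' * g = 1\<^sub>m n"
    unfolding Units_def ring_mat_def by auto
  have "det g * det g' = 1" using det_mult[OF assms(1) g'(1)] g'(2) by simp
  then have "det g' \<noteq> 0" by auto
  then show ?thesis by (rule that[OF g'(1) _ g'(2,3)])
qed

lemma det_nonzero_if_mult_one:
  fixes g :: "'a :: field mat"
  assumes "g \<in> carrier_mat n n" "g' \<in> carrier_mat n n" "g * g' = 1\<^sub>m n"
  shows "det g \<noteq> 0" "det g' \<noteq> 0"
  using det_mult[OF assms(1,2)] assms(3) by auto

text \<open>
Completing both matrices by the same unit rows at the bottom makes them invertible, and then the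
quotient of the completions works.
\<close>

lemma wide_mat_transitive:
  fixes Z Z' :: "'a :: field mat"
  assumes Z: "Z \<in> carrier_mat n D" and Z': "Z' \<in> carrier_mat n D" and "n \<le> D"
    and dZ: "det (mat n n (($$) Z)) \<noteq> 0" and dZ': "det (mat n n (($$) Z')) \<noteq> 0"
  shows "\<exists>h \<in> carrier_mat D D. det h \<noteq> 0 \<and> Z' = Z * h"
proof -
  define E :: "'a mat" where "E = mat n D (\<lambda>(i, j). if j = i then 1 else 0)"
  define H where "H Z = four_block_mat (mat n n (($$) Z)) (mat n (D - n) (\<lambda>(i, j). Z $$ (i, j + n)))
    (0\<^sub>m (D - n) n) (1\<^sub>m (D - n))" for Z :: "'a mat"
  have H: "H Z \<in> carrier_mat D D" for Z
    using \<open>n \<le> D\<close> four_block_carrier_mat[of "mat n n (($$) Z)" n n "1\<^sub>m (D - n)" "D - n" "D - n"]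
    unfolding H_def by auto
  have detH: "det (H Z) = det (mat n n (($$) Z))" for Z
    unfolding H_def by (subst det_four_block_mat_lower_left_zero[where n = n and m = "D - n"]) auto
  have E: "E \<in> carrier_mat n D" unfolding E_def by simp
  have fact: "Z = E * H Z" if Z: "Z \<in> carrier_mat n D" for Z
  proof (rule eq_matI)
    fix i j assume "i < dim_row (E * H Z)" "j < dim_col (E * H Z)"
    then have ij: "i < n" "j < D" using E H[of Z] by auto
    have "row E i = unit_vec D i" using ij \<open>n \<le> D\<close> unfolding E_def by (intro eq_vecI) auto
    then have "(E * H Z) $$ (i, j) = unit_vec D i \<bullet> col (H Z) j" using ij E H[of Z] by simp
    also have "\<dots> = H Z $$ (i, j)" using ij \<open>n \<le> D\<close> H[of Z] by (subst scalar_prod_left_unit) auto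
    also have "\<dots> = Z $$ (i, j)" using ij \<open>n \<le> D\<close> unfolding H_def by (subst index_mat_four_block) auto
    finally show "Z $$ (i, j) = (E * H Z) $$ (i, j)" ..
  qed (use Z E H[of Z] in auto)
  obtain K where K: "K \<in> carrier_mat D D" "det K \<noteq> 0" "H Z * K = 1\<^sub>m D"
    using det_nonzero_inverse[OF H[of Z]] detH dZ by metis
  have "Z * (K * H Z') = Z * K * H Z'" by (rule assoc_mult_mat[OF Z K(1) H, symmetric])
  also have "Z * K = E * (H Z * K)" using assoc_mult_mat[OF E H K(1), of Z] fact[OF Z] by simp
  also have "E * (H Z * K) * H Z' = Z'" unfolding K(3) right_mult_one_mat[OF E] by (rule fact[OF Z', symmetric])
  finally have "Z' = Z * (K * H Z')" ..
  moreover have "det (K * H Z') \<noteq> 0" using det_mult[OF K(1) H] K(2) detH dZ' by simp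
  ultimately show ?thesis using K(1) H by (intro bexI[of _ "K * H Z'"]) auto
qed

lemma tall_mat_transitive:
  fixes Z Z' :: "'a :: field mat"
  assumes Z: "Z \<in> carrier_mat D n" and Z': "Z' \<in> carrier_mat D n" and "n \<le> D"
    and dZ: "det (mat n n (($$) Z)) \<noteq> 0" and dZ': "det (mat n n (($$) Z')) \<noteq> 0"
  shows "\<exists>h \<in> carrier_mat D D. det h \<noteq> 0 \<and> Z' = h * Z"
proof -
  have t: "mat n n (($$) Z\<^sup>T) = (mat n n (($$) Z))\<^sup>T" if "Z \<in> carrier_mat D n" for Z :: "'a mat"
    using that \<open>n \<le> D\<close> by (intro eq_matI) auto
  obtain h where h: "h \<in> carrier_mat D D" "det h \<noteq> 0" "Z'\<^sup>T = Z\<^sup>T * h"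
    using wide_mat_transitive[of "Z\<^sup>T" n D "Z'\<^sup>T"] assms
    by (auto simp: t det_transpose[OF mat_carrier])
  have "Z' = h\<^sup>T * Z"
    using arg_cong[OF h(3), of transpose_mat] Z h(1) by (simp add: transpose_mult[of "Z\<^sup>T" n D h D])
  then show ?thesis using h det_transpose[OF h(1)] by (intro bexI[of _ "h\<^sup>T"]) auto
qed

subsection \<open>Orthogonal complements of row spaces\<close>

text \<open>
The rows of \<open>A\<close> and of \<open>B\<close> are bases of mutually orthogonal complements in the space of row vectors of
length \<open>p + q\<close>. Full rank is expressed by the existence of right inverses.
\<close>

definition perp :: "nat \<Rightarrow> nat \<Rightarrow> 'a :: field mat \<Rightarrow> 'a mat \<Rightarrow> bool" where
  "perp p q A B \<longleftrightarrow> A \<in> carrier_mat q (p + q) \<and> B \<in> carrier_mat p (p + q) \<and>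
     A * B\<^sup>T = 0\<^sub>m q p \<and> (\<exists>R \<in> carrier_mat (p + q) q. A * R = 1\<^sub>m q) \<and>
     (\<exists>S \<in> carrier_mat (p + q) p. B * S = 1\<^sub>m p)"

text \<open>
With a right inverse \<open>R\<close> of \<open>A\<close>, the square matrix \<open>[R | B\<^sup>T]\<close> is invertible, since multiplying it from
the left by \<open>A\<close> on top of the transpose of a right inverse of \<open>B\<close> gives a triangular matrix. Both \<open>A'\<close>
and \<open>(A' R) A\<close> have the same product with it, so they agree and \<open>u = A' R\<close>.
\<close>

lemma perp_unique:
  fixes A A' B :: "'a :: field mat"
  assumes AB: "perp p q A B" and A'B: "perp p q A' B"
  shows "\<exists>u \<in> carrier_mat q q. det u \<noteq> 0 \<and> A' = u * A"
proof -
  define N where "N = p + q"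
  obtain R S R' where A: "A \<in> carrier_mat q N" and B: "B \<in> carrier_mat p N" and AB0: "A * B\<^sup>T = 0\<^sub>m q p"
    and R: "R \<in> carrier_mat N q" "A * R = 1\<^sub>m q" and S: "S \<in> carrier_mat N p" "B * S = 1\<^sub>m p"
    and A': "A' \<in> carrier_mat q N" and A'B0: "A' * B\<^sup>T = 0\<^sub>m q p"
    and R': "R' \<in> carrier_mat N q" "A' * R' = 1\<^sub>m q"
    using AB A'B unfolding perp_def N_def by blast
  define Q where "Q = mat N N (\<lambda>(i, j). if j < q then R $$ (i, j) else B $$ (j - q, i))"
  define T where "T = mat N N (\<lambda>(i, j). if i < q then A $$ (i, j) else S $$ (j, i - q))"
  have Q: "Q \<in> carrier_mat N N" and T: "T \<in> carrier_mat N N" unfolding Q_def T_def by auto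
  have colQ: "col Q j = (if j < q then col R j else row B (j - q))" if "j < N" for j
    using that R(1) B unfolding Q_def N_def by (intro eq_vecI) auto
  have rowT: "row T i = (if i < q then row A i else col S (i - q))" if "i < N" for i
    using that S(1) A unfolding T_def N_def by (intro eq_vecI) auto
  have TQ: "(T * Q) $$ (i, j) = (if i = j then 1 else 0)" if "i < N" "j < N" "i \<le> j" for i j
  proof -
    have eq: "(T * Q) $$ (i, j) = row T i \<bullet> col Q j" using that T Q by simp
    consider "j < q" | "i < q" "q \<le> j" | "q \<le> i" "q \<le> j" using that by linarith
    then show ?thesis
    proof cases
      case 1
      then have "row A i \<bullet> col R j = (A * R) $$ (i, j)" using that A R(1) by simp
      then show ?thesis using 1 that eq R(2) by (simp add: rowT colQ)
    next
      case 2
      then have "row A i \<bullet> row B (j - q) = (A * B\<^sup>T) $$ (i, j - q)" using that A B by (simp add: N_def)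
      then show ?thesis using 2 that eq AB0 by (simp add: rowT colQ N_def)
    next
      case 3
      then have "col S (i - q) \<bullet> row B (j - q) = (B * S) $$ (j - q, i - q)"
        using that S(1) B comm_scalar_prod[OF col_carrier_vec[OF _ S(1)] row_carrier_vec[OF _ B], of "i - q" "j - q"] 
        by (simp add: N_def)
      moreover have "(i = j) = (j - q = i - q)" using 3 by auto
      ultimately show ?thesis using 3 that eq S(2) by (simp add: rowT colQ N_def)
    qed
  qed
  have "det (T * Q) = prod_list (diag_mat (T * Q))"
    using T Q TQ by (intro det_lower_triangular[where n = N]) auto
  also have "\<dots> = 1" using T Q TQ by (simp add: prod_list_diag_prod)
  finally have "det Q \<noteq> 0" using det_mult[OF T Q] by auto
  then obtain Q' where Q': "Q' \<in> carrier_mat N N" "Q * Q' = 1\<^sub>m N" using det_nonzero_inverse[OF Q] by metis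
  define u where "u = A' * R"
  have u: "u \<in> carrier_mat q q" unfolding u_def using A' R by simp
  have eq: "A' * Q = (u * A) * Q"
  proof (rule eq_matI)
    fix i j assume "i < dim_row ((u * A) * Q)" "j < dim_col ((u * A) * Q)"
    then have ij: "i < q" "j < N" using u Q by auto
    have L: "(A' * Q) $$ (i, j) = (if j < q then (A' * R) $$ (i, j) else (A' * B\<^sup>T) $$ (i, j - q))"
      using ij A' R(1) B Q by (auto simp: colQ N_def)
    have Rr: "((u * A) * Q) $$ (i, j) = (if j < q then ((u * A) * R) $$ (i, j) else ((u * A) * B\<^sup>T) $$ (i, j - q))"
      using ij A u R(1) B Q by (auto simp: colQ N_def)
    have "(u * A) * R = A' * R"
      using u A R right_mult_one_mat[OF u] by (simp add: assoc_mult_mat[OF u A R(1)] u_def)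
    moreover have "(u * A) * B\<^sup>T = 0\<^sub>m q p"
      using u A B AB0 by (simp add: assoc_mult_mat[OF u A, of "B\<^sup>T" p])
    ultimately show "(A' * Q) $$ (i, j) = ((u * A) * Q) $$ (i, j)" using L Rr A'B0 by simp
  qed (use u A' Q in auto)
  have "A' = A' * Q * Q'" using A' Q' Q by (simp add: assoc_mult_mat[OF A' Q Q'(1)])
  also have "\<dots> = u * A" unfolding eq
    using assoc_mult_mat[OF mult_carrier_mat[OF u A] Q Q'(1)] right_mult_one_mat[OF mult_carrier_mat[OF u A]] Q'(2)
    by simp
  finally have A'u: "A' = u * A" .
  have "u * (A * R') = 1\<^sub>m q" using R' u A A'u by (simp add: assoc_mult_mat[OF u A R'(1)])
  then have "det u \<noteq> 0" using det_nonzero_if_mult_one[OF u, of "A * R'"] A R' by auto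
  then show ?thesis using A'u u by blast
qed

text \<open>
The rows of \<open>A' H\<^sup>T\<close> are orthogonal to those of \<open>B\<close>, so uniqueness of the complement applies to \<open>A\<close> and
\<open>A' H\<^sup>T\<close>.
\<close>

lemma perp_equivariant:
  fixes A A' B B' :: "'a :: field mat"
  assumes AB: "perp p q A B" and AB': "perp p q A' B'"
    and g: "g \<in> carrier_mat p p" "det g \<noteq> 0" and H: "H \<in> carrier_mat (p + q) (p + q)" "det H \<noteq> 0"
    and B': "B' = g * B * H"
  shows "\<exists>u \<in> carrier_mat q q. det u \<noteq> 0 \<and> A' * H\<^sup>T = u * A"
proof -
  define N where "N = p + q"
  obtain R' S where B: "B \<in> carrier_mat p N" and S: "S \<in> carrier_mat N p" "B * S = 1\<^sub>m p"
    and A': "A' \<in> carrier_mat q N" and A'B0: "A' * B'\<^sup>T = 0\<^sub>m q p"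
    and R': "R' \<in> carrier_mat N q" "A' * R' = 1\<^sub>m q"
    using AB AB' unfolding perp_def N_def by blast
  note H = H[folded N_def]
  have HT: "H\<^sup>T \<in> carrier_mat N N" "det (H\<^sup>T) \<noteq> 0" using H det_transpose[OF H(1)] by auto
  have gT: "g\<^sup>T \<in> carrier_mat p p" "det (g\<^sup>T) \<noteq> 0" using g det_transpose[OF g(1)] by auto
  obtain H' where H': "H' \<in> carrier_mat N N" "H\<^sup>T * H' = 1\<^sub>m N" using det_nonzero_inverse[OF HT] by metis
  obtain g' where g': "g' \<in> carrier_mat p p" "g\<^sup>T * g' = 1\<^sub>m p" using det_nonzero_inverse[OF gT] by metis
  have AH: "A' * H\<^sup>T \<in> carrier_mat q N" using A' HT by simp
  have BT: "B\<^sup>T \<in> carrier_mat N p" using B by simp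
  have "B'\<^sup>T = H\<^sup>T * (B\<^sup>T * g\<^sup>T)"
    unfolding B' using transpose_mult[of "g * B" p N H N] transpose_mult[OF g(1) B] g B H by simp
  then have "A' * (H\<^sup>T * (B\<^sup>T * g\<^sup>T)) = 0\<^sub>m q p" using A'B0 by simp
  then have z: "A' * H\<^sup>T * B\<^sup>T * g\<^sup>T = 0\<^sub>m q p"
    using A' HT BT gT AH by (simp add: assoc_mult_mat[of _ q N _ N _ p] assoc_mult_mat[of _ q N _ p _ p])
  have "A' * H\<^sup>T * B\<^sup>T = A' * H\<^sup>T * B\<^sup>T * g\<^sup>T * g'"
    using AH BT gT g' assoc_mult_mat[OF mult_carrier_mat[OF AH BT] gT(1) g'(1)]
      right_mult_one_mat[OF mult_carrier_mat[OF AH BT]] by (simp del: assoc_mult_mat)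
  also have "\<dots> = 0\<^sub>m q p" using z g' by simp
  finally have perp0: "A' * H\<^sup>T * B\<^sup>T = 0\<^sub>m q p" .
  have "A' * H\<^sup>T * (H' * R') = A' * (H\<^sup>T * H') * R'"
    using assoc_mult_mat[OF AH H'(1) R'(1)] assoc_mult_mat[OF A' HT(1) H'(1)] by simp
  also have "\<dots> = 1\<^sub>m q" using A' H' R' by simp
  finally have "A' * H\<^sup>T * (H' * R') = 1\<^sub>m q" .
  then have "perp p q (A' * H\<^sup>T) B"
    unfolding perp_def using AH B perp0 H'(1) R'(1) S unfolding N_def[symmetric] by auto
  then show ?thesis using perp_unique[OF AB] by blast
qed

definition stack :: "nat \<Rightarrow> nat \<Rightarrow> 'a mat \<Rightarrow> 'a mat \<Rightarrow> 'a mat" where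
  "stack p N B C = mat N N (\<lambda>(i, j). if i < p then B $$ (i, j) else C $$ (i - p, j))"

text \<open>
If \<open>B\<close> is bordered by \<open>C\<close> to an invertible square matrix, the last columns of the inverse are
orthogonal to the rows of \<open>B\<close>. The adjugate replaces the inverse in order to stay polynomial in the
entries of \<open>B\<close>; the factor \<open>c\<close> allows the determinant to be cancelled at one chosen point.
\<close>

definition adj_tail :: "nat \<Rightarrow> nat \<Rightarrow> 'a :: field mat \<Rightarrow> 'a \<Rightarrow> 'a mat \<Rightarrow> 'a mat" where
  "adj_tail p q C c B = mat q (p + q) (\<lambda>(r, j). c * adj_mat (stack p (p + q) B C) $$ (j, p + r))"

lemma perp_adj_tail:
  fixes B C :: "'a :: field mat"
  assumes B: "B \<in> carrier_mat p (p + q)" and C: "C \<in> carrier_mat q (p + q)" and "c \<noteq> 0"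
    and det: "det (stack p (p + q) B C) \<noteq> 0"
  shows "perp p q (adj_tail p q C c B) B"
proof -
  define N where "N = p + q"
  define F where "F = stack p N B C"
  define A where "A = adj_tail p q C c B"
  have F: "F \<in> carrier_mat N N" unfolding F_def stack_def by simp
  have dF: "det F \<noteq> 0" using det unfolding F_def N_def .
  note adj = adj_mat[OF F]
  have A: "A \<in> carrier_mat q N" unfolding A_def adj_tail_def N_def by simp
  have rowA: "row A r = c \<cdot>\<^sub>v col (adj_mat F) (p + r)" if "r < q" for r
    using that adj(1) unfolding A_def adj_tail_def F_def N_def[symmetric]
    by (intro eq_vecI) (auto simp: N_def)
  have rowB: "row B i = row F i" if "i < p" for i
    using that B unfolding F_def stack_def by (intro eq_vecI) (auto simp: N_def)
  have rowC: "row C i = row F (p + i)" if "i < q" for i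
    using that C unfolding F_def stack_def by (intro eq_vecI) (auto simp: N_def)
  have prod: "row F i \<bullet> col (adj_mat F) j = (if i = j then det F else 0)" if "i < N" "j < N" for i j
  proof -
    have "row F i \<bullet> col (adj_mat F) j = (F * adj_mat F) $$ (i, j)" using that F adj(1) by simp
    then show ?thesis using adj(2) that by simp
  qed
  have AF: "row A r \<bullet> row F i = (if i = p + r then c * det F else 0)" if "r < q" "i < N" for r i
  proof -
    have "row A r \<bullet> row F i = row F i \<bullet> row A r"
      using A F that by (intro comm_scalar_prod[of _ N]) auto
    also have "\<dots> = c * (row F i \<bullet> col (adj_mat F) (p + r))"
      unfolding rowA[OF that(1)] using F adj(1) that
      by (intro scalar_prod_smult_distrib[of _ N] row_carrier_vec col_carrier_vec) (auto simp: N_def)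
    also have "\<dots> = (if i = p + r then c * det F else 0)" using prod that by (simp add: N_def)
    finally show ?thesis .
  qed
  have 1: "A * B\<^sup>T = 0\<^sub>m q p"
    using A B AF rowB by (intro eq_matI) (auto simp: N_def)
  have CT: "C\<^sup>T \<in> carrier_mat N q" using C unfolding N_def by simp
  have "A * C\<^sup>T = (c * det F) \<cdot>\<^sub>m 1\<^sub>m q"
    using A C AF rowC by (intro eq_matI) (auto simp: N_def)
  then have "A * (inverse (c * det F) \<cdot>\<^sub>m C\<^sup>T) = 1\<^sub>m q"
    using dF \<open>c \<noteq> 0\<close> mult_smult_distrib[OF A CT] by (intro eq_matI) (auto simp: field_simps)
  then have 2: "\<exists>R \<in> carrier_mat N q. A * R = 1\<^sub>m q" using CT by (intro bexI) auto
  define S where "S = mat N p (\<lambda>(i, j). inverse (det F) * adj_mat F $$ (i, j))"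
  have S: "S \<in> carrier_mat N p" unfolding S_def by simp
  have colS: "col S j = inverse (det F) \<cdot>\<^sub>v col (adj_mat F) j" if "j < p" for j
    using that adj(1) unfolding S_def by (intro eq_vecI) (auto simp: N_def)
  have "B * S = 1\<^sub>m p"
  proof (rule eq_matI)
    fix i j assume "i < dim_row (1\<^sub>m p :: 'a mat)" "j < dim_col (1\<^sub>m p :: 'a mat)"
    then have ij: "i < p" "j < p" by auto
    have "(B * S) $$ (i, j) = row F i \<bullet> col S j" using ij B S rowB by simp
    also have "\<dots> = inverse (det F) * (row F i \<bullet> col (adj_mat F) j)"
      unfolding colS[OF ij(2)] using F adj(1) ij
      by (intro scalar_prod_smult_distrib[of _ N] row_carrier_vec col_carrier_vec) (auto simp: N_def)
    also have "\<dots> = (1\<^sub>m p) $$ (i, j)" using prod ij dF by (simp add: N_def)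
    finally show "(B * S) $$ (i, j) = (1\<^sub>m p) $$ (i, j)" .
  qed (use B S in auto)
  then show ?thesis
    using 1 2 A B S unfolding perp_def A_def N_def[symmetric] by blast
qed

text \<open>
Complete \<open>A\<close> by unit rows on top to an invertible matrix \<open>E\<close>. The inverse transpose of \<open>E\<close>, cut after
\<open>p\<close> rows, gives \<open>B\<close> and \<open>C\<close>, because its own inverse is \<open>E\<^sup>T\<close>.
\<close>

lemma adj_tail_surj:
  fixes A :: "'a :: field mat"
  assumes A: "A \<in> carrier_mat q (p + q)" and det: "det (mat q q (\<lambda>(i, j). A $$ (i, p + j))) \<noteq> 0"
  obtains B C c where "B \<in> carrier_mat p (p + q)" "C \<in> carrier_mat q (p + q)" "c \<noteq> 0"
    "det (stack p (p + q) B C) \<noteq> 0" "A = adj_tail p q C c B"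
proof -
  define N where "N = p + q"
  define E where "E = four_block_mat (1\<^sub>m p) (0\<^sub>m p q)
    (mat q p (($$) A)) (mat q q (\<lambda>(i, j). A $$ (i, p + j)))"
  have E: "E \<in> carrier_mat N N" unfolding E_def N_def by auto
  have Eidx: "E $$ (p + r, j) = A $$ (r, j)" if "r < q" "j < N" for r j
    using that unfolding E_def N_def by (subst index_mat_four_block) auto
  have "det E = det (mat q q (\<lambda>(i, j). A $$ (i, p + j)))"
    unfolding E_def by (subst det_four_block_mat_upper_right_zero[where n = p and m = q]) auto
  then have "det E \<noteq> 0" using det by simp
  then obtain E' where E': "E' \<in> carrier_mat N N" "det E' \<noteq> 0" "E * E' = 1\<^sub>m N" "E' * E = 1\<^sub>m N"
    using det_nonzero_inverse[OF E] by metis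
  define F where "F = E'\<^sup>T"
  have F: "F \<in> carrier_mat N N" "det F \<noteq> 0" unfolding F_def using E' det_transpose[OF E'(1)] by auto
  define B where "B = mat p N (($$) F)"
  define C where "C = mat q N (\<lambda>(i, j). F $$ (p + i, j))"
  have BC: "B \<in> carrier_mat p N" "C \<in> carrier_mat q N" unfolding B_def C_def by auto
  have st: "stack p N B C = F"
    using F(1) unfolding stack_def B_def C_def by (intro eq_matI) (auto simp: N_def)
  note adj = adj_mat[OF F(1)]
  have EF: "E\<^sup>T * F = 1\<^sub>m N" unfolding F_def using transpose_mult[OF E'(1) E] E' by simp
  have "adj_mat F = (E\<^sup>T * F) * adj_mat F" using EF adj(1) by simp
  also have "\<dots> = E\<^sup>T * (det F \<cdot>\<^sub>m 1\<^sub>m N)" using E F adj by (simp add: assoc_mult_mat[of _ N N _ N _ N])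
  also have "\<dots> = det F \<cdot>\<^sub>m E\<^sup>T" using E by (simp add: mult_smult_distrib[of _ N N _ N])
  finally have adjF: "adj_mat F = det F \<cdot>\<^sub>m E\<^sup>T" .
  have "A = adj_tail p q C (inverse (det F)) B"
    unfolding adj_tail_def N_def[symmetric] st adjF using A E F(2) Eidx
    by (intro eq_matI) (auto simp: N_def)
  then show ?thesis using that[of B C "inverse (det F)"] BC st F(2) unfolding N_def by simp
qed

lemma polyfuns_adj_mat:
  assumes M: "\<And>x. M x \<in> carrier_mat N N"
    and p: "\<And>i j. i < N \<Longrightarrow> j < N \<Longrightarrow> (\<lambda>x. M x $$ (i, j)) \<in> polyfuns"
    and ij: "i < N" "j < N"
  shows "(\<lambda>x. adj_mat (M x) $$ (i, j)) \<in> polyfuns"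
proof -
  have "(\<lambda>x. det (mat_delete (M x) j i)) \<in> polyfuns"
  proof (rule polyfuns_det)
    fix x show "mat_delete (M x) j i \<in> carrier_mat (N - 1) (N - 1)"
      using mat_delete_carrier[OF M] .
  next
    fix a b assume "a < N - 1" "b < N - 1"
    then have "(\<lambda>x. mat_delete (M x) j i $$ (a, b)) =
        (\<lambda>x. M x $$ (if a < j then a else Suc a, if b < i then b else Suc b))"
      using M unfolding mat_delete_def by (intro ext) (auto simp: carrier_matD[OF M])
    then show "(\<lambda>x. mat_delete (M x) j i $$ (a, b)) \<in> polyfuns"
      using p \<open>a < N - 1\<close> \<open>b < N - 1\<close> by auto
  qed
  then have "(\<lambda>x. (-1) ^ (j + i) * det (mat_delete (M x) j i)) \<in> polyfuns"
    by (intro polyfuns.mult polyfuns.const)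
  then show ?thesis
    using ij M unfolding adj_mat_def cofactor_def by (auto simp: carrier_matD[OF M])
qed


section \<open>Matrices cut into column blocks\<close>

text \<open>
The columns of a matrix with \<open>N\<close> columns are distributed over \<open>k\<close> blocks: column \<open>j\<close> is column \<open>po j\<close> of
block \<open>bi j\<close>. Working with an arbitrary bijection avoids computing with partial sums of the block sizes.
\<close>

locale column_blocks =
  fixes k :: nat and d :: "nat \<Rightarrow> nat" and N :: nat and bi po :: "nat \<Rightarrow> nat"
  assumes bij: "bij_betw (\<lambda>j. (bi j, po j)) {..<N} (SIGMA i:{..<k}. {..<d i})"
begin

lemma N_eq: "N = (\<Sum>i<k. d i)"
  using bij_betw_same_card[OF bij] by simp

lemma bi_less: "j < N \<Longrightarrow> bi j < k" and po_less: "j < N \<Longrightarrow> po j < d (bi j)"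
  using bij unfolding bij_betw_def by auto

lemma index_inj: "i < N \<Longrightarrow> j < N \<Longrightarrow> bi i = bi j \<Longrightarrow> po i = po j \<Longrightarrow> i = j"
  using bij unfolding bij_betw_def inj_on_def by auto

lemma index_ex:
  assumes "i < k" "c < d i"
  obtains j where "j < N" "bi j = i" "po j = c"
proof -
  have "(i, c) \<in> (\<lambda>j. (bi j, po j)) ` {..<N}" using assms bij unfolding bij_betw_def by auto
  then show ?thesis using that by auto
qed

lemma sum_columns: "(\<Sum>j<N. f (bi j) (po j)) = (\<Sum>i<k. \<Sum>c<d i. f i c)"
proof -
  have "(\<Sum>j<N. f (bi j) (po j)) = (\<Sum>(i, c)\<in>(SIGMA i:{..<k}. {..<d i}). f i c)"
    using sum.reindex_bij_betw[OF bij, of "\<lambda>(i, c). f i c"] by simp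
  then show ?thesis by (simp add: sum.Sigma)
qed

definition hcat :: "nat \<Rightarrow> (nat \<Rightarrow> 'a mat) \<Rightarrow> 'a mat" where
  "hcat m X = mat m N (\<lambda>(r, j). X (bi j) $$ (r, po j))"

definition bdiag :: "(nat \<Rightarrow> 'a :: field mat) \<Rightarrow> 'a mat" where
  "bdiag h = mat N N (\<lambda>(j, j'). if bi j = bi j' then h (bi j) $$ (po j, po j') else 0)"

lemma hcat_carrier [simp]: "hcat m X \<in> carrier_mat m N"
  unfolding hcat_def by simp

lemma bdiag_carrier [simp]: "bdiag h \<in> carrier_mat N N"
  unfolding bdiag_def by simp

lemma hcat_dim [simp]: "dim_row (hcat m X) = m" "dim_col (hcat m X) = N"
  unfolding hcat_def by simp_all

lemma bdiag_dim [simp]: "dim_row (bdiag h) = N" "dim_col (bdiag h) = N"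
  unfolding bdiag_def by simp_all

lemma hcat_cong: "(\<And>i. i < k \<Longrightarrow> X i = Y i) \<Longrightarrow> hcat m X = hcat m Y"
  unfolding hcat_def using bi_less by (intro cong_mat) auto

lemma hcat_inject:
  assumes eq: "hcat m X = hcat m Y" and X: "X i \<in> carrier_mat m (d i)" and Y: "Y i \<in> carrier_mat m (d i)"
    and "i < k"
  shows "X i = Y i"
proof (rule eq_matI)
  fix r c assume "r < dim_row (Y i)" "c < dim_col (Y i)"
  then have rc: "r < m" "c < d i" using Y by auto
  obtain j where j: "j < N" "bi j = i" "po j = c" using index_ex[OF \<open>i < k\<close> rc(2)] .
  have "hcat m X $$ (r, j) = hcat m Y $$ (r, j)" using eq by simp
  then show "X i $$ (r, c) = Y i $$ (r, c)" using rc j unfolding hcat_def by simp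
qed (use X Y in auto)

lemma hcat_left:
  assumes "g \<in> carrier_mat m' m" "\<And>i. i < k \<Longrightarrow> X i \<in> carrier_mat m (d i)"
  shows "hcat m' (\<lambda>i. g * X i) = g * hcat m X"
proof (rule eq_matI)
  fix r j assume "r < dim_row (g * hcat m X)" "j < dim_col (g * hcat m X)"
  then have rj: "r < m'" "j < N" using assms(1) hcat_carrier[of m X] by auto
  note X = assms(2)[OF bi_less[OF rj(2)]]
  have "col (hcat m X) j = col (X (bi j)) (po j)"
    using rj X po_less[OF rj(2)] unfolding hcat_def by (intro eq_vecI) auto
  then show "hcat m' (\<lambda>i. g * X i) $$ (r, j) = (g * hcat m X) $$ (r, j)"
    using rj X assms(1) po_less[OF rj(2)] hcat_carrier[of m X] by (simp add: hcat_def[of m'])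
qed (use assms(1) in \<open>auto simp: hcat_def\<close>)

lemma hcat_right:
  assumes "\<And>i. i < k \<Longrightarrow> X i \<in> carrier_mat m (d i)" "\<And>i. i < k \<Longrightarrow> h i \<in> carrier_mat (d i) (d i)"
  shows "hcat m (\<lambda>i. X i * h i) = hcat m X * bdiag h"
proof (rule eq_matI)
  fix r j assume "r < dim_row (hcat m X * bdiag h)" "j < dim_col (hcat m X * bdiag h)"
  then have rj: "r < m" "j < N" using hcat_carrier[of m X] bdiag_carrier[of h] by auto
  note b = bi_less[OF rj(2)] po_less[OF rj(2)]
  note X = assms(1)[OF b(1)] and h = assms(2)[OF b(1)]
  have "(hcat m X * bdiag h) $$ (r, j) = (\<Sum>l<N. X (bi l) $$ (r, po l) *
      (if bi l = bi j then h (bi l) $$ (po l, po j) else 0))"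
    using rj hcat_carrier[of m X] bdiag_carrier[of h]
    by (simp add: scalar_prod_def hcat_def bdiag_def lessThan_atLeast0)
  also have "\<dots> = (\<Sum>i<k. \<Sum>c<d i. X i $$ (r, c) * (if i = bi j then h i $$ (c, po j) else 0))"
    by (rule sum_columns)
  also have "\<dots> = (\<Sum>i<k. if i = bi j then \<Sum>c<d i. X i $$ (r, c) * h i $$ (c, po j) else 0)"
    by (intro sum.cong) auto
  also have "\<dots> = (\<Sum>c<d (bi j). X (bi j) $$ (r, c) * h (bi j) $$ (c, po j))"
    using b(1) by (simp add: sum.delta)
  also have "\<dots> = (X (bi j) * h (bi j)) $$ (r, po j)"
    using rj b X h by (simp add: scalar_prod_def lessThan_atLeast0)
  finally show "hcat m (\<lambda>i. X i * h i) $$ (r, j) = (hcat m X * bdiag h) $$ (r, j)"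
    using rj by (simp add: hcat_def[of m "\<lambda>i. X i * h i"])
qed (auto simp: hcat_def bdiag_def)

text \<open>
The blocks of the identity matrix. Writing a block diagonal matrix as a concatenation of products with
them reduces its multiplication to that of concatenations.
\<close>

definition block_cols :: "nat \<Rightarrow> 'a :: field mat" where
  "block_cols i = mat N (d i) (\<lambda>(j, c). if bi j = i \<and> po j = c then 1 else 0)"

lemma block_cols_carrier: "block_cols i \<in> carrier_mat N (d i)"
  unfolding block_cols_def by simp

lemma hcat_block_cols: "hcat N block_cols = 1\<^sub>m N"
  unfolding hcat_def block_cols_def using po_less index_inj by (intro eq_matI) auto

lemma bdiag_mult:
  assumes h: "\<And>i. i < k \<Longrightarrow> h i \<in> carrier_mat (d i) (d i)"
    and h': "\<And>i. i < k \<Longrightarrow> h' i \<in> carrier_mat (d i) (d i)"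
  shows "bdiag (\<lambda>i. h i * h' i) = bdiag h * bdiag h'"
proof -
  have 1: "bdiag g = hcat N (\<lambda>i. block_cols i * g i)"
    if "\<And>i. i < k \<Longrightarrow> g i \<in> carrier_mat (d i) (d i)" for g
    using hcat_right[OF block_cols_carrier that] left_mult_one_mat[OF bdiag_carrier, of g]
    unfolding hcat_block_cols by simp
  have "bdiag (\<lambda>i. h i * h' i) = hcat N (\<lambda>i. block_cols i * (h i * h' i))"
    by (rule 1) (rule mult_carrier_mat[OF h h'])
  also have "\<dots> = hcat N (\<lambda>i. block_cols i * h i * h' i)"
    using assoc_mult_mat[OF block_cols_carrier h h'] by (intro hcat_cong) simp
  also have "\<dots> = hcat N (\<lambda>i. block_cols i * h i) * bdiag h'"
    by (rule hcat_right[OF mult_carrier_mat[OF block_cols_carrier h] h'])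
  also have "\<dots> = bdiag h * bdiag h'" using 1[OF h] by simp
  finally show ?thesis .
qed

lemma bdiag_one: "bdiag (\<lambda>i. 1\<^sub>m (d i)) = 1\<^sub>m N"
proof (rule eq_matI)
  fix i j assume "i < dim_row (1\<^sub>m N)" "j < dim_col (1\<^sub>m N)"
  then have ij: "i < N" "j < N" by auto
  then show "bdiag (\<lambda>i. 1\<^sub>m (d i)) $$ (i, j) = 1\<^sub>m N $$ (i, j)"
    using po_less[OF ij(1)] po_less[OF ij(2)] index_inj[OF ij] by (auto simp: bdiag_def)
qed auto

lemma bdiag_cong: "(\<And>i. i < k \<Longrightarrow> h i = h' i) \<Longrightarrow> bdiag h = bdiag h'"
  unfolding bdiag_def using bi_less by (intro cong_mat) auto

lemma det_bdiag_nonzero: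
  assumes h: "\<And>i. i < k \<Longrightarrow> h i \<in> carrier_mat (d i) (d i)" "\<And>i. i < k \<Longrightarrow> det (h i) \<noteq> 0"
  shows "det (bdiag h) \<noteq> 0"
proof -
  have "\<forall>i. \<exists>h'. i < k \<longrightarrow> h' \<in> carrier_mat (d i) (d i) \<and> h i * h' = 1\<^sub>m (d i)"
    using det_nonzero_inverse[OF h] by metis
  then obtain h' where h': "\<And>i. i < k \<Longrightarrow> h' i \<in> carrier_mat (d i) (d i)"
    "\<And>i. i < k \<Longrightarrow> h i * h' i = 1\<^sub>m (d i)" by metis
  have "bdiag h * bdiag h' = bdiag (\<lambda>i. h i * h' i)" using bdiag_mult[of h h'] h h' by simp
  also have "\<dots> = 1\<^sub>m N" unfolding bdiag_one[symmetric] using h' by (intro bdiag_cong) auto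
  finally show ?thesis using det_nonzero_if_mult_one[OF bdiag_carrier bdiag_carrier] by blast
qed

lemma bdiag_transpose:
  assumes "\<And>i. i < k \<Longrightarrow> h i \<in> carrier_mat (d i) (d i)"
  shows "(bdiag h)\<^sup>T = bdiag (\<lambda>i. (h i)\<^sup>T)"
proof (rule eq_matI)
  fix i j assume "i < dim_row (bdiag (\<lambda>i. (h i)\<^sup>T))" "j < dim_col (bdiag (\<lambda>i. (h i)\<^sup>T))"
  then have ij: "i < N" "j < N" by (auto simp: bdiag_def)
  have "bi i = bi j \<Longrightarrow> po i < d (bi j)" using po_less[OF ij(1)] by simp
  then show "(bdiag h)\<^sup>T $$ (i, j) = bdiag (\<lambda>i. (h i)\<^sup>T) $$ (i, j)"
    using ij assms[OF bi_less[OF ij(2)]] po_less[OF ij(2)] by (auto simp: bdiag_def)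
qed (auto simp: bdiag_def)

end

lemma column_blocks_exist: "\<exists>bi po. column_blocks k d (\<Sum>i<k. d i) bi po"
proof -
  have "card (SIGMA i:{..<k}. {..<d i}) = (\<Sum>i<k. d i)" by simp
  then obtain f where "bij_betw f {0..<(\<Sum>i<k. d i)} (SIGMA i:{..<k}. {..<d i})"
    using ex_bij_betw_nat_finite[of "SIGMA i:{..<k}. {..<d i}"] by auto
  then have "column_blocks k d (\<Sum>i<k. d i) (\<lambda>j. fst (f j)) (\<lambda>j. snd (f j))"
    by unfold_locales (simp add: lessThan_atLeast0)
  then show ?thesis by blast
qed

section \<open>Tuples of matrices with a dense orbit\<close>

text \<open>
The matrix \<open>g\<close> moves all subspaces simultaneously, and \<open>h i\<close> changes the basis of the subspace with
index \<open>i\<close>.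
\<close>

definition conf_equiv ::
    "nat \<Rightarrow> nat \<Rightarrow> (nat \<Rightarrow> nat) \<Rightarrow> (nat \<Rightarrow> 'a :: field mat) \<Rightarrow> (nat \<Rightarrow> 'a mat) \<Rightarrow> bool" where
  "conf_equiv k n d A B \<longleftrightarrow> (\<exists>g h. g \<in> carrier_mat n n \<and> det g \<noteq> 0 \<and>
     (\<forall>i<k. h i \<in> carrier_mat (d i) (d i) \<and> det (h i) \<noteq> 0 \<and> B i = g * A i * h i))"

text \<open>
A tuple of matrices is read off from a point of an affine space whose coordinates are indexed by block,
row and column. The index set of the coordinates is the same for all sizes, so that one affine space
serves all dimension vectors.
\<close>

definition blk :: "nat \<Rightarrow> (nat \<Rightarrow> nat) \<Rightarrow> (nat \<times> nat \<times> nat \<Rightarrow> 'a) \<Rightarrow> nat \<Rightarrow> 'a mat" where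
  "blk n d x i = mat n (d i) (\<lambda>(r, c). x (i, r, c))"

definition generic_orbit :: "'a :: field itself \<Rightarrow> nat \<Rightarrow> nat \<Rightarrow> (nat \<Rightarrow> nat) \<Rightarrow> bool" where
  "generic_orbit _ k n d \<longleftrightarrow> (\<exists>S :: (nat \<times> nat \<times> nat \<Rightarrow> 'a) set. zdense S \<and>
     (\<forall>x\<in>S. \<forall>y\<in>S. conf_equiv k n d (blk n d x) (blk n d y)))"

lemma blk_carrier [simp]: "blk n d x i \<in> carrier_mat n (d i)"
  unfolding blk_def by simp

lemma blk_dim [simp]: "dim_row (blk n d x i) = n" "dim_col (blk n d x i) = d i"
  unfolding blk_def by simp_all

lemma conf_equivI:
  assumes "g \<in> carrier_mat n n" "det g \<noteq> 0"
    and "\<And>i. i < k \<Longrightarrow> \<exists>h \<in> carrier_mat (d i) (d i). det h \<noteq> 0 \<and> B i = g * A i * h"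
  shows "conf_equiv k n d A B"
proof -
  obtain h where "\<And>i. i < k \<Longrightarrow> h i \<in> carrier_mat (d i) (d i) \<and> det (h i) \<noteq> 0 \<and> B i = g * A i * h i"
    using assms(3) by metis
  then show ?thesis using assms(1,2) unfolding conf_equiv_def by blast
qed

lemma generic_orbitI:
  fixes S :: "(nat \<times> nat \<times> nat \<Rightarrow> 'a :: field) set"
  assumes "zdense S" "\<And>x y. x \<in> S \<Longrightarrow> y \<in> S \<Longrightarrow> conf_equiv k n d (blk n d x) (blk n d y)"
  shows "generic_orbit TYPE('a) k n d"
  unfolding generic_orbit_def by (rule exI[of _ S]) (simp add: assms)

lemma generic_orbitE:
  assumes "generic_orbit TYPE('a :: field) k n d"
  obtains S :: "(nat \<times> nat \<times> nat \<Rightarrow> 'a :: field) set" where "zdense S"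
    "\<forall>x\<in>S. \<forall>y\<in>S. conf_equiv k n d (blk n d x) (blk n d y)"
  using assms unfolding generic_orbit_def by (elim exE conjE) (rule that)

lemma conf_equivE:
  assumes "conf_equiv k n d A B"
  obtains g h where "g \<in> carrier_mat n n" "det g \<noteq> 0"
    "\<forall>i<k. h i \<in> carrier_mat (d i) (d i) \<and> det (h i) \<noteq> 0 \<and> B i = g * A i * h i"
  using assms unfolding conf_equiv_def by (elim exE conjE) (rule that)

lemma generic_orbit_fewer:
  assumes "generic_orbit TYPE('a :: field) k n d" "k' \<le> k"
    and d': "\<And>i. i < k' \<Longrightarrow> d' i = d i \<or> d' i = 0"
  shows "generic_orbit TYPE('a) k' n d'"
proof -
  obtain S :: "(nat \<times> nat \<times> nat \<Rightarrow> 'a) set" where S: "zdense S"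
    "\<forall>x\<in>S. \<forall>y\<in>S. conf_equiv k n d (blk n d x) (blk n d y)"
    by (rule generic_orbitE[OF assms(1)])
  have "conf_equiv k' n d' (blk n d' x) (blk n d' y)" if xy: "x \<in> S" "y \<in> S" for x y
  proof -
    obtain g h where g: "g \<in> carrier_mat n n" "det g \<noteq> 0"
      and h: "\<forall>i<k. h i \<in> carrier_mat (d i) (d i) \<and> det (h i) \<noteq> 0 \<and> blk n d y i = g * blk n d x i * h i"
      by (rule conf_equivE[OF S(2)[rule_format, OF xy]])
    show ?thesis
    proof (rule conf_equivI[OF g])
      fix i assume i: "i < k'"
      show "\<exists>h \<in> carrier_mat (d' i) (d' i). det h \<noteq> 0 \<and> blk n d' y i = g * blk n d' x i * h"
      proof (cases "d' i = d i")
        case True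
        then have same: "blk n d' z i = blk n d z i" for z :: "nat \<times> nat \<times> nat \<Rightarrow> 'a" unfolding blk_def by simp
        have "i < k" using i \<open>k' \<le> k\<close> by simp
        then show ?thesis using h[rule_format, of i] unfolding same True by (intro bexI[of _ "h i"]) auto
      next
        case False
        then have "d' i = 0" using d'[OF i] by blast
        then have "blk n d' y i = g * blk n d' x i * 1\<^sub>m 0" using g(1) by (intro eq_matI) auto
        then show ?thesis using \<open>d' i = 0\<close> by (intro bexI[of _ "1\<^sub>m 0"]) auto
      qed
    qed
  qed
  with S(1) show ?thesis by (rule generic_orbitI)
qed

text \<open>
Tuples of independent subspaces are all equivalent, even without changing the bases: any matrix with
linearly independent columns is carried to any other by an invertible matrix on the left.
\<close>

lemma generic_orbit_independent:
  assumes le: "(\<Sum>i<k. d i) \<le> n"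
  shows "generic_orbit TYPE('a :: alg_closed_field) k n d"
proof -
  define N where "N = (\<Sum>i<k. d i)"
  obtain bi po where "column_blocks k d N bi po" using column_blocks_exist unfolding N_def by blast
  then interpret column_blocks k d N bi po .
  define q where "q x = det (mat N N (\<lambda>(r, j). x (bi j, r, po j)))" for x :: "nat \<times> nat \<times> nat \<Rightarrow> 'a"
  have q: "q \<in> polyfuns"
    unfolding q_def by (rule polyfuns_det[where N = N]) (auto intro: polyfuns.coord)
  \<comment> \<open>the point whose concatenated matrix has the identity as its top square\<close>
  define x0 :: "nat \<times> nat \<times> nat \<Rightarrow> 'a" where
    "x0 = (\<lambda>(i, r, c). if r < N \<and> bi r = i \<and> po r = c then 1 else 0)"
  have "mat N N (\<lambda>(r, j). x0 (bi j, r, po j)) = 1\<^sub>m N"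
    unfolding x0_def using index_inj by (intro eq_matI) auto
  then have "q x0 \<noteq> 0" unfolding q_def by simp
  then have "zdense {x. q x \<noteq> 0}" by (rule zdense_principal[OF q])
  moreover have "conf_equiv k n d (blk n d x) (blk n d y)" if "q x \<noteq> 0" "q y \<noteq> 0" for x y
  proof -
    have top: "mat N N (($$) (hcat n (blk n d x))) = mat N N (\<lambda>(r, j). x (bi j, r, po j))" for x :: "nat \<times> nat \<times> nat \<Rightarrow> 'a"
      using le po_less unfolding hcat_def blk_def N_def[symmetric] by (intro eq_matI) auto
    have "\<exists>g \<in> carrier_mat n n. det g \<noteq> 0 \<and> hcat n (blk n d y) = g * hcat n (blk n d x)"
    proof (rule tall_mat_transitive)
      show "N \<le> n" using le unfolding N_def .
    qed (use that in \<open>simp_all add: top q_def\<close>)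
    then obtain g where g: "g \<in> carrier_mat n n" "det g \<noteq> 0" "hcat n (blk n d y) = g * hcat n (blk n d x)"
      by (elim bexE conjE) (rule that)
    have "hcat n (blk n d y) = hcat n (\<lambda>i. g * blk n d x i)" using g hcat_left[OF g(1)] by simp
    then have eq: "blk n d y i = g * blk n d x i" if "i < k" for i
      using hcat_inject[of n "blk n d y"] g(1) that by auto
    show ?thesis
    proof (rule conf_equivI[OF g(1,2)])
      fix i assume "i < k"
      then show "\<exists>h \<in> carrier_mat (d i) (d i). det h \<noteq> 0 \<and> blk n d y i = g * blk n d x i * h"
        using eq right_mult_one_mat[OF mult_carrier_mat[OF g(1) blk_carrier]]
        by (intro bexI[of _ "1\<^sub>m (d i)"]) auto
    qed
  qed
  ultimately show ?thesis by (rule generic_orbitI) auto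
qed

text \<open>
A generic subspace spanned by \<open>d l \<ge> n\<close> vectors is the whole space and imposes no condition, so it may
be dropped.
\<close>

lemma generic_orbit_full_space:
  assumes P: "generic_orbit TYPE('a :: alg_closed_field) k n (d(l := 0))" and le: "n \<le> d l"
  shows "generic_orbit TYPE('a) k n d"
proof -
  obtain S :: "(nat \<times> nat \<times> nat \<Rightarrow> 'a) set" where S: "zdense S"
    "\<forall>x\<in>S. \<forall>y\<in>S. conf_equiv k n (d(l := 0)) (blk n (d(l := 0)) x) (blk n (d(l := 0)) y)"
    by (rule generic_orbitE[OF P])
  define q where "q x = det (mat n n (\<lambda>(r, j). x (l, r, j)))" for x :: "nat \<times> nat \<times> nat \<Rightarrow> 'a"
  have q: "q \<in> polyfuns"
    unfolding q_def by (rule polyfuns_det[where N = n]) (auto intro: polyfuns.coord)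
  define x0 :: "nat \<times> nat \<times> nat \<Rightarrow> 'a" where "x0 = (\<lambda>(i, r, c). if r = c then 1 else 0)"
  have "mat n n (\<lambda>(r, j). x0 (l, r, j)) = 1\<^sub>m n" unfolding x0_def by (intro eq_matI) auto
  then have "q x0 \<noteq> 0" unfolding q_def by simp
  then have "zdense {x \<in> S. q x \<noteq> 0}" by (rule zdense_restrict[OF S(1) q])
  moreover have "conf_equiv k n d (blk n d x) (blk n d y)" if xy: "x \<in> S" "q x \<noteq> 0" "y \<in> S" "q y \<noteq> 0" for x y
  proof -
    obtain g h where g: "g \<in> carrier_mat n n" "det g \<noteq> 0"
      and h: "\<forall>i<k. h i \<in> carrier_mat ((d(l := 0)) i) ((d(l := 0)) i) \<and> det (h i) \<noteq> 0 \<and>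
        blk n (d(l := 0)) y i = g * blk n (d(l := 0)) x i * h i"
      by (rule conf_equivE[OF S(2)[rule_format, OF xy(1,3)]])
    have left: "mat n n (($$) (blk n d x l)) = mat n n (\<lambda>(r, j). x (l, r, j))" for x :: "nat \<times> nat \<times> nat \<Rightarrow> 'a"
      using le unfolding blk_def by (intro eq_matI) auto
    have "mat n n (($$) (g * blk n d x l)) = g * mat n n (($$) (blk n d x l))"
    proof (rule eq_matI)
      fix i j assume "i < dim_row (g * mat n n (($$) (blk n d x l)))" "j < dim_col (g * mat n n (($$) (blk n d x l)))"
      then have ij: "i < n" "j < n" using g by auto
      have "col (mat n n (($$) (blk n d x l))) j = col (blk n d x l) j"
        using ij le by (intro eq_vecI) (auto simp: blk_def)
      then show "mat n n (($$) (g * blk n d x l)) $$ (i, j) = (g * mat n n (($$) (blk n d x l))) $$ (i, j)"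
        using ij le g(1) blk_carrier[of n d x l] by auto
    qed (use g in auto)
    then have "det (mat n n (($$) (g * blk n d x l))) \<noteq> 0"
      using g xy(2) det_mult[OF g(1) mat_carrier] unfolding left q_def by simp
    then have "\<exists>H \<in> carrier_mat (d l) (d l). det H \<noteq> 0 \<and> blk n d y l = g * blk n d x l * H"
      using g(1) le xy(4) left unfolding q_def by (intro wide_mat_transitive[of _ n]) auto
    then obtain H where H: "H \<in> carrier_mat (d l) (d l)" "det H \<noteq> 0" "blk n d y l = g * blk n d x l * H"
      by (elim bexE conjE) (rule that)
    show ?thesis
    proof (rule conf_equivI[OF g])
      fix i assume i: "i < k"
      show "\<exists>h \<in> carrier_mat (d i) (d i). det h \<noteq> 0 \<and> blk n d y i = g * blk n d x i * h"
      proof (cases "i = l")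
        case True
        then show ?thesis using H by blast
      next
        case False
        then have same: "blk n (d(l := 0)) z i = blk n d z i" for z :: "nat \<times> nat \<times> nat \<Rightarrow> 'a" unfolding blk_def by simp
        have "(d(l := 0)) i = d i" using False by simp
        then show ?thesis using h[rule_format, OF i] unfolding same by (intro bexI[of _ "h i"]) auto
      qed
    qed
  qed
  ultimately show ?thesis by (rule generic_orbitI) auto
qed


section \<open>Duality and Gale duality\<close>

lemma polyfuns_stack:
  assumes "\<And>i j. i < p \<Longrightarrow> j < N \<Longrightarrow> (\<lambda>x. B x $$ (i, j)) \<in> polyfuns" "i < N" "j < N"
  shows "(\<lambda>x. stack p N (B x) C $$ (i, j)) \<in> polyfuns"
proof (cases "i < p")
  case True
  then show ?thesis using assms unfolding stack_def by simp
next
  case False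
  then show ?thesis using assms polyfuns.const unfolding stack_def by simp
qed

lemma stack_carrier: "stack p N B C \<in> carrier_mat N N"
  unfolding stack_def by simp

lemma polyfuns_det_stack:
  assumes "\<And>i j. i < p \<Longrightarrow> j < N \<Longrightarrow> (\<lambda>x. B x $$ (i, j)) \<in> polyfuns"
  shows "(\<lambda>x. det (stack p N (B x) C)) \<in> polyfuns"
  by (rule polyfuns_det[OF stack_carrier polyfuns_stack]) (use assms in auto)

lemma polyfuns_adj_tail:
  assumes "\<And>i j. i < p \<Longrightarrow> j < p + q \<Longrightarrow> (\<lambda>x. B x $$ (i, j)) \<in> polyfuns" "r < q" "j < p + q"
  shows "(\<lambda>x. adj_tail p q C c (B x) $$ (r, j)) \<in> polyfuns"
proof -
  have "(\<lambda>x. c * adj_mat (stack p (p + q) (B x) C) $$ (j, p + r)) \<in> polyfuns"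
    by (rule polyfuns.mult[OF polyfuns.const polyfuns_adj_mat[OF stack_carrier polyfuns_stack]])
      (use assms in auto)
  then show ?thesis using assms(2,3) unfolding adj_tail_def by simp
qed

lemma adj_tail_carrier: "adj_tail p q C c B \<in> carrier_mat q (p + q)"
  unfolding adj_tail_def by simp

text \<open>
Passing to the orthogonal complement of each column space: equivalent tuples have equivalent
complements, where the roles of \<open>g\<close> and of its inverse transpose are exchanged. The dense set for
\<open>d\<close> consists of the tuples whose complements lie in the dense set for \<open>n - d\<close>.
\<close>

lemma generic_orbit_dual:
  assumes le: "\<And>i. i < k \<Longrightarrow> d i \<le> n"
    and P: "generic_orbit TYPE('a :: alg_closed_field) k n (\<lambda>i. n - d i)"
  shows "generic_orbit TYPE('a) k n d"
proof -
  define d' where "d' = (\<lambda>i. n - d i)"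
  obtain T :: "(nat \<times> nat \<times> nat \<Rightarrow> 'a) set" where T: "zdense T"
    "\<forall>x\<in>T. \<forall>y\<in>T. conf_equiv k n d' (blk n d' x) (blk n d' y)"
    by (rule generic_orbitE[OF P[folded d'_def]])
  have sum: "d' i + d i = n" if "i < k" for i using le[OF that] unfolding d'_def by simp
  define A :: "(nat \<times> nat \<times> nat \<Rightarrow> 'a) \<Rightarrow> nat \<Rightarrow> 'a mat" where "A x i = (blk n d x i)\<^sup>T" for x i
  define B :: "(nat \<times> nat \<times> nat \<Rightarrow> 'a) \<Rightarrow> nat \<Rightarrow> 'a mat" where "B y i = (blk n d' y i)\<^sup>T" for y i
  define S where "S = {x. \<exists>y\<in>T. \<forall>i<k. perp (d' i) (d i) (A x i) (B y i)}"
  have Bpoly: "(\<lambda>y. B y i $$ (a, b)) \<in> polyfuns" if "a < d' i" "b < n" for i a b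
    using that polyfuns.coord unfolding B_def blk_def by simp
  \<comment> \<open>approximation is only needed where the last rows of every block form an invertible square,
    the situation of \<open>adj_tail_surj\<close>\<close>
  define r where "r x = (\<Prod>i<k. det (mat (d i) (d i) (\<lambda>(a, b). A x i $$ (a, d' i + b))))" for x
  have r: "r \<in> polyfuns"
    unfolding r_def
  proof (rule polyfuns_prod, rule polyfuns_det)
    fix i a b assume "i \<in> {..<k}" "a < d i" "b < d i"
    then show "(\<lambda>x. mat (d i) (d i) (\<lambda>(a, b). A x i $$ (a, d' i + b)) $$ (a, b)) \<in> polyfuns"
      using sum[of i] polyfuns.coord unfolding A_def blk_def by simp
  qed simp
  define x0 :: "nat \<times> nat \<times> nat \<Rightarrow> 'a" where "x0 = (\<lambda>(i, r, c). if r = d' i + c then 1 else 0)"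
  have "mat (d i) (d i) (\<lambda>(a, b). A x0 i $$ (a, d' i + b)) = 1\<^sub>m (d i)" if "i < k" for i
    using sum[OF that] unfolding A_def blk_def x0_def by (intro eq_matI) auto
  then have r0: "r x0 \<noteq> 0" unfolding r_def by simp
  have "zdense S"
  proof (rule zdense_transfer[OF T(1) r r0])
    fix x assume rx: "r x \<noteq> 0"
    have "\<forall>i\<in>{..<k}. \<exists>z. fst z \<in> carrier_mat (d' i) n \<and> fst (snd z) \<in> carrier_mat (d i) n \<and> snd (snd z) \<noteq> 0 \<and>
        det (stack (d' i) n (fst z) (fst (snd z))) \<noteq> 0 \<and>
        A x i = adj_tail (d' i) (d i) (fst (snd z)) (snd (snd z)) (fst z)"
    proof
      fix i assume "i \<in> {..<k}"
      then have i: "i < k" by simp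
      have "A x i \<in> carrier_mat (d i) (d' i + d i)" unfolding A_def sum[OF i] by simp
      moreover have "det (mat (d i) (d i) (\<lambda>(a, b). A x i $$ (a, d' i + b))) \<noteq> 0"
        using rx i unfolding r_def by auto
      ultimately obtain B0 C c where "B0 \<in> carrier_mat (d' i) (d' i + d i)" "C \<in> carrier_mat (d i) (d' i + d i)"
          "c \<noteq> 0" "det (stack (d' i) (d' i + d i) B0 C) \<noteq> 0" "A x i = adj_tail (d' i) (d i) C c B0"
        by (rule adj_tail_surj)
      then show "\<exists>z. fst z \<in> carrier_mat (d' i) n \<and> fst (snd z) \<in> carrier_mat (d i) n \<and> snd (snd z) \<noteq> 0 \<and>
        det (stack (d' i) n (fst z) (fst (snd z))) \<noteq> 0 \<and>
        A x i = adj_tail (d' i) (d i) (fst (snd z)) (snd (snd z)) (fst z)"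
        unfolding sum[OF i] by (intro exI[of _ "(B0, C, c)"]) simp
    qed
    from bchoice[OF this] obtain z where z: "\<forall>i\<in>{..<k}. fst (z i) \<in> carrier_mat (d' i) n \<and>
        fst (snd (z i)) \<in> carrier_mat (d i) n \<and> snd (snd (z i)) \<noteq> 0 \<and>
        det (stack (d' i) n (fst (z i)) (fst (snd (z i)))) \<noteq> 0 \<and>
        A x i = adj_tail (d' i) (d i) (fst (snd (z i))) (snd (snd (z i))) (fst (z i))" ..
    define B0 C c where "B0 i = fst (z i)" "C i = fst (snd (z i))" "c i = snd (snd (z i))" for i
    have B0: "B0 i \<in> carrier_mat (d' i) n" and C: "C i \<in> carrier_mat (d i) n" and c: "c i \<noteq> 0"
      and det0: "det (stack (d' i) n (B0 i) (C i)) \<noteq> 0"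
      and Ax: "A x i = adj_tail (d' i) (d i) (C i) (c i) (B0 i)" if "i < k" for i
      using z that unfolding B0_C_c_def by auto
    define tl where "tl y i = adj_tail (d' i) (d i) (C i) (c i) (B y i)" for y i
    define \<psi> where "\<psi> y = (\<lambda>(i, a, b). if i < k \<and> a < n \<and> b < d i then tl y i $$ (b, a) else x (i, a, b))"
      for y
    define q where "q y = (\<Prod>i<k. det (stack (d' i) n (B y i) (C i)))" for y
    define y0 where "y0 = (\<lambda>(i, a, b). B0 i $$ (b, a))"
    have By0: "B y0 i = B0 i" if "i < k" for i
      using B0[OF that] unfolding B_def blk_def y0_def by (intro eq_matI) auto
    have \<psi>: "(\<lambda>y. \<psi> y v) \<in> polyfuns" for v
    proof (cases v)
      case (fields i a b)
      show ?thesis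
      proof (cases "i < k \<and> a < n \<and> b < d i")
        case True
        then have "(\<lambda>y. tl y i $$ (b, a)) \<in> polyfuns"
          unfolding tl_def using Bpoly sum[of i] by (intro polyfuns_adj_tail) auto
        then show ?thesis using True unfolding \<psi>_def fields by simp
      next
        case False
        then show ?thesis using polyfuns.const unfolding \<psi>_def fields by auto
      qed
    qed
    have q: "q \<in> polyfuns" unfolding q_def using Bpoly by (intro polyfuns_prod polyfuns_det_stack) auto
    have q0: "q y0 \<noteq> 0" unfolding q_def using By0 det0 by auto
    have \<psi>0: "\<psi> y0 = x"
    proof
      fix v show "\<psi> y0 v = x v"
      proof (cases v)
        case (fields i a b)
        have "A x i $$ (b, a) = x (i, a, b)" if "i < k" "a < n" "b < d i"
          using that unfolding A_def blk_def by simp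
        then show ?thesis using Ax By0 unfolding \<psi>_def fields tl_def by auto
      qed
    qed
    have S: "\<psi> y \<in> S" if y: "y \<in> T" "q y \<noteq> 0" for y
    proof -
      have "perp (d' i) (d i) (A (\<psi> y) i) (B y i)" if i: "i < k" for i
      proof -
        have tlc: "tl y i \<in> carrier_mat (d i) n" using adj_tail_carrier sum[OF i] unfolding tl_def by metis
        have "A (\<psi> y) i = tl y i"
          using i tlc unfolding A_def blk_def \<psi>_def by (intro eq_matI) auto
        moreover have "det (stack (d' i) n (B y i) (C i)) \<noteq> 0" using y(2) i unfolding q_def by auto
        then have "perp (d' i) (d i) (tl y i) (B y i)"
          unfolding tl_def using C[OF i] c[OF i] sum[OF i]
          by (intro perp_adj_tail) (auto simp: B_def)
        ultimately show ?thesis by simp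
      qed
      then show ?thesis using y(1) unfolding S_def by blast
    qed
    show "\<exists>\<psi> q y. (\<forall>v. (\<lambda>y. \<psi> y v) \<in> polyfuns) \<and> q \<in> polyfuns \<and> q y \<noteq> 0 \<and> \<psi> y = x \<and>
        (\<forall>y\<in>T. q y \<noteq> 0 \<longrightarrow> \<psi> y \<in> S)"
      by (rule exI[of _ \<psi>], rule exI[of _ q], rule exI[of _ y0]) (simp add: \<psi> q q0 \<psi>0 S)
  qed
  moreover have "conf_equiv k n d (blk n d x) (blk n d x')" if xx': "x \<in> S" "x' \<in> S" for x x'
  proof -
    obtain y where y: "y \<in> T" "\<forall>i<k. perp (d' i) (d i) (A x i) (B y i)"
      using xx'(1) unfolding S_def by auto
    obtain y' where y': "y' \<in> T" "\<forall>i<k. perp (d' i) (d i) (A x' i) (B y' i)"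
      using xx'(2) unfolding S_def by auto
    obtain g h where g: "g \<in> carrier_mat n n" "det g \<noteq> 0"
      and h: "\<forall>i<k. h i \<in> carrier_mat (d' i) (d' i) \<and> det (h i) \<noteq> 0 \<and> blk n d' y' i = g * blk n d' y i * h i"
      by (rule conf_equivE[OF T(2)[rule_format, OF y(1) y'(1)]])
    have gT: "g\<^sup>T \<in> carrier_mat n n" "det (g\<^sup>T) \<noteq> 0" using g det_transpose[OF g(1)] by auto
    obtain g' where g': "g' \<in> carrier_mat n n" "det g' \<noteq> 0" "g' * g\<^sup>T = 1\<^sub>m n"
      using det_nonzero_inverse[OF gT] by metis
    show ?thesis
    proof (rule conf_equivI[OF g'(1,2)])
      fix i assume i: "i < k"
      note hi = h[rule_format, OF i]
      have hT: "(h i)\<^sup>T \<in> carrier_mat (d' i) (d' i)" "det ((h i)\<^sup>T) \<noteq> 0"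
        using hi det_transpose[of "h i" "d' i"] by auto
      have Bc: "blk n d' y i \<in> carrier_mat n (d' i)" "B y i \<in> carrier_mat (d' i) n"
        unfolding B_def by auto
      have "B y' i = (h i)\<^sup>T * (g * blk n d' y i)\<^sup>T"
        unfolding B_def using hi g Bc by (simp add: transpose_mult[of _ n "d' i" _ "d' i"])
      also have "(g * blk n d' y i)\<^sup>T = B y i * g\<^sup>T"
        unfolding B_def using transpose_mult[OF g(1) Bc(1)] .
      also have "(h i)\<^sup>T * (B y i * g\<^sup>T) = (h i)\<^sup>T * B y i * g\<^sup>T"
        by (rule assoc_mult_mat[OF hT(1) Bc(2) gT(1), symmetric])
      finally have eq: "B y' i = (h i)\<^sup>T * B y i * g\<^sup>T" .
      have "\<exists>u \<in> carrier_mat (d i) (d i). det u \<noteq> 0 \<and> A x' i * (g\<^sup>T)\<^sup>T = u * A x i"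
        by (rule perp_equivariant[OF y(2)[rule_format, OF i] y'(2)[rule_format, OF i] hT _ _ eq])
          (use gT sum[OF i] in auto)
      then obtain u where u: "u \<in> carrier_mat (d i) (d i)" "det u \<noteq> 0" "A x' i * g = u * A x i"
        by (elim bexE conjE) (rule that, simp_all)
      have "g\<^sup>T * blk n d x' i = blk n d x i * u\<^sup>T"
        using arg_cong[OF u(3), of transpose_mat] u(1) g(1)
        by (simp add: A_def transpose_mult[of _ "d i" n _ n] transpose_mult[of _ "d i" "d i" _ n])
      then have "g' * (g\<^sup>T * blk n d x' i) = g' * (blk n d x i * u\<^sup>T)" by simp
      moreover have "g' * (g\<^sup>T * blk n d x' i) = blk n d x' i"
        using assoc_mult_mat[OF g'(1) gT(1) blk_carrier[of n d x' i]] g'(3)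
          left_mult_one_mat[OF blk_carrier[of n d x' i]] by simp
      moreover have "g' * (blk n d x i * u\<^sup>T) = g' * blk n d x i * u\<^sup>T"
        using assoc_mult_mat[OF g'(1) blk_carrier[of n d x i], of "u\<^sup>T" "d i"] u(1) by simp
      ultimately have "blk n d x' i = g' * blk n d x i * u\<^sup>T" by metis
      then show "\<exists>h \<in> carrier_mat (d i) (d i). det h \<noteq> 0 \<and> blk n d x' i = g' * blk n d x i * h"
        using u det_transpose[OF u(1)] by (intro bexI[of _ "u\<^sup>T"]) auto
    qed
  qed
  ultimately show ?thesis by (rule generic_orbitI)
qed

context column_blocks
begin

definition idx :: "nat \<Rightarrow> nat \<Rightarrow> nat" where
  "idx i c = (SOME j. j < N \<and> bi j = i \<and> po j = c)"

lemma idx: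
  assumes "i < k" "c < d i"
  shows "idx i c < N" "bi (idx i c) = i" "po (idx i c) = c"
proof -
  have "\<exists>j. j < N \<and> bi j = i \<and> po j = c" using index_ex[OF assms] by metis
  from someI_ex[OF this] show "idx i c < N" "bi (idx i c) = i" "po (idx i c) = c"
    unfolding idx_def by auto
qed

lemma idx_inverse:
  assumes "j < N"
  shows "idx (bi j) (po j) = j"
  using idx[OF bi_less[OF assms] po_less[OF assms]] by (rule index_inj[OF _ assms])

end

text \<open>
Passing to the orthogonal complement of the row space of the concatenation. Now the invertible matrix on
the left comes from the uniqueness of the complement, and the block diagonal matrix of base changes turns
into its inverse transpose, which is block diagonal again. This is why the block sizes survive.
\<close>

lemma generic_orbit_gale:
  assumes le: "m \<le> (\<Sum>i<k. d i)"
    and P: "generic_orbit TYPE('a :: alg_closed_field) k ((\<Sum>i<k. d i) - m) d"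
  shows "generic_orbit TYPE('a) k m d"
proof -
  define N where "N = (\<Sum>i<k. d i)"
  define p where "p = N - m"
  have sum: "p + m = N" using le unfolding p_def N_def by simp
  obtain bi po where "column_blocks k d N bi po" using column_blocks_exist unfolding N_def by blast
  then interpret column_blocks k d N bi po .
  obtain T :: "(nat \<times> nat \<times> nat \<Rightarrow> 'a) set" where T: "zdense T"
    "\<forall>x\<in>T. \<forall>y\<in>T. conf_equiv k p d (blk p d x) (blk p d y)"
    by (rule generic_orbitE[OF P[folded N_def, folded p_def]])
  define A :: "(nat \<times> nat \<times> nat \<Rightarrow> 'a) \<Rightarrow> 'a mat" where "A x = hcat m (blk m d x)" for x
  define B :: "(nat \<times> nat \<times> nat \<Rightarrow> 'a) \<Rightarrow> 'a mat" where "B y = hcat p (blk p d y)" for y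
  define S where "S = {x. \<exists>y\<in>T. perp p m (A x) (B y)}"
  have A: "A x \<in> carrier_mat m N" and B: "B x \<in> carrier_mat p N" for x unfolding A_def B_def by auto
  have Aidx: "A x $$ (r, j) = x (bi j, r, po j)" if "r < m" "j < N" for x r j
    using that po_less unfolding A_def hcat_def blk_def by simp
  have Bidx: "B x $$ (r, j) = x (bi j, r, po j)" if "r < p" "j < N" for x r j
    using that po_less unfolding B_def hcat_def blk_def by simp
  have Bpoly: "(\<lambda>y. B y $$ (a, b)) \<in> polyfuns" if "a < p" "b < N" for a b
    using that polyfuns.coord by (simp add: Bidx)
  \<comment> \<open>approximation is only needed where the last \<open>m\<close> columns form an invertible square\<close>
  define r where "r x = det (mat m m (\<lambda>(a, b). A x $$ (a, p + b)))" for x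
  have r: "r \<in> polyfuns"
    unfolding r_def using sum polyfuns.coord by (intro polyfuns_det[where N = m]) (auto simp: Aidx)
  define x0 :: "nat \<times> nat \<times> nat \<Rightarrow> 'a" where
    "x0 = (\<lambda>(i, r, c). if bi (p + r) = i \<and> po (p + r) = c then 1 else 0)"
  have "mat m m (\<lambda>(a, b). A x0 $$ (a, p + b)) = 1\<^sub>m m"
  proof (rule eq_matI)
    fix a b assume "a < dim_row (1\<^sub>m m :: 'a mat)" "b < dim_col (1\<^sub>m m :: 'a mat)"
    then have ab: "a < m" "b < m" by auto
    then show "mat m m (\<lambda>(a, b). A x0 $$ (a, p + b)) $$ (a, b) = 1\<^sub>m m $$ (a, b)"
      using sum index_inj[of "p + a" "p + b"] by (auto simp: Aidx x0_def)
  qed auto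
  then have r0: "r x0 \<noteq> 0" unfolding r_def by simp
  have "zdense S"
  proof (rule zdense_transfer[OF T(1) r r0])
    fix x assume rx: "r x \<noteq> 0"
    obtain B0 C c where "B0 \<in> carrier_mat p (p + m)" "C \<in> carrier_mat m (p + m)"
          "c \<noteq> 0" "det (stack p (p + m) B0 C) \<noteq> 0" "A x = adj_tail p m C c B0"
      by (rule adj_tail_surj[of "A x" m p]) (use A rx in \<open>auto simp: sum r_def\<close>)
    note z = this[unfolded sum]
    define tl where "tl y = adj_tail p m C c (B y)" for y
    define \<psi> where "\<psi> y = (\<lambda>(i, a, b). if i < k \<and> a < m \<and> b < d i then tl y $$ (a, idx i b) else x (i, a, b))"
      for y
    define q where "q y = det (stack p N (B y) C)" for y
    define y0 where "y0 = (\<lambda>(i, a, b). B0 $$ (a, idx i b))"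
    have By0: "B y0 = B0"
      using z(1) B[of y0] by (intro eq_matI) (auto simp: Bidx y0_def idx_inverse)
    have \<psi>: "(\<lambda>y. \<psi> y v) \<in> polyfuns" for v
    proof (cases v)
      case (fields i a b)
      show ?thesis
      proof (cases "i < k \<and> a < m \<and> b < d i")
        case True
        then have "(\<lambda>y. tl y $$ (a, idx i b)) \<in> polyfuns"
          unfolding tl_def using Bpoly sum idx[of i b] by (intro polyfuns_adj_tail) auto
        then show ?thesis using True unfolding \<psi>_def fields by simp
      next
        case False
        then show ?thesis using polyfuns.const unfolding \<psi>_def fields by auto
      qed
    qed
    have q: "q \<in> polyfuns" unfolding q_def using Bpoly by (intro polyfuns_det_stack) auto
    have q0: "q y0 \<noteq> 0" unfolding q_def By0 using z(4) .
    have \<psi>0: "\<psi> y0 = x"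
    proof
      fix v show "\<psi> y0 v = x v"
      proof (cases v)
        case (fields i a b)
        have "A x $$ (a, idx i b) = x (i, a, b)" if "i < k" "a < m" "b < d i"
          using that idx[of i b] by (simp add: Aidx)
        then show ?thesis using z(5) By0 unfolding \<psi>_def fields tl_def by auto
      qed
    qed
    have S: "\<psi> y \<in> S" if y: "y \<in> T" "q y \<noteq> 0" for y
    proof -
      have tlc: "tl y \<in> carrier_mat m N" using adj_tail_carrier sum unfolding tl_def by metis
      have "A (\<psi> y) = tl y"
        using A[of "\<psi> y"] tlc bi_less po_less
        by (intro eq_matI) (auto simp: Aidx \<psi>_def idx_inverse)
      moreover have "perp p m (tl y) (B y)"
        unfolding tl_def using z(2,3) y(2) B[of y] unfolding q_def sum[symmetric]
        by (intro perp_adj_tail) auto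
      ultimately show ?thesis using y(1) unfolding S_def by auto
    qed
    show "\<exists>\<psi> q y. (\<forall>v. (\<lambda>y. \<psi> y v) \<in> polyfuns) \<and> q \<in> polyfuns \<and> q y \<noteq> 0 \<and> \<psi> y = x \<and>
        (\<forall>y\<in>T. q y \<noteq> 0 \<longrightarrow> \<psi> y \<in> S)"
      by (rule exI[of _ \<psi>], rule exI[of _ q], rule exI[of _ y0]) (simp add: \<psi> q q0 \<psi>0 S)
  qed
  moreover have "conf_equiv k m d (blk m d x) (blk m d x')" if xx': "x \<in> S" "x' \<in> S" for x x'
  proof -
    obtain y where y: "y \<in> T" "perp p m (A x) (B y)"
      using xx'(1) unfolding S_def by auto
    obtain y' where y': "y' \<in> T" "perp p m (A x') (B y')"
      using xx'(2) unfolding S_def by auto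
    obtain g h where g: "g \<in> carrier_mat p p" "det g \<noteq> 0"
      and h: "\<forall>i<k. h i \<in> carrier_mat (d i) (d i) \<and> det (h i) \<noteq> 0 \<and> blk p d y' i = g * blk p d y i * h i"
      by (rule conf_equivE[OF T(2)[rule_format, OF y(1) y'(1)]])
    have h1: "h i \<in> carrier_mat (d i) (d i)" and h2: "det (h i) \<noteq> 0" if "i < k" for i
      using h that by auto
    have hT: "(h i)\<^sup>T \<in> carrier_mat (d i) (d i)" if "i < k" for i using h1[OF that] by simp
    have "B y' = hcat p (\<lambda>i. g * blk p d y i * h i)"
      unfolding B_def using h by (intro hcat_cong) auto
    also have "\<dots> = hcat p (\<lambda>i. g * blk p d y i) * bdiag h"
      by (rule hcat_right[of "\<lambda>i. g * blk p d y i" p h]) (use g(1) h1 in auto)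
    also have "hcat p (\<lambda>i. g * blk p d y i) = g * B y"
      unfolding B_def by (rule hcat_left[of g p p "blk p d y"]) (use g(1) in auto)
    finally have eq: "B y' = g * B y * bdiag h" .
    have "\<exists>u \<in> carrier_mat m m. det u \<noteq> 0 \<and> A x' * (bdiag h)\<^sup>T = u * A x"
      by (rule perp_equivariant[OF y(2) y'(2) g _ _ eq])
        (use det_bdiag_nonzero[OF h1 h2] in \<open>auto simp: sum\<close>)
    then obtain u where u: "u \<in> carrier_mat m m" "det u \<noteq> 0" "A x' * (bdiag h)\<^sup>T = u * A x"
      by (elim bexE conjE) (rule that)
    have "hcat m (\<lambda>i. blk m d x' i * (h i)\<^sup>T) = hcat m (\<lambda>i. u * blk m d x i)"
      using u(3) hcat_right[of "blk m d x'" m "\<lambda>i. (h i)\<^sup>T"] hT hcat_left[of u m m "blk m d x"] u(1)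
        bdiag_transpose[of h] h1 unfolding A_def by simp
    then have eqs: "blk m d x' i * (h i)\<^sup>T = u * blk m d x i" if "i < k" for i
      using that hT[OF that] u(1) mult_carrier_mat[OF blk_carrier[of m d x' i] hT[OF that]]
      by (intro hcat_inject[of m "\<lambda>i. blk m d x' i * (h i)\<^sup>T" "\<lambda>i. u * blk m d x i"]) auto
    show ?thesis
    proof (rule conf_equivI[OF u(1,2)])
      fix i assume i: "i < k"
      have "det ((h i)\<^sup>T) \<noteq> 0" using det_transpose[OF h1[OF i]] h2[OF i] by simp
      then obtain h' where h': "h' \<in> carrier_mat (d i) (d i)" "det h' \<noteq> 0" "(h i)\<^sup>T * h' = 1\<^sub>m (d i)"
        using det_nonzero_inverse[OF hT[OF i]] by metis
      have "blk m d x' i = blk m d x' i * ((h i)\<^sup>T * h')"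
        unfolding h'(3) using right_mult_one_mat[OF blk_carrier[of m d x' i]] by simp
      also have "\<dots> = blk m d x' i * (h i)\<^sup>T * h'"
        by (rule assoc_mult_mat[OF blk_carrier[of m d x' i] hT[OF i] h'(1), symmetric])
      also have "blk m d x' i * (h i)\<^sup>T = u * blk m d x i" by (rule eqs[OF i])
      finally show "\<exists>h \<in> carrier_mat (d i) (d i). det h \<noteq> 0 \<and> blk m d x' i = u * blk m d x i * h"
        using h' by blast
    qed
  qed
  ultimately show ?thesis by (rule generic_orbitI)
qed

section \<open>Four subspaces with nonzero defect\<close>

text \<open>
A whole space may be exchanged for \<open>0\<close> and then for a generic span of more than \<open>n\<close> vectors.
\<close>

lemma generic_orbit_truncate:
  assumes "generic_orbit TYPE('a :: alg_closed_field) k n (d(l := n))" "n \<le> d l"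
  shows "generic_orbit TYPE('a) k n d"
proof -
  have "generic_orbit TYPE('a) k n (d(l := 0))"
    by (rule generic_orbit_fewer[OF assms(1)]) auto
  then show ?thesis using assms(2) by (rule generic_orbit_full_space)
qed

lemma sum_update:
  fixes d :: "nat \<Rightarrow> nat"
  assumes "l < k"
  shows "(\<Sum>i<k. (d(l := a)) i) + d l = (\<Sum>i<k. d i) + a"
proof -
  have "(\<Sum>i<k. (d(l := a)) i) = a + (\<Sum>i\<in>{..<k} - {l}. d i)"
    using assms by (subst sum.remove[of _ l]) (auto intro!: sum.cong)
  moreover have "(\<Sum>i<k. d i) = d l + (\<Sum>i\<in>{..<k} - {l}. d i)"
    using assms by (subst sum.remove[of _ l]) auto
  ultimately show ?thesis by simp
qed

lemma member_le_sum_nat: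
  fixes d :: "nat \<Rightarrow> nat"
  shows "l < k \<Longrightarrow> d l \<le> (\<Sum>i<k. d i)"
  by (rule member_le_sum) auto

text \<open>
Put \<open>n' = \<Sum>d\<^sub>i - n\<close>, which is less than \<open>n\<close>. If all \<open>d\<^sub>i \<le> n'\<close>, Gale duality followed by duality leads
to \<open>(n' - d\<^sub>i; n')\<close> with the same defect. If some \<open>d\<^sub>l > n'\<close>, the other three subspaces span only a
proper subspace of dimension \<open>m = \<Sum>d\<^sub>i - d\<^sub>l\<close>, and one may replace the space by this span and the
subspace with index \<open>l\<close> by its intersection with it, which has dimension \<open>n'\<close>. In terms of the available
operations this is Gale duality, truncation to \<open>n'\<close>, and Gale duality once more. The case \<open>d\<^sub>l = n\<close> must
be kept apart, since there the second reduction would produce defect zero.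
\<close>

lemma four_subspaces_below:
  fixes d :: "nat \<Rightarrow> nat"
  assumes "\<And>i. i < 4 \<Longrightarrow> d i \<le> n" "(\<Sum>i<4. d i) < 2 * n"
  shows "generic_orbit TYPE('a :: alg_closed_field) 4 n d"
  using assms
proof (induction n arbitrary: d rule: less_induct)
  case (less n)
  define s where "s = (\<Sum>i<4. d i)"
  have s2: "s < 2 * n" using less.prems(2) unfolding s_def .
  show ?case
  proof (cases "s \<le> n")
    case True
    then show ?thesis unfolding s_def by (rule generic_orbit_independent)
  next
    case False
    define n' where "n' = s - n"
    have n': "n' < n" "n' + n = s" using False s2 unfolding n'_def by auto
    have gale: "generic_orbit TYPE('a) 4 n d" if "generic_orbit TYPE('a) 4 n' d"
      using generic_orbit_gale[of n d 4] that False unfolding n'_def s_def by simp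
    consider l where "l < 4" "d l = n" | "\<forall>i<4. d i \<le> n'" | l where "l < 4" "d l \<noteq> n" "n' < d l"
      by (meson not_less)
    then show ?thesis
    proof cases
      case 1
      have "(\<Sum>i<4. (d(l := 0)) i) \<le> n" using sum_update[OF 1(1), of d 0] 1(2) s2 unfolding s_def by simp
      then have "generic_orbit TYPE('a) 4 n (d(l := 0))" by (rule generic_orbit_independent)
      then show ?thesis by (rule generic_orbit_full_space) (simp add: 1)
    next
      case 2
      have "(\<Sum>i<4. n' - d i) + s = 4 * n'"
        unfolding s_def sum.distrib[symmetric] using 2 by (simp add: sum.cong)
      then have "(\<Sum>i<4. n' - d i) < 2 * n'" using n' s2 by simp
      then have "generic_orbit TYPE('a) 4 n' (\<lambda>i. n' - d i)" by (intro less.IH n'(1)) auto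
      then have "generic_orbit TYPE('a) 4 n' d" by (rule generic_orbit_dual[rotated]) (use 2 in auto)
      then show ?thesis by (rule gale)
    next
      case 3
      define d1 where "d1 = d(l := n')"
      define m where "m = s - d l"
      have dl: "d l \<le> s" "d l < n" using member_le_sum_nat[OF 3(1), of d] less.prems(1)[OF 3(1)] 3(2)
        unfolding s_def by auto
      have sum1: "(\<Sum>i<4. d1 i) = m + n'"
        using sum_update[OF 3(1), of d n'] dl unfolding d1_def m_def s_def by simp
      have m: "m < n" "n' < m" using n' dl 3(3) unfolding m_def by auto
      have "generic_orbit TYPE('a) 4 m d1"
      proof (rule less.IH[OF m(1)])
        fix i :: nat assume "i < 4"
        then have "d1 i \<le> (\<Sum>i<4. (d(l := 0)) i)" if "i \<noteq> l"
          using member_le_sum_nat[of i 4 "d(l := 0)"] that unfolding d1_def by simp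
        moreover have "(\<Sum>i<4. (d(l := 0)) i) = m"
          using sum_update[OF 3(1), of d 0] unfolding m_def s_def by simp
        ultimately show "d1 i \<le> m" using m(2) unfolding d1_def by (cases "i = l") auto
      next
        show "(\<Sum>i<4. d1 i) < 2 * m" using sum1 m by simp
      qed
      then have "generic_orbit TYPE('a) 4 n' d1"
        using sum1 generic_orbit_gale[of n' d1 4] by simp
      then have "generic_orbit TYPE('a) 4 n' d"
        unfolding d1_def using 3(3) by (intro generic_orbit_truncate[of 4 n' d l]) auto
      then show ?thesis by (rule gale)
    qed
  qed
qed

lemma four_subspaces:
  fixes d :: "nat \<Rightarrow> nat"
  assumes le: "\<And>i. i < 4 \<Longrightarrow> d i \<le> n" and ne: "(\<Sum>i<4. d i) \<noteq> 2 * n"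
  shows "generic_orbit TYPE('a :: alg_closed_field) 4 n d"
proof (cases "(\<Sum>i<4. d i) < 2 * n")
  case True
  then show ?thesis using le by (intro four_subspaces_below) auto
next
  case False
  have "(\<Sum>i<4. n - d i) + (\<Sum>i<4. d i) = 4 * n"
    unfolding sum.distrib[symmetric] using le by (simp add: sum.cong)
  then have "(\<Sum>i<4. n - d i) < 2 * n" using False ne by simp
  then have "generic_orbit TYPE('a) 4 n (\<lambda>i. n - d i)" by (intro four_subspaces_below) auto
  then show ?thesis by (rule generic_orbit_dual[rotated]) (use le in auto)
qed

text \<open>
Add the zero space until there are three subspaces, and then \<open>0\<close> or the whole space as the fourth: if
the sum of the three dimensions is less than \<open>2n\<close>, it stays so, and otherwise it grows to at least
\<open>3n\<close>.
\<close>

lemma three_subspaces: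
  fixes d :: "nat \<Rightarrow> nat"
  assumes "k \<le> 3" and le: "\<And>i. i < k \<Longrightarrow> d i \<le> n"
  shows "generic_orbit TYPE('a :: alg_closed_field) k n d"
proof (cases "n = 0")
  case True
  then have "(\<Sum>i<k. d i) \<le> n" using le by simp
  then show ?thesis by (rule generic_orbit_independent)
next
  case False
  define e where "e i = (if i < k then d i else 0)" for i
  define s where "s = (\<Sum>i<3. e i)"
  define f where "f i = (if i < 3 then e i else if s < 2 * n then 0 else n)" for i
  have four: "{..<4} = insert 3 {..<3::nat}" by auto
  have "(\<Sum>i<3. f i) = s" unfolding s_def by (rule sum.cong) (auto simp: f_def)
  moreover have "(\<Sum>i<4. f i) = f 3 + (\<Sum>i<3. f i)" unfolding four by (subst sum.insert) auto
  ultimately have "(\<Sum>i<4. f i) = (if s < 2 * n then s else s + n)" by (simp add: f_def)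
  then have "(\<Sum>i<4. f i) \<noteq> 2 * n" using False by simp
  moreover have "f i \<le> n" if "i < 4" for i using le unfolding f_def e_def by auto
  ultimately have "generic_orbit TYPE('a) 4 n f" by (intro four_subspaces) auto
  then show ?thesis by (rule generic_orbit_fewer) (use assms(1) in \<open>auto simp: f_def e_def\<close>)
qed


section \<open>Matrices and points of Grassmannians\<close>

lemma col_space_image:
  fixes A :: "'a :: field mat"
  assumes "A \<in> carrier_mat n d"
  shows "vec_space.col_space n A = (\<lambda>v. A *\<^sub>v v) ` carrier_vec d"
  using assms mult_mat_vec_carrier[OF assms] unfolding vec_space.col_space_eq[OF assms] by auto

lemma col_space_in_Grassmannian:
  fixes A :: "'a :: field mat"
  assumes A: "A \<in> carrier_mat n d"
    and inj: "\<And>v. v \<in> carrier_vec d \<Longrightarrow> A *\<^sub>v v = 0\<^sub>v n \<Longrightarrow> v = 0\<^sub>v d"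
  shows "vec_space.col_space n A \<in> Grassmannian d n"
proof -
  interpret vec_space "TYPE('a)" n .
  have cols: "set (cols A) \<subseteq> carrier_vec n" using A cols_dim by blast
  have dist: "distinct (cols A)"
  proof (rule ccontr)
    assume "\<not> distinct (cols A)"
    then obtain i j where ij: "i < d" "j < d" "i \<noteq> j" "col A i = col A j"
      using A unfolding distinct_conv_nth by auto
    have "A *\<^sub>v (unit_vec d i - unit_vec d j) = A *\<^sub>v unit_vec d i - A *\<^sub>v unit_vec d j"
      by (rule mult_minus_distrib_mat_vec[OF A]) auto
    also have "\<dots> = 0\<^sub>v n"
    proof -
      have "A *\<^sub>v unit_vec d l = col A l" if "l < d" for l
        using that A by (intro eq_vecI) auto
      then show ?thesis using ij A by auto
    qed
    finally have "unit_vec d i - unit_vec d j = (0\<^sub>v d :: 'a vec)" by (intro inj) auto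
    then have "(unit_vec d i - unit_vec d j :: 'a vec) $ i = 0\<^sub>v d $ i" by simp
    then show False using ij by simp
  qed
  have "lin_indpt (set (cols A))"
    using lin_depE[OF A _ dist] inj by metis
  then have "rank A = d" by (rule lin_indpt_full_rank[OF A dist])
  then show ?thesis
    using span_is_subspace[of "set (cols A)"] cols
    unfolding Grassmannian_def col_space_def rank_def by simp
qed

text \<open>
A maximal independent subset of \<open>W\<close> is finite, because independent subsets of the ambient space are
bounded in size; it is a basis of \<open>W\<close> and provides the columns.
\<close>

lemma Grassmannian_col_space:
  fixes W :: "'a :: field vec set"
  assumes W: "W \<in> Grassmannian d n"
  obtains A where "A \<in> carrier_mat n d" "vec_space.col_space n A = W"
proof -
  interpret vec_space "TYPE('a)" n .
  have sub: "VectorSpace.subspace class_ring W V" and dimW: "vectorspace.dim class_ring (vs W) = d"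
    using W unfolding Grassmannian_def by auto
  have sm: "submodule class_ring W V" using sub unfolding VectorSpace.subspace_def by blast
  have WV: "W \<subseteq> carrier V" using sm unfolding submodule_def by blast
  interpret w: vectorspace class_ring "vs W" by (rule subspace_is_vs[OF sub])
  have small: "finite S \<and> card S \<le> dim" if S: "S \<subseteq> carrier (vs W)" "w.lin_indpt S" for S
  proof -
    have "S \<subseteq> W" using S(1) by simp
    then have "lin_indpt S" "S \<subseteq> carrier V" using S(2) span_li_not_depend(2)[OF _ sm] WV by auto
    then show ?thesis using li_le_dim[OF fin_dim] by auto
  qed
  have "w.lin_indpt {}" unfolding w.lin_dep_def by auto
  then have "\<exists>S. finite S \<and> maximal S (\<lambda>S. S \<subseteq> carrier (vs W) \<and> w.lin_indpt S)"
    by (intro maximal_exists[where N = dim and B = "{}"]) (use small in auto)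
  then obtain S where S: "finite S" "maximal S (\<lambda>S. S \<subseteq> carrier (vs W) \<and> w.lin_indpt S)" by blast
  have bas: "w.basis S" by (rule w.max_li_is_basis[OF S(2)])
  have cardS: "card S = d" using w.dim_basis[OF S(1) bas] dimW by simp
  have SW: "S \<subseteq> W" and spanS: "w.span S = W" using bas unfolding w.basis_def by auto
  obtain vs where vs: "set vs = S" "distinct vs" using finite_distinct_list[OF S(1)] by blast
  have vsc: "set vs \<subseteq> carrier_vec n" using vs SW WV by (auto simp: module_vec_simps)
  define A where "A = mat_of_cols n vs"
  have "length vs = d" using vs cardS distinct_card by metis
  then have "A \<in> carrier_mat n d" unfolding A_def by auto
  moreover have "col_space A = W"
    unfolding col_space_def A_def cols_mat_of_cols[OF vsc] vs(1)
    using span_li_not_depend(1)[OF SW sm] spanS by simp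
  ultimately show ?thesis by (rule that)
qed

lemma col_space_mono:
  fixes A B :: "'a :: field mat"
  assumes A: "A \<in> carrier_mat n d" and B: "B \<in> carrier_mat n d"
    and sub: "vec_space.col_space n A \<subseteq> vec_space.col_space n B"
  obtains h where "h \<in> carrier_mat d d" "A = B * h"
proof -
  have "\<exists>v. v \<in> carrier_vec d \<and> col A c = B *\<^sub>v v" if "c < d" for c
  proof -
    have "A *\<^sub>v unit_vec d c = col A c" using that A by (intro eq_vecI) auto
    then have "col A c \<in> vec_space.col_space n A" unfolding col_space_image[OF A] by (metis imageI unit_vec_carrier)
    then show ?thesis using sub unfolding col_space_image[OF B] by auto
  qed
  then obtain v where v: "\<And>c. c < d \<Longrightarrow> v c \<in> carrier_vec d" "\<And>c. c < d \<Longrightarrow> col A c = B *\<^sub>v v c" by metis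
  define h where "h = mat d d (\<lambda>(r, c). v c $ r)"
  have h: "h \<in> carrier_mat d d" unfolding h_def by simp
  have "A = B * h"
  proof (rule mat_col_eqI)
    fix c assume "c < dim_col (B * h)"
    then have c: "c < d" using h by simp
    have "col h c = v c" using c v(1)[OF c] unfolding h_def by (intro eq_vecI) auto
    then show "col A c = col (B * h) c" using c v(2)[OF c] B h v(1)[OF c] by (intro eq_vecI) auto
  qed (use A B h in auto)
  with h show ?thesis by (rule that)
qed

lemma col_space_mult_right:
  fixes A :: "'a :: field mat"
  assumes A: "A \<in> carrier_mat n d" and h: "h \<in> carrier_mat d d" "det h \<noteq> 0"
  shows "vec_space.col_space n (A * h) = vec_space.col_space n A"
proof -
  obtain h' where h': "h' \<in> carrier_mat d d" "h * h' = 1\<^sub>m d" using det_nonzero_inverse[OF h] by metis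
  have Ah: "A * h \<in> carrier_mat n d" using A h by simp
  have "A *\<^sub>v v \<in> (\<lambda>v. A * h *\<^sub>v v) ` carrier_vec d" if v: "v \<in> carrier_vec d" for v
  proof
    have "A * h *\<^sub>v (h' *\<^sub>v v) = A *\<^sub>v (h *\<^sub>v (h' *\<^sub>v v))"
      using A h(1) h'(1) v by (intro assoc_mult_mat_vec) auto
    also have "h *\<^sub>v (h' *\<^sub>v v) = v" using assoc_mult_mat_vec[OF h(1) h'(1) v] h'(2) v by simp
    finally show "A *\<^sub>v v = A * h *\<^sub>v (h' *\<^sub>v v)" ..
    show "h' *\<^sub>v v \<in> carrier_vec d" using h'(1) v by simp
  qed
  moreover have "A * h *\<^sub>v v \<in> (\<lambda>v. A *\<^sub>v v) ` carrier_vec d" if v: "v \<in> carrier_vec d" for v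
    using assoc_mult_mat_vec[OF A h(1) v] h(1) v by (intro image_eqI[of _ _ "h *\<^sub>v v"]) auto
  ultimately show ?thesis unfolding col_space_image[OF A] col_space_image[OF Ah] by blast
qed

subsection \<open>The action of the projective linear group\<close>

lemma carrier_GL: "g \<in> carrier (GL n) \<longleftrightarrow> g \<in> carrier_mat n n \<and> det g \<noteq> (0 :: 'a :: field)"
proof
  assume "g \<in> carrier (GL n)"
  then have "g \<in> Units (ring_mat TYPE('a) n ())" unfolding GL_def units_of_def by simp
  then show "g \<in> carrier_mat n n \<and> det g \<noteq> 0"
    using unit_imp_det_non_zero by (auto simp: Units_def ring_mat_def)
next
  assume "g \<in> carrier_mat n n \<and> det g \<noteq> 0"
  then show "g \<in> carrier (GL n)"
    using det_non_zero_imp_unit[of g n "()"] unfolding GL_def units_of_def by simp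
qed

lemma carrier_PGL: "carrier (PGL n) = {scalar_mats n #>\<^bsub>GL n\<^esub> g | g. g \<in> carrier (GL n)}"
  unfolding PGL_def FactGroup_def RCOSETS_def by auto

lemma PGL_image_col_space:
  fixes A :: "'a :: field mat"
  assumes A: "A \<in> carrier_mat n d" and g: "g \<in> carrier_mat n n"
  shows "PGL_image (scalar_mats n #>\<^bsub>GL n\<^esub> g) (vec_space.col_space n A) = vec_space.col_space n (g * A)"
proof -
  have coset: "scalar_mats n #>\<^bsub>GL n\<^esub> g = {c \<cdot>\<^sub>m g | c. c \<noteq> 0}"
  proof -
    have "(c \<cdot>\<^sub>m 1\<^sub>m n) \<otimes>\<^bsub>GL n\<^esub> g = c \<cdot>\<^sub>m g" for c
      using mult_smult_assoc_mat[OF one_carrier_mat g, of c] g unfolding GL_def units_of_def ring_mat_def by simp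
    then show ?thesis unfolding r_coset_def scalar_mats_def by auto
  qed
  have gA: "g * A \<in> carrier_mat n d" using g A by simp
  have "PGL_image (scalar_mats n #>\<^bsub>GL n\<^esub> g) (vec_space.col_space n A)
      = (\<Union>c\<in>{c. c \<noteq> 0}. (\<lambda>v. (c \<cdot>\<^sub>m g) *\<^sub>v (A *\<^sub>v v)) ` carrier_vec d)"
    unfolding PGL_image_def coset col_space_image[OF A] by auto
  also have "\<dots> = (\<lambda>v. g * A *\<^sub>v v) ` carrier_vec d"
  proof (intro equalityI subsetI)
    fix w assume "w \<in> (\<Union>c\<in>{c. c \<noteq> 0}. (\<lambda>v. (c \<cdot>\<^sub>m g) *\<^sub>v (A *\<^sub>v v)) ` carrier_vec d)"
    then obtain c v where w: "v \<in> carrier_vec d" "w = (c \<cdot>\<^sub>m g) *\<^sub>v (A *\<^sub>v v)" by blast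
    have "w = g * A *\<^sub>v (c \<cdot>\<^sub>v v)"
      using assoc_mult_mat_vec[OF g A w(1)] mult_mat_vec[OF gA w(1), of c] g A w
      by (auto intro!: eq_vecI simp: smult_scalar_prod_distrib[of _ n])
    then show "w \<in> (\<lambda>v. g * A *\<^sub>v v) ` carrier_vec d" using w(1) by auto
  next
    fix w assume "w \<in> (\<lambda>v. g * A *\<^sub>v v) ` carrier_vec d"
    then obtain v where w: "v \<in> carrier_vec d" "w = g * A *\<^sub>v v" by blast
    have "1 \<cdot>\<^sub>m g = g" by (intro eq_matI) auto
    then have "w = (1 \<cdot>\<^sub>m g) *\<^sub>v (A *\<^sub>v v)" using w assoc_mult_mat_vec[OF g A w(1)] by simp
    then show "w \<in> (\<Union>c\<in>{c. c \<noteq> 0}. (\<lambda>v. (c \<cdot>\<^sub>m g) *\<^sub>v (A *\<^sub>v v)) ` carrier_vec d)"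
      using w(1) by (intro UN_I[of 1]) auto
  qed
  finally show ?thesis unfolding col_space_image[OF gA] .
qed

subsection \<open>Principal open sets in matrix coordinates\<close>

lemma polyfuns_pluecker: "(\<lambda>x. pluecker (blk n d x i) I) \<in> polyfuns"
proof -
  define a where "a = card {r. r < n \<and> r \<in> I}"
  have sub: "submatrix (blk n d x i) I UNIV = mat a (d i) (\<lambda>(r, c). x (i, pick I r, c))" for x
    unfolding submatrix_def a_def blk_def by (intro eq_matI) (auto simp: pick_UNIV pick_le)
  show ?thesis
  proof (cases "a = d i")
    case True
    then show ?thesis
      unfolding pluecker_def sub by (intro polyfuns_det[where N = a]) (auto intro: polyfuns.coord)
  next
    case False
    then have "pluecker (blk n d x i) I = 0" for x :: "nat \<times> nat \<times> nat \<Rightarrow> 'a"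
      unfolding pluecker_def sub det_def by simp
    then show ?thesis using polyfuns.const[of 0] by simp
  qed
qed

lemma polyfuns_eval_mpoly: "(\<lambda>x. eval_mpoly (\<lambda>(i, I). pluecker (blk n d x i) I) f) \<in> polyfuns"
  unfolding eval_mpoly_def case_prod_unfold
  by (intro polyfuns_sum polyfuns.mult polyfuns.const polyfuns_prod polyfuns_power polyfuns_pluecker)

lemma eval_mpoly_cong:
  assumes "multihomogeneous ds n e f" "\<And>i. i < length ds \<Longrightarrow> A i = B i"
  shows "eval_mpoly (\<lambda>(i, I). pluecker (A i) I) f = eval_mpoly (\<lambda>(i, I). pluecker (B i) I) f"
  unfolding eval_mpoly_def
proof (rule sum.cong[OF refl])
  fix m assume "m \<in> Poly_Mapping.keys f"
  then have "Poly_Mapping.keys m \<subseteq> pluecker_variables ds n" using assms(1) unfolding multihomogeneous_def by blast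
  then have "fst v < length ds" if "v \<in> Poly_Mapping.keys m" for v
    using that unfolding pluecker_variables_def by auto
  then have "(\<Prod>v\<in>Poly_Mapping.keys m. (case v of (i, I) \<Rightarrow> pluecker (A i) I) ^ Poly_Mapping.lookup m v)
      = (\<Prod>v\<in>Poly_Mapping.keys m. (case v of (i, I) \<Rightarrow> pluecker (B i) I) ^ Poly_Mapping.lookup m v)"
    using assms(2) by (intro prod.cong) (auto simp: case_prod_unfold)
  then show "Poly_Mapping.lookup f m * (\<Prod>v\<in>Poly_Mapping.keys m. (case v of (i, I) \<Rightarrow> pluecker (A i) I) ^ Poly_Mapping.lookup m v)
      = Poly_Mapping.lookup f m * (\<Prod>v\<in>Poly_Mapping.keys m. (case v of (i, I) \<Rightarrow> pluecker (B i) I) ^ Poly_Mapping.lookup m v)"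
    by simp
qed


section \<open>From tuples of matrices to dense dimension vectors\<close>

definition subspaces_of :: "nat list \<Rightarrow> nat \<Rightarrow> (nat \<times> nat \<times> nat \<Rightarrow> 'a :: field) \<Rightarrow> nat \<Rightarrow> 'a vec set" where
  "subspaces_of ds n x = (\<lambda>i\<in>{..<length ds}. vec_space.col_space n (blk n ((!) ds) x i))"

text \<open>
For block sizes up to \<open>n\<close>, its nonvanishing is an open condition under which all blocks have
independent columns.
\<close>

definition top_minors :: "nat list \<Rightarrow> (nat \<times> nat \<times> nat \<Rightarrow> 'a :: field) \<Rightarrow> 'a" where
  "top_minors ds x = (\<Prod>i<length ds. det (mat (ds ! i) (ds ! i) (\<lambda>(r, c). x (i, r, c))))"

lemma polyfuns_top_minors: "top_minors ds \<in> polyfuns"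
  unfolding top_minors_def by (intro polyfuns_prod polyfuns_det) (auto intro: polyfuns.coord)

lemma top_minors_nonzero: "\<exists>x :: nat \<times> nat \<times> nat \<Rightarrow> 'a :: field. top_minors ds x \<noteq> 0"
proof -
  have "mat (ds ! i) (ds ! i) (\<lambda>(r, c). if r = c then 1 else 0) = (1\<^sub>m (ds ! i) :: 'a mat)" for i
    by (intro eq_matI) auto
  then have "top_minors ds (\<lambda>(i, r, c). if r = c then 1 else 0 :: 'a) \<noteq> 0"
    unfolding top_minors_def by simp
  then show ?thesis by blast
qed

lemma kernel_zero_if_top_minor:
  fixes A :: "'a :: field mat"
  assumes A: "A \<in> carrier_mat n d" and "d \<le> n" and det: "det (mat d d (($$) A)) \<noteq> 0"
    and v: "v \<in> carrier_vec d" "A *\<^sub>v v = 0\<^sub>v n"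
  shows "v = 0\<^sub>v d"
proof -
  have "mat d d (($$) A) *\<^sub>v v = 0\<^sub>v d"
  proof (rule eq_vecI)
    fix r assume "r < dim_vec (0\<^sub>v d :: 'a vec)"
    then have r: "r < d" by simp
    have "row (mat d d (($$) A)) r = row A r" using r A \<open>d \<le> n\<close> by (intro eq_vecI) auto
    moreover have "(A *\<^sub>v v) $ r = 0\<^sub>v n $ r" using v(2) by simp
    ultimately show "(mat d d (($$) A) *\<^sub>v v) $ r = 0\<^sub>v d $ r" using r A \<open>d \<le> n\<close> by simp
  qed auto
  then show ?thesis using det det_0_iff_vec_prod_zero_field[OF mat_carrier[of d d "($$) A"]] v(1) by metis
qed

lemma subspaces_of_in_Gr_product:
  assumes dv: "dimension_vector ds n" and x: "top_minors ds x \<noteq> 0"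
  shows "subspaces_of ds n x \<in> Gr_product ds n"
    and "i < length ds \<Longrightarrow> basis_matrix (ds ! i) n (subspaces_of ds n x i) (blk n ((!) ds) x i)"
proof -
  have G: "vec_space.col_space n (blk n ((!) ds) x i) \<in> Grassmannian (ds ! i) n" if i: "i < length ds" for i
  proof (rule col_space_in_Grassmannian[OF blk_carrier])
    fix v :: "'a vec" assume v: "v \<in> carrier_vec (ds ! i)" "blk n ((!) ds) x i *\<^sub>v v = 0\<^sub>v n"
    have le: "ds ! i \<le> n" using dv i nth_mem[OF i] unfolding dimension_vector_def by fastforce
    have "mat (ds ! i) (ds ! i) (($$) (blk n ((!) ds) x i)) = mat (ds ! i) (ds ! i) (\<lambda>(r, c). x (i, r, c))"
      using le unfolding blk_def by (intro eq_matI) auto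
    moreover have "det (mat (ds ! i) (ds ! i) (\<lambda>(r, c). x (i, r, c))) \<noteq> 0"
      using x i unfolding top_minors_def by auto
    ultimately have "det (mat (ds ! i) (ds ! i) (($$) (blk n ((!) ds) x i))) \<noteq> 0" by simp
    then show "v = 0\<^sub>v (ds ! i)" by (rule kernel_zero_if_top_minor[OF blk_carrier le _ v])
  qed
  then show "subspaces_of ds n x \<in> Gr_product ds n"
    unfolding Gr_product_def subspaces_of_def by auto
  show "basis_matrix (ds ! i) n (subspaces_of ds n x i) (blk n ((!) ds) x i)" if "i < length ds"
    using G[OF that] that unfolding basis_matrix_def subspaces_of_def by simp
qed

lemma topspace_zariski: "topspace (zariski ds n :: (nat \<Rightarrow> 'a :: field vec set) topology) = Gr_product ds n"
proof -
  have "Gr_product ds n \<subseteq> \<Union>{principal_open ds n f | f :: (nat \<times> nat set, 'a) mpoly. \<exists>e. multihomogeneous ds n e f}"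
  proof
    fix W :: "nat \<Rightarrow> 'a vec set" assume W: "W \<in> Gr_product ds n"
    define one :: "(nat \<times> nat set, 'a) mpoly" where "one = Poly_Mapping.single 0 1"
    have "\<exists>A. basis_matrix (ds ! i) n (W i) A" if "i < length ds" for i
    proof -
      have "W i \<in> Grassmannian (ds ! i) n" using W that unfolding Gr_product_def by auto
      then show ?thesis using Grassmannian_col_space unfolding basis_matrix_def by metis
    qed
    then obtain A where "\<And>i. i < length ds \<Longrightarrow> basis_matrix (ds ! i) n (W i) (A i)" by metis
    then have "W \<in> principal_open ds n one"
      using W unfolding principal_open_def by (auto simp: eval_mpoly_def one_def)
    moreover have "multihomogeneous ds n (\<lambda>_. 0) one"
      unfolding multihomogeneous_def one_def by simp
    ultimately show "W \<in> \<Union>{principal_open ds n f | f :: (nat \<times> nat set, 'a) mpoly. \<exists>e. multihomogeneous ds n e f}"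
      by blast
  qed
  moreover have "principal_open ds n f \<subseteq> Gr_product ds n" for f :: "(nat \<times> nat set, 'a) mpoly"
    unfolding principal_open_def by blast
  ultimately show ?thesis unfolding zariski_def topology_generated_by_topspace by blast
qed

text \<open>
By definition the principal open sets only form a subbase of the topology. For density a weak form of the base property suffices, which survives intersections by irreducibility
of affine space: every nonempty open set contains all sufficiently generic points.
\<close>

lemma zariski_open_contains_principal:
  fixes T :: "(nat \<Rightarrow> 'a :: alg_closed_field vec set) set"
  assumes dv: "dimension_vector ds n"
    and T: "openin (zariski ds n) T" "T \<noteq> {}"
  shows "\<exists>q \<in> polyfuns. (\<exists>x. q x \<noteq> 0) \<and> (\<forall>x. top_minors ds x \<noteq> 0 \<longrightarrow> q x \<noteq> 0 \<longrightarrow> subspaces_of ds n x \<in> T)"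
proof -
  have "generate_topology_on {principal_open ds n f | f. \<exists>e. multihomogeneous ds n e f} T"
    using T(1) unfolding zariski_def by (rule openin_topology_generated_by)
  then show ?thesis using T(2)
  proof induction
    case Empty
    then show ?case by simp
  next
    case (Int a b)
    then obtain q q' where q: "q \<in> polyfuns" "\<exists>x. q x \<noteq> 0" "\<forall>x. top_minors ds x \<noteq> 0 \<longrightarrow> q x \<noteq> 0 \<longrightarrow> subspaces_of ds n x \<in> a"
      and q': "q' \<in> polyfuns" "\<exists>x. q' x \<noteq> 0" "\<forall>x. top_minors ds x \<noteq> 0 \<longrightarrow> q' x \<noteq> 0 \<longrightarrow> subspaces_of ds n x \<in> b"
      by blast
    have "\<exists>x. q x * q' x \<noteq> 0" using polyfuns_mult_nonzero[OF q(1) q'(1)] q(2) q'(2) by auto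
    then show ?case
      using polyfuns.mult[OF q(1) q'(1)] q(3) q'(3) by (intro bexI[of _ "\<lambda>x. q x * q' x"]) auto
  next
    case (UN K)
    then obtain a where a: "a \<in> K" "a \<noteq> {}" by blast
    then show ?case using UN.IH[OF a] by blast
  next
    case (Basis T)
    then obtain f e where f: "T = principal_open ds n f" "multihomogeneous ds n e f" by blast
    define q where "q x = eval_mpoly (\<lambda>(i, I). pluecker (blk n ((!) ds) x i) I) f" for x
    have q: "q \<in> polyfuns" unfolding q_def by (rule polyfuns_eval_mpoly)
    obtain W A where A: "\<And>i. i < length ds \<Longrightarrow> basis_matrix (ds ! i) n (W i) (A i)"
      "eval_mpoly (\<lambda>(i, I). pluecker (A i) I) f \<noteq> 0"
      using Basis(2) f(1) unfolding principal_open_def by auto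
    have "blk n ((!) ds) (\<lambda>(i, r, c). A i $$ (r, c)) i = A i" if "i < length ds" for i
      using A(1)[OF that] unfolding basis_matrix_def blk_def by (intro eq_matI) auto
    then have "q (\<lambda>(i, r, c). A i $$ (r, c)) = eval_mpoly (\<lambda>(i, I). pluecker (A i) I) f"
      unfolding q_def by (rule eval_mpoly_cong[OF f(2)])
    then have "\<exists>x. q x \<noteq> 0" using A(2) by metis
    moreover have "subspaces_of ds n x \<in> T" if "top_minors ds x \<noteq> 0" "q x \<noteq> 0" for x
    proof -
      have "\<exists>A. (\<forall>i<length ds. basis_matrix (ds ! i) n (subspaces_of ds n x i) (A i)) \<and>
          eval_mpoly (\<lambda>(i, I). pluecker (A i) I) f \<noteq> 0"
        using subspaces_of_in_Gr_product(2)[OF dv that(1)] that(2)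
        by (intro exI[of _ "blk n ((!) ds) x"]) (auto simp: q_def)
      then show ?thesis
        unfolding f(1) principal_open_def using subspaces_of_in_Gr_product(1)[OF dv that(1)] by blast
    qed
    ultimately show ?case using q by blast
  qed
qed

lemma subspaces_of_in_orbit:
  assumes equiv: "conf_equiv (length ds) n ((!) ds) (blk n ((!) ds) x) (blk n ((!) ds) y)"
  shows "subspaces_of ds n y \<in> Group_Action.orbit (PGL n) (diagonal_action ds) (subspaces_of ds n x)"
proof -
  obtain g h where g: "g \<in> carrier_mat n n" "det g \<noteq> 0" and h: "\<forall>i<length ds. h i \<in> carrier_mat (ds ! i) (ds ! i) \<and>
      det (h i) \<noteq> 0 \<and> blk n ((!) ds) y i = g * blk n ((!) ds) x i * h i"
    by (rule conf_equivE[OF equiv])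
  have C: "scalar_mats n #>\<^bsub>GL n\<^esub> g \<in> carrier (PGL n)" unfolding carrier_PGL using g carrier_GL by blast
  have "subspaces_of ds n y = diagonal_action ds (scalar_mats n #>\<^bsub>GL n\<^esub> g) (subspaces_of ds n x)"
    unfolding diagonal_action_def
  proof
    fix i
    have "vec_space.col_space n (blk n ((!) ds) y i) =
        PGL_image (scalar_mats n #>\<^bsub>GL n\<^esub> g) (vec_space.col_space n (blk n ((!) ds) x i))" if i: "i < length ds"
    proof -
      have gx: "g * blk n ((!) ds) x i \<in> carrier_mat n (ds ! i)"
        using mult_carrier_mat[OF g(1) blk_carrier[of n "(!) ds" x i]] .
      show ?thesis
        unfolding PGL_image_col_space[OF blk_carrier g(1)]
        using col_space_mult_right[OF gx] h i by simp
    qed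
    then show "subspaces_of ds n y i = (\<lambda>i\<in>{..<length ds}. PGL_image (scalar_mats n #>\<^bsub>GL n\<^esub> g) (subspaces_of ds n x i)) i"
      unfolding subspaces_of_def by auto
  qed
  then show ?thesis unfolding Group_Action.orbit_def using C by blast
qed

theorem dense_if_generic_orbit:
  assumes dv: "dimension_vector ds n"
    and P: "generic_orbit TYPE('a :: alg_closed_field) (length ds) n ((!) ds)"
  shows "dense_dimension_vector TYPE('a) ds n"
proof -
  obtain S :: "(nat \<times> nat \<times> nat \<Rightarrow> 'a) set" where S: "zdense S"
    "\<forall>x\<in>S. \<forall>y\<in>S. conf_equiv (length ds) n ((!) ds) (blk n ((!) ds) x) (blk n ((!) ds) y)"
    by (rule generic_orbitE[OF P])
  obtain x1 :: "nat \<times> nat \<times> nat \<Rightarrow> 'a" where "top_minors ds x1 \<noteq> 0" using top_minors_nonzero by blast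
  then have S': "zdense {x \<in> S. top_minors ds x \<noteq> 0}" by (rule zdense_restrict[OF S(1) polyfuns_top_minors])
  then obtain x0 where x0: "x0 \<in> S" "top_minors ds x0 \<noteq> 0"
    using S'[unfolded zdense_def, rule_format, OF polyfuns.const[of 1]] by auto
  define W where "W = subspaces_of ds n x0"
  have W: "W \<in> Gr_product ds n" unfolding W_def by (rule subspaces_of_in_Gr_product[OF dv x0(2)])
  let ?X = "zariski ds n :: (nat \<Rightarrow> 'a vec set) topology"
  let ?O = "Group_Action.orbit (PGL n) (diagonal_action ds) W"
  have "\<exists>y\<in>?O. y \<in> T" if T: "openin ?X T" "T \<noteq> {}" for T
  proof -
    obtain q where q: "q \<in> polyfuns" "\<exists>x. q x \<noteq> 0"
        "\<forall>x. top_minors ds x \<noteq> 0 \<longrightarrow> q x \<noteq> 0 \<longrightarrow> subspaces_of ds n x \<in> T"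
      using zariski_open_contains_principal[OF dv T] by (elim bexE conjE) (rule that)
    have "\<exists>x\<in>{x \<in> S. top_minors ds x \<noteq> 0}. q x \<noteq> 0"
      by (rule S'[unfolded zdense_def, rule_format, OF q(1,2)])
    then obtain x where x: "x \<in> S" "top_minors ds x \<noteq> 0" "q x \<noteq> 0" by auto
    have "subspaces_of ds n x \<in> ?O"
      unfolding W_def by (rule subspaces_of_in_orbit[OF S(2)[rule_format, OF x0(1) x(1)]])
    then show ?thesis using q(3) x by blast
  qed
  then have "Gr_product ds n \<subseteq> Abstract_Topology.closure_of ?X ?O"
    unfolding closure_of_def topspace_zariski by auto
  moreover have "Abstract_Topology.closure_of ?X ?O \<subseteq> Gr_product ds n"
    using closure_of_subset_topspace topspace_zariski by metis
  ultimately show ?thesis unfolding dense_dimension_vector_def using W by blast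
qed


section \<open>Expansion of determinants in Pluecker coordinates\<close>

text \<open>
Every permutation is a product of transpositions.
\<close>

lemma alternating_permute:
  fixes \<phi> :: "(nat \<Rightarrow> nat) \<Rightarrow> 'a :: comm_ring_1"
  assumes swap: "\<And>f c c'. c < d \<Longrightarrow> c' < d \<Longrightarrow> c \<noteq> c' \<Longrightarrow> \<phi> (f \<circ> Transposition.transpose c c') = - \<phi> f"
    and \<sigma>: "\<sigma> permutes {..<d}"
  shows "\<phi> (f \<circ> \<sigma>) = of_int (sign \<sigma>) * \<phi> f"
  using \<sigma> finite_lessThan
proof (induction arbitrary: f rule: permutes_induct)
  case id
  then show ?case by simp
next
  case (swap a b p)
  have "\<phi> (f \<circ> (Transposition.transpose a b \<circ> p)) = of_int (sign p) * \<phi> (f \<circ> Transposition.transpose a b)"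
    using swap.IH[of "f \<circ> Transposition.transpose a b"] by (simp only: comp_assoc)
  also have "\<dots> = - of_int (sign p) * \<phi> f" using assms(1)[of a b f] swap.hyps by simp
  also have "- sign p = sign (Transposition.transpose a b \<circ> p)"
    using swap.hyps permutes_imp_permutation[of "{..<d}" p]
    by (subst sign_compose) (auto simp: sign_swap_id permutation_swap_id)
  then have "- of_int (sign p) * \<phi> f = of_int (sign (Transposition.transpose a b \<circ> p)) * \<phi> f"
    by (metis of_int_minus)
  finally show ?case .
qed

lemma pluecker_eq_det:
  assumes A: "A \<in> carrier_mat n d" and I: "I \<subseteq> {..<n}" "card I = d"
  shows "pluecker A I = det (mat d d (\<lambda>(a, b). A $$ (pick I a, b)))"
proof -
  have "{i. i < n \<and> i \<in> I} = I" using I(1) by auto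
  then show ?thesis using A I(2) unfolding pluecker_def submatrix_def by (simp add: pick_UNIV)
qed

text \<open>
This is the expansion of an alternating multilinear function of the columns of \<open>A\<close> in maximal minors,
as in the Cauchy-Binet formula. Only injective \<open>f\<close> contribute; those with image \<open>I\<close> are the increasing
enumeration of \<open>I\<close> composed with a permutation, and summing over the permutations gives the minor.
\<close>

lemma alternating_sum_pluecker:
  fixes \<phi> :: "(nat \<Rightarrow> nat) \<Rightarrow> 'a :: field"
  assumes A: "A \<in> carrier_mat n d"
    and cong: "\<And>f f'. (\<And>c. c < d \<Longrightarrow> f c = f' c) \<Longrightarrow> \<phi> f = \<phi> f'"
    and rep: "\<And>f c c'. c < d \<Longrightarrow> c' < d \<Longrightarrow> c \<noteq> c' \<Longrightarrow> f c = f c' \<Longrightarrow> \<phi> f = 0"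
    and swap: "\<And>f c c'. c < d \<Longrightarrow> c' < d \<Longrightarrow> c \<noteq> c' \<Longrightarrow> \<phi> (f \<circ> Transposition.transpose c c') = - \<phi> f"
  shows "(\<Sum>f\<in>{..<d} \<rightarrow>\<^sub>E {..<n}. (\<Prod>c<d. A $$ (f c, c)) * \<phi> f) =
    (\<Sum>I\<in>{I. I \<subseteq> {..<n} \<and> card I = d}. pluecker A I * \<phi> (pick I))"
proof -
  define F where "F = {..<d} \<rightarrow>\<^sub>E {..<n}"
  define G where "G = {f \<in> F. inj_on f {..<d}}"
  define P where "P = {I. I \<subseteq> {..<n} \<and> card I = d}"
  define h where "h f = (\<Prod>c<d. A $$ (f c, c)) * \<phi> f" for f
  have finF: "finite F" unfolding F_def by (intro finite_PiE) auto
  have finG: "finite G" using finF unfolding G_def by simp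
  have finP: "finite P" by (rule finite_subset[of _ "Pow {..<n}"]) (auto simp: P_def)
  have "sum h F = sum h G"
  proof (rule sum.mono_neutral_right[OF finF])
    show "G \<subseteq> F" unfolding G_def by auto
    show "\<forall>f\<in>F - G. h f = 0"
    proof
      fix f assume "f \<in> F - G"
      then obtain c c' where "c < d" "c' < d" "c \<noteq> c'" "f c = f c'" unfolding G_def inj_on_def by auto
      then have "\<phi> f = 0" by (rule rep)
      then show "h f = 0" unfolding h_def by simp
    qed
  qed
  also have "\<dots> = (\<Sum>I\<in>P. \<Sum>f\<in>{f \<in> G. f ` {..<d} = I}. h f)"
  proof (rule sum.group[OF finG finP, symmetric])
    show "(\<lambda>f. f ` {..<d}) ` G \<subseteq> P"
    proof (rule image_subsetI)
      fix f assume f: "f \<in> G"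
      then have "f ` {..<d} \<subseteq> {..<n}" unfolding G_def F_def by blast
      moreover have "card (f ` {..<d}) = d" using f card_image[of f "{..<d}"] unfolding G_def by simp
      ultimately show "f ` {..<d} \<in> P" unfolding P_def by simp
    qed
  qed
  also have "\<dots> = (\<Sum>I\<in>P. pluecker A I * \<phi> (pick I))"
  proof (rule sum.cong[OF refl])
    fix I assume "I \<in> P"
    then have I: "I \<subseteq> {..<n}" "card I = d" unfolding P_def by auto
    then have finI: "finite I" by (auto intro: finite_subset)
    define rk where "rk x = card {a \<in> I. a < x}" for x
    have rk_less: "rk x < d" if "x \<in> I" for x
      unfolding rk_def I(2)[symmetric] using that finI by (intro psubset_card_mono) auto
    have pick_rk: "pick I (rk x) = x" if "x \<in> I" for x unfolding rk_def using that by (rule pick_card_in_set)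
    have pickI: "pick I c \<in> I" and rk_pick: "rk (pick I c) = c" if "c < d" for c
      using that I(2) pick_in_set_le card_pick_le unfolding rk_def by auto
    have "(\<Sum>f\<in>{f \<in> G. f ` {..<d} = I}. h f) =
        (\<Sum>\<sigma>\<in>{\<sigma>. \<sigma> permutes {..<d}}. h (restrict (pick I \<circ> \<sigma>) {..<d}))"
    proof (rule sum.reindex_bij_witness[where i = "\<lambda>\<sigma>. restrict (pick I \<circ> \<sigma>) {..<d}"
          and j = "\<lambda>f c. if c < d then rk (f c) else c"])
      fix f assume f: "f \<in> {f \<in> G. f ` {..<d} = I}"
      then have fI: "f c \<in> I" if "c < d" for c using that by auto
      have fext: "f \<in> extensional {..<d}" using f unfolding G_def F_def by (auto simp: PiE_def)
      show 1: "restrict (pick I \<circ> (\<lambda>c. if c < d then rk (f c) else c)) {..<d} = f"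
      proof
        fix c show "restrict (pick I \<circ> (\<lambda>c. if c < d then rk (f c) else c)) {..<d} c = f c"
          using fI pick_rk fext by (cases "c < d") (auto simp: extensional_def)
      qed
      have inj: "inj_on (\<lambda>c. if c < d then rk (f c) else c) {..<d}"
      proof (rule inj_onI)
        fix c c' assume c: "c \<in> {..<d}" "c' \<in> {..<d}"
          and "(if c < d then rk (f c) else c) = (if c' < d then rk (f c') else c')"
        then have "rk (f c) = rk (f c')" by simp
        then have "f c = f c'" using pick_rk fI c by (metis lessThan_iff)
        then show "c = c'" using f c unfolding G_def inj_on_def by auto
      qed
      have "(\<lambda>c. if c < d then rk (f c) else c) ` {..<d} \<subseteq> {..<d}" using rk_less fI by auto
      then have "bij_betw (\<lambda>c. if c < d then rk (f c) else c) {..<d} {..<d}"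
        using inj endo_inj_surj[OF finite_lessThan _ inj] unfolding bij_betw_def by blast
      then show "(\<lambda>c. if c < d then rk (f c) else c) \<in> {\<sigma>. \<sigma> permutes {..<d}}"
        by (auto intro!: bij_imp_permutes split: if_splits)
      show "h (restrict (pick I \<circ> (\<lambda>c. if c < d then rk (f c) else c)) {..<d}) = h f" unfolding 1 ..
    next
      fix \<sigma> assume "\<sigma> \<in> {\<sigma>. \<sigma> permutes {..<d}}"
      then have \<sigma>: "\<sigma> permutes {..<d}" by simp
      have \<sigma>d: "\<sigma> c < d" if "c < d" for c using permutes_in_image[OF \<sigma>, of c] that by simp
      show "(\<lambda>c. if c < d then rk (restrict (pick I \<circ> \<sigma>) {..<d} c) else c) = \<sigma>"
      proof
        fix c show "(if c < d then rk (restrict (pick I \<circ> \<sigma>) {..<d} c) else c) = \<sigma> c"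
          using rk_pick \<sigma>d permutes_not_in[OF \<sigma>, of c] by auto
      qed
      have im: "restrict (pick I \<circ> \<sigma>) {..<d} ` {..<d} = I"
      proof
        show "restrict (pick I \<circ> \<sigma>) {..<d} ` {..<d} \<subseteq> I" using pickI \<sigma>d by auto
        show "I \<subseteq> restrict (pick I \<circ> \<sigma>) {..<d} ` {..<d}"
        proof
          fix x assume x: "x \<in> I"
          obtain c where "c < d" "\<sigma> c = rk x"
            using permutes_image[OF \<sigma>] rk_less[OF x] by (metis image_iff lessThan_iff)
          then show "x \<in> restrict (pick I \<circ> \<sigma>) {..<d} ` {..<d}"
            using pick_rk[OF x] by (auto intro!: image_eqI[of _ _ c])
        qed
      qed
      then have "inj_on (restrict (pick I \<circ> \<sigma>) {..<d}) {..<d}"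
        using I(2) by (intro eq_card_imp_inj_on) auto
      moreover have "restrict (pick I \<circ> \<sigma>) {..<d} \<in> F"
        unfolding F_def using subsetD[OF I(1) pickI] \<sigma>d by auto
      ultimately show "restrict (pick I \<circ> \<sigma>) {..<d} \<in> {f \<in> G. f ` {..<d} = I}"
        unfolding G_def using im by simp
    qed
    also have "\<dots> = (\<Sum>\<sigma>\<in>{\<sigma>. \<sigma> permutes {..<d}}. of_int (sign \<sigma>) * (\<Prod>c<d. A $$ (pick I (\<sigma> c), c)) * \<phi> (pick I))"
    proof (rule sum.cong[OF refl])
      fix \<sigma> assume "\<sigma> \<in> {\<sigma>. \<sigma> permutes {..<d}}"
      then have \<sigma>: "\<sigma> permutes {..<d}" by simp
      have "\<phi> (restrict (pick I \<circ> \<sigma>) {..<d}) = \<phi> (pick I \<circ> \<sigma>)" by (rule cong) simp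
      also have "\<dots> = of_int (sign \<sigma>) * \<phi> (pick I)"
        by (rule alternating_permute[OF swap \<sigma>])
      finally show "h (restrict (pick I \<circ> \<sigma>) {..<d}) =
          of_int (sign \<sigma>) * (\<Prod>c<d. A $$ (pick I (\<sigma> c), c)) * \<phi> (pick I)"
        unfolding h_def by simp
    qed
    also have "\<dots> = (\<Sum>\<sigma>\<in>{\<sigma>. \<sigma> permutes {..<d}}. of_int (sign \<sigma>) * (\<Prod>c<d. A $$ (pick I (\<sigma> c), c))) * \<phi> (pick I)"
      by (simp add: sum_distrib_right)
    also have "(\<Sum>\<sigma>\<in>{\<sigma>. \<sigma> permutes {..<d}}. of_int (sign \<sigma>) * (\<Prod>c<d. A $$ (pick I (\<sigma> c), c))) = pluecker A I"
      unfolding pluecker_eq_det[OF A I] det_col[OF mat_carrier]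
      by (intro sum.cong) (auto simp: lessThan_atLeast0 permutes_in_image intro!: prod.cong)
    finally show "(\<Sum>f\<in>{f \<in> G. f ` {..<d} = I}. h f) = pluecker A I * \<phi> (pick I)" .
  qed
  finally show ?thesis unfolding F_def P_def h_def .
qed

definition coord_mat :: "nat \<Rightarrow> nat \<Rightarrow> (nat \<Rightarrow> nat) \<Rightarrow> 'a :: field mat" where
  "coord_mat n d f = mat n d (\<lambda>(r, c). if r = f c then 1 else 0)"

lemma coord_mat_carrier [simp]: "coord_mat n d f \<in> carrier_mat n d"
  unfolding coord_mat_def by simp

lemma coord_mat_dim [simp]: "dim_row (coord_mat n d f) = n" "dim_col (coord_mat n d f) = d"
  unfolding coord_mat_def by simp_all

lemma mult_coord_mat:
  fixes S :: "'a :: field mat"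
  assumes "S \<in> carrier_mat N n" "r < N" "c < d" "f c < n"
  shows "(S * coord_mat n d f) $$ (r, c) = S $$ (r, f c)"
proof -
  have "col (coord_mat n d f) c = (unit_vec n (f c) :: 'a vec)"
    using assms unfolding coord_mat_def by (intro eq_vecI) auto
  then have "(S * coord_mat n d f) $$ (r, c) = row S r \<bullet> unit_vec n (f c)"
    using assms coord_mat_carrier[of n d f] by simp
  also have "\<dots> = S $$ (r, f c)" using assms by (simp add: scalar_prod_right_unit)
  finally show ?thesis .
qed

context column_blocks
begin

lemma prod_columns: "(\<Prod>j<N. g j) = (\<Prod>i<k. \<Prod>c<d i. g (idx i c))"
proof -
  have "(\<Prod>j<N. g j) = (\<Prod>j<N. g (idx (bi j) (po j)))"
    by (rule prod.cong) (auto simp: idx_inverse)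
  also have "\<dots> = (\<Prod>(i, c)\<in>(SIGMA i:{..<k}. {..<d i}). g (idx i c))"
    using prod.reindex_bij_betw[OF bij, of "\<lambda>(i, c). g (idx i c)"] by simp
  finally show ?thesis by (simp add: prod.Sigma)
qed

lemma col_hcat: "j < N \<Longrightarrow> X (bi j) \<in> carrier_mat m (d (bi j)) \<Longrightarrow> col (hcat m X) j = col (X (bi j)) (po j)"
  using po_less[of j] unfolding hcat_def by (intro eq_vecI) auto

lemma hcat_idx: "i < k \<Longrightarrow> c < d i \<Longrightarrow> r < m \<Longrightarrow> hcat m X $$ (r, idx i c) = X i $$ (r, c)"
  using idx[of i c] unfolding hcat_def by simp

text \<open>
Multilinearity of the determinant in the columns of the block \<open>l\<close>, on the level of the Leibniz formula.
\<close>

lemma det_block_expand: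
  fixes A S :: "nat \<Rightarrow> 'a :: field mat"
  assumes A: "\<And>i. i < k \<Longrightarrow> A i \<in> carrier_mat n (d i)" and S: "\<And>i. i < k \<Longrightarrow> S i \<in> carrier_mat N n"
    and l: "l < k"
  shows "det (hcat N (\<lambda>i. S i * A i)) = (\<Sum>f\<in>{..<d l} \<rightarrow>\<^sub>E {..<n}. (\<Prod>c<d l. A l $$ (f c, c)) *
    det (hcat N (\<lambda>i. S i * (A(l := coord_mat n (d l) f)) i)))"
proof -
  define Q where "Q = {p. p permutes {0..<N}}"
  define R where "R p = (\<Prod>i\<in>{..<k} - {l}. \<Prod>c<d i. (S i * A i) $$ (p (idx i c), c))" for p
  have pN: "p (idx i c) < N" if "p \<in> Q" "i < k" "c < d i" for p i c
    using that idx[of i c] permutes_in_image[of p "{0..<N}" "idx i c"] unfolding Q_def by simp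
  have split: "(\<Prod>j<N. hcat N X $$ (p j, j)) =
      (\<Prod>c<d l. X l $$ (p (idx l c), c)) * (\<Prod>i\<in>{..<k} - {l}. \<Prod>c<d i. X i $$ (p (idx i c), c))"
    if p: "p \<in> Q" for p and X :: "nat \<Rightarrow> 'a mat"
  proof -
    have "(\<Prod>j<N. hcat N X $$ (p j, j)) = (\<Prod>i<k. \<Prod>c<d i. X i $$ (p (idx i c), c))"
      unfolding prod_columns by (intro prod.cong) (auto simp: hcat_idx pN[OF p])
    also have "\<dots> = (\<Prod>c<d l. X l $$ (p (idx l c), c)) * (\<Prod>i\<in>{..<k} - {l}. \<Prod>c<d i. X i $$ (p (idx i c), c))"
      using l by (subst prod.remove[of _ l]) auto
    finally show ?thesis .
  qed
  have term1: "(\<Prod>j<N. hcat N (\<lambda>i. S i * A i) $$ (p j, j)) =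
      (\<Sum>f\<in>{..<d l} \<rightarrow>\<^sub>E {..<n}. (\<Prod>c<d l. A l $$ (f c, c)) * ((\<Prod>c<d l. S l $$ (p (idx l c), f c)) * R p))"
    if p: "p \<in> Q" for p
  proof -
    have "(\<Prod>c<d l. (S l * A l) $$ (p (idx l c), c)) = (\<Prod>c<d l. \<Sum>s<n. A l $$ (s, c) * S l $$ (p (idx l c), s))"
      using A[OF l] S[OF l] pN[OF p l]
      by (intro prod.cong) (auto simp: scalar_prod_def lessThan_atLeast0 mult.commute)
    also have "\<dots> = (\<Sum>f\<in>{..<d l} \<rightarrow>\<^sub>E {..<n}. \<Prod>c<d l. A l $$ (f c, c) * S l $$ (p (idx l c), f c))"
      by (intro prod_sum_PiE) auto
    finally show ?thesis
      unfolding split[OF p] R_def[symmetric] by (simp add: sum_distrib_right prod.distrib mult.assoc)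
  qed
  have term2: "(\<Prod>c<d l. S l $$ (p (idx l c), f c)) * R p =
      (\<Prod>j<N. hcat N (\<lambda>i. S i * (A(l := coord_mat n (d l) f)) i) $$ (p j, j))"
    if p: "p \<in> Q" and f: "f \<in> {..<d l} \<rightarrow>\<^sub>E {..<n}" for p f
  proof -
    have "(\<Prod>c<d l. (S l * coord_mat n (d l) f) $$ (p (idx l c), c)) = (\<Prod>c<d l. S l $$ (p (idx l c), f c))"
      using f pN[OF p l] by (intro prod.cong refl mult_coord_mat[OF S[OF l]]) auto
    moreover have "(\<Prod>i\<in>{..<k} - {l}. \<Prod>c<d i. (S i * (A(l := coord_mat n (d l) f)) i) $$ (p (idx i c), c)) = R p"
      unfolding R_def by (intro prod.cong) auto
    ultimately show ?thesis unfolding split[OF p] by simp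
  qed
  have "det (hcat N (\<lambda>i. S i * A i)) = (\<Sum>p\<in>Q. signof p * (\<Prod>j<N. hcat N (\<lambda>i. S i * A i) $$ (p j, j)))"
    unfolding Q_def by (rule det_col[OF hcat_carrier])
  also have "\<dots> = (\<Sum>p\<in>Q. \<Sum>f\<in>{..<d l} \<rightarrow>\<^sub>E {..<n}. (\<Prod>c<d l. A l $$ (f c, c)) *
      (signof p * (\<Prod>j<N. hcat N (\<lambda>i. S i * (A(l := coord_mat n (d l) f)) i) $$ (p j, j))))"
    by (intro sum.cong refl) (simp add: term1 term2 sum_distrib_left mult.left_commute cong: sum.cong)
  also have "\<dots> = (\<Sum>f\<in>{..<d l} \<rightarrow>\<^sub>E {..<n}. (\<Prod>c<d l. A l $$ (f c, c)) *
      (\<Sum>p\<in>Q. signof p * (\<Prod>j<N. hcat N (\<lambda>i. S i * (A(l := coord_mat n (d l) f)) i) $$ (p j, j))))"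
    by (subst sum.swap) (simp add: sum_distrib_left)
  also have "\<dots> = (\<Sum>f\<in>{..<d l} \<rightarrow>\<^sub>E {..<n}. (\<Prod>c<d l. A l $$ (f c, c)) *
    det (hcat N (\<lambda>i. S i * (A(l := coord_mat n (d l) f)) i)))"
    unfolding Q_def by (simp only: det_col[OF hcat_carrier])
  finally show ?thesis .
qed

text \<open>
The determinant is alternating in the columns of each block \<open>A l\<close>, so each block enters only through its
Pluecker coordinates.
\<close>

lemma det_block_pluecker:
  fixes A S :: "nat \<Rightarrow> 'a :: field mat"
  assumes A: "\<And>i. i < k \<Longrightarrow> A i \<in> carrier_mat n (d i)" and S: "\<And>i. i < k \<Longrightarrow> S i \<in> carrier_mat N n"
    and l: "l < k"
  shows "det (hcat N (\<lambda>i. S i * A i)) = (\<Sum>I\<in>{I. I \<subseteq> {..<n} \<and> card I = d l}. pluecker (A l) I *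
    det (hcat N (\<lambda>i. S i * (A(l := coord_mat n (d l) (pick I))) i)))"
proof -
  define M where "M f = hcat N (\<lambda>i. S i * (A(l := coord_mat n (d l) f)) i)" for f
  have M: "M f \<in> carrier_mat N N" for f unfolding M_def by simp
  have X: "S i * (A(l := coord_mat n (d l) f)) i \<in> carrier_mat N (d i)" if "i < k" for f i
    using A[OF that] S[OF that] coord_mat_carrier[of n "d l" f] by auto
  have colM: "col (M f) j = (if bi j = l then S l *\<^sub>v col (coord_mat n (d l) f) (po j) else col (S (bi j) * A (bi j)) (po j))"
    if j: "j < N" for f j
  proof -
    have "col (M f) j = col (S (bi j) * (A(l := coord_mat n (d l) f)) (bi j)) (po j)"
      unfolding M_def by (rule col_hcat[where X = "\<lambda>i. S i * (A(l := coord_mat n (d l) f)) i", OF j X[OF bi_less[OF j]]])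
    moreover have "col (S l * coord_mat n (d l) f) (po j) = S l *\<^sub>v col (coord_mat n (d l) f) (po j)"
      if "bi j = l"
      using S[OF l] po_less[OF j] that coord_mat_carrier[of n "d l" f] by (intro eq_vecI) auto
    ultimately show ?thesis by auto
  qed
  have colE: "col (coord_mat n (d l) f) c = (col (coord_mat n (d l) f') c' :: 'a vec)"
    if "c < d l" "c' < d l" "f c = f' c'" for f f' c c'
    using that unfolding coord_mat_def by (intro eq_vecI) auto
  have "(\<Sum>f\<in>{..<d l} \<rightarrow>\<^sub>E {..<n}. (\<Prod>c<d l. A l $$ (f c, c)) * det (M f)) =
      (\<Sum>I\<in>{I. I \<subseteq> {..<n} \<and> card I = d l}. pluecker (A l) I * det (M (pick I)))"
  proof (rule alternating_sum_pluecker[OF A[OF l]])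
    fix f f' :: "nat \<Rightarrow> nat" assume "\<And>c. c < d l \<Longrightarrow> f c = f' c"
    then have "coord_mat n (d l) f = (coord_mat n (d l) f' :: 'a mat)"
      unfolding coord_mat_def by (intro cong_mat) auto
    then show "det (M f) = det (M f')" unfolding M_def by simp
  next
    fix f :: "nat \<Rightarrow> nat" and c c' assume c: "c < d l" "c' < d l" "c \<noteq> c'" "f c = f c'"
    have "col (M f) (idx l c) = col (M f) (idx l c')"
      using colM idx[OF l c(1)] idx[OF l c(2)] colE[of c c' f f, OF c(1,2,4)] by simp
    moreover have "idx l c \<noteq> idx l c'" using idx(3)[OF l c(1)] idx(3)[OF l c(2)] c(3) by metis
    ultimately show "det (M f) = 0"
      using det_identical_columns[OF M] idx(1)[OF l c(1)] idx(1)[OF l c(2)] by blast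
  next
    fix f :: "nat \<Rightarrow> nat" and c c' assume c: "c < d l" "c' < d l" "c \<noteq> c'"
    have ne: "idx l c \<noteq> idx l c'" using idx(3)[OF l c(1)] idx(3)[OF l c(2)] c(3) by metis
    have "M (f \<circ> Transposition.transpose c c') = swapcols (idx l c) (idx l c') (M f)"
    proof (rule mat_col_eqI)
      fix j assume "j < dim_col (swapcols (idx l c) (idx l c') (M f))"
      then have j: "j < N" using M[of f] by simp
      have jc: "po j \<noteq> c" if "bi j = l" "j \<noteq> idx l c" using that idx_inverse[OF j] by auto
      have jc': "po j \<noteq> c'" if "bi j = l" "j \<noteq> idx l c'" using that idx_inverse[OF j] by auto
      have "col (swapcols (idx l c) (idx l c') (M f)) j =
          col (M f) (if j = idx l c then idx l c' else if j = idx l c' then idx l c else j)"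
        using j M[of f] idx(1)[OF l c(1)] idx(1)[OF l c(2)] by (intro eq_vecI) auto
      also have "\<dots> = col (M (f \<circ> Transposition.transpose c c')) j"
      proof -
        consider "j = idx l c" | "j = idx l c'" | "j \<noteq> idx l c" "j \<noteq> idx l c'" by blast
        then show ?thesis
        proof cases
          case 1
          then show ?thesis
            using ne colM[OF idx(1)[OF l c(1)]] colM[OF idx(1)[OF l c(2)]] idx[OF l c(1)] idx[OF l c(2)]
              colE[OF c(2,1), of f "f \<circ> Transposition.transpose c c'"] by simp
        next
          case 2
          then show ?thesis
            using ne colM[OF idx(1)[OF l c(1)]] colM[OF idx(1)[OF l c(2)]] idx[OF l c(1)] idx[OF l c(2)]
              colE[OF c(1,2), of f "f \<circ> Transposition.transpose c c'"] by simp
        next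
          case 3
          have "bi j = l \<Longrightarrow> col (coord_mat n (d l) f) (po j) =
              (col (coord_mat n (d l) (f \<circ> Transposition.transpose c c')) (po j) :: 'a vec)"
            using jc jc' 3 po_less[OF j] by (intro colE) (auto simp: Transposition.transpose_def)
          then show ?thesis using 3 colM[OF j] by simp
        qed
      qed
      finally show "col (M (f \<circ> Transposition.transpose c c')) j = col (swapcols (idx l c) (idx l c') (M f)) j" ..
    qed (use M[of f] M[of "f \<circ> Transposition.transpose c c'"] in auto)
    then show "det (M (f \<circ> Transposition.transpose c c')) = - det (M f)"
      using det_swapcols[OF idx(1)[OF l c(1)] idx(1)[OF l c(2)] ne M] by simp
  qed
  then show ?thesis using det_block_expand[of A n S l] A S l unfolding M_def by simp
qed

end


section \<open>Multilinear forms in Pluecker coordinates\<close>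

text \<open>
Functions of a matrix tuple that are multihomogeneous of degree one in the Pluecker coordinates of each
matrix.
\<close>

definition pluecker_form :: "nat list \<Rightarrow> nat \<Rightarrow> ((nat \<Rightarrow> 'a :: field mat) \<Rightarrow> 'a) \<Rightarrow> bool" where
  "pluecker_form ds n \<Phi> \<longleftrightarrow> (\<exists>f. multihomogeneous ds n (\<lambda>_. 1) f \<and>
     (\<forall>A. (\<forall>i<length ds. A i \<in> carrier_mat n (ds ! i)) \<longrightarrow>
        \<Phi> A = eval_mpoly (\<lambda>(i, I). pluecker (A i) I) f))"

lemma eval_mpoly_superset:
  assumes "finite K" "Poly_Mapping.keys f \<subseteq> K"
  shows "eval_mpoly x f = (\<Sum>m\<in>K. Poly_Mapping.lookup f m *
        (\<Prod>v\<in>Poly_Mapping.keys m. x v ^ Poly_Mapping.lookup m v))"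
  unfolding eval_mpoly_def using assms by (intro sum.mono_neutral_left) (auto simp: in_keys_iff)

lemma eval_mpoly_add: "eval_mpoly x (f + g) = eval_mpoly x f + eval_mpoly x g"
proof -
  define K where "K = Poly_Mapping.keys f \<union> Poly_Mapping.keys g"
  have K: "finite K" unfolding K_def by simp
  have sub: "Poly_Mapping.keys f \<subseteq> K" "Poly_Mapping.keys g \<subseteq> K" "Poly_Mapping.keys (f + g) \<subseteq> K"
    unfolding K_def using keys_add[of f g] by auto
  show ?thesis
    unfolding eval_mpoly_superset[OF K sub(1)] eval_mpoly_superset[OF K sub(2)] eval_mpoly_superset[OF K sub(3)]
    by (simp add: lookup_add algebra_simps sum.distrib)
qed

lemma lookup_scale: "Poly_Mapping.lookup (Poly_Mapping.map ((*) c) f) m = c * Poly_Mapping.lookup f m"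
  for c :: "'a :: mult_zero"
  by (cases "Poly_Mapping.lookup f m = 0") (simp_all add: map.rep_eq)

lemma keys_scale: "Poly_Mapping.keys (Poly_Mapping.map ((*) c) f) \<subseteq> Poly_Mapping.keys f"
  for c :: "'a :: mult_zero"
  by (auto simp: in_keys_iff lookup_scale)

lemma eval_mpoly_scale: "eval_mpoly x (Poly_Mapping.map ((*) c) f) = c * eval_mpoly x f"
proof -
  have "eval_mpoly x (Poly_Mapping.map ((*) c) f) = (\<Sum>m\<in>Poly_Mapping.keys f. c * Poly_Mapping.lookup f m *
        (\<Prod>v\<in>Poly_Mapping.keys m. x v ^ Poly_Mapping.lookup m v))"
    using eval_mpoly_superset[OF finite_keys keys_scale[of c f]] by (simp add: lookup_scale)
  then show ?thesis unfolding eval_mpoly_def by (simp add: sum_distrib_left mult.assoc)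
qed

lemma pluecker_form_add:
  assumes "pluecker_form ds n \<Phi>" "pluecker_form ds n \<Psi>"
  shows "pluecker_form ds n (\<lambda>A. \<Phi> A + \<Psi> A)"
proof -
  obtain f where f: "multihomogeneous ds n (\<lambda>_. 1) f"
    "\<forall>A. (\<forall>i<length ds. A i \<in> carrier_mat n (ds ! i)) \<longrightarrow> \<Phi> A = eval_mpoly (\<lambda>(i, I). pluecker (A i) I) f"
    using assms(1) unfolding pluecker_form_def by (elim exE conjE) (rule that)
  obtain g where g: "multihomogeneous ds n (\<lambda>_. 1) g"
    "\<forall>A. (\<forall>i<length ds. A i \<in> carrier_mat n (ds ! i)) \<longrightarrow> \<Psi> A = eval_mpoly (\<lambda>(i, I). pluecker (A i) I) g"
    using assms(2) unfolding pluecker_form_def by (elim exE conjE) (rule that)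
  have "multihomogeneous ds n (\<lambda>_. 1) (f + g)"
    using f(1) g(1) keys_add[of f g] unfolding multihomogeneous_def by blast
  then show ?thesis
    unfolding pluecker_form_def by (rule exI[of _ "f + g", OF conjI]) (simp add: eval_mpoly_add f(2) g(2))
qed

lemma pluecker_form_scale:
  assumes "pluecker_form ds n \<Phi>"
  shows "pluecker_form ds n (\<lambda>A. c * \<Phi> A)"
proof -
  obtain f where f: "multihomogeneous ds n (\<lambda>_. 1) f"
    "\<forall>A. (\<forall>i<length ds. A i \<in> carrier_mat n (ds ! i)) \<longrightarrow> \<Phi> A = eval_mpoly (\<lambda>(i, I). pluecker (A i) I) f"
    using assms(1) unfolding pluecker_form_def by (elim exE conjE) (rule that)
  have "multihomogeneous ds n (\<lambda>_. 1) (Poly_Mapping.map ((*) c) f)"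
    using f(1) keys_scale[of c f] unfolding multihomogeneous_def by blast
  then show ?thesis
    unfolding pluecker_form_def
    by (rule exI[of _ "Poly_Mapping.map ((*) c) f", OF conjI]) (simp add: eval_mpoly_scale f(2))
qed

lemma pluecker_form_sum:
  assumes "\<And>J. J \<in> X \<Longrightarrow> pluecker_form ds n (\<Phi> J)"
  shows "pluecker_form ds n (\<lambda>A. \<Sum>J\<in>X. \<Phi> J A)"
proof -
  have zero: "pluecker_form ds n (\<lambda>A. 0)"
    unfolding pluecker_form_def by (rule exI[of _ 0]) (simp add: multihomogeneous_def eval_mpoly_def)
  show ?thesis
    using assms by (induction X rule: infinite_finite_induct) (simp_all add: zero pluecker_form_add)
qed

lemma pluecker_form_cong:
  assumes "pluecker_form ds n \<Psi>"
    and "\<And>A. (\<forall>i<length ds. A i \<in> carrier_mat n (ds ! i)) \<Longrightarrow> \<Phi> A = \<Psi> A"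
  shows "pluecker_form ds n \<Phi>"
  using assms unfolding pluecker_form_def by simp

lemma pluecker_form_monomial:
  assumes I: "\<And>i. i < length ds \<Longrightarrow> I i \<subseteq> {..<n} \<and> card (I i) = ds ! i"
  shows "pluecker_form ds n (\<lambda>A. \<Prod>i<length ds. pluecker (A i) (I i))"
proof -
  define m :: "nat \<times> nat set \<Rightarrow>\<^sub>0 nat" where "m = (\<Sum>i<length ds. Poly_Mapping.single (i, I i) 1)"
  have lookup: "Poly_Mapping.lookup m v = (if fst v < length ds \<and> snd v = I (fst v) then 1 else 0)" for v
  proof -
    have "Poly_Mapping.lookup m v = (\<Sum>i<length ds. if i = fst v then (if snd v = I (fst v) then 1 else 0) else 0)"
      unfolding m_def lookup_sum by (cases v, intro sum.cong refl) (simp add: lookup_single when_def)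
    then show ?thesis by (simp add: sum.delta)
  qed
  have keys: "Poly_Mapping.keys m = (\<lambda>i. (i, I i)) ` {..<length ds}"
    by (auto simp: in_keys_iff lookup split: if_splits)
  have "multihomogeneous ds n (\<lambda>_. 1) (Poly_Mapping.single m (1 :: 'a))"
    unfolding multihomogeneous_def
  proof (intro ballI conjI allI impI)
    fix m' assume "m' \<in> Poly_Mapping.keys (Poly_Mapping.single m (1 :: 'a))"
    then have m': "m' = m" by simp
    show "Poly_Mapping.keys m' \<subseteq> pluecker_variables ds n"
      unfolding m' keys pluecker_variables_def using I by auto
    fix i assume i: "i < length ds"
    then have "{v \<in> Poly_Mapping.keys m. fst v = i} = {(i, I i)}" unfolding keys by auto
    then show "(\<Sum>v\<in>{v \<in> Poly_Mapping.keys m'. fst v = i}. Poly_Mapping.lookup m' v) = 1"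
      unfolding m' using i by (simp add: lookup)
  qed
  moreover have "(\<Prod>i<length ds. pluecker (A i) (I i)) =
      eval_mpoly (\<lambda>(i, I). pluecker (A i) I) (Poly_Mapping.single m 1)" for A :: "nat \<Rightarrow> 'a mat"
  proof -
    have "inj_on (\<lambda>i. (i, I i)) {..<length ds}" by (auto intro: inj_onI)
    then show ?thesis unfolding eval_mpoly_def by (simp add: keys prod.reindex lookup)
  qed
  ultimately show ?thesis unfolding pluecker_form_def by blast
qed

text \<open>
The blocks are expanded one after the other. After \<open>m\<close> steps the determinant is a combination of terms
\<open>\<Psi> m I\<close>, in which the first \<open>m\<close> blocks have been replaced by coordinate matrices and have left their
Pluecker coordinates as factors; after the last step only a scalar times a monomial remains.
\<close>

lemma pluecker_form_det:
  fixes S :: "nat \<Rightarrow> 'a :: field mat"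
  assumes cb: "column_blocks (length ds) ((!) ds) N bi po"
    and S: "\<And>i. i < length ds \<Longrightarrow> S i \<in> carrier_mat N n"
  shows "pluecker_form ds n (\<lambda>A. det (column_blocks.hcat N bi po N (\<lambda>i. S i * A i)))"
proof -
  interpret column_blocks "length ds" "(!) ds" N bi po by (rule cb)
  define P where "P i = {I. I \<subseteq> {..<n} \<and> card I = ds ! i}" for i
  define \<Psi> where "\<Psi> m I A = (\<Prod>i<m. pluecker (A i) (I i)) *
      det (hcat N (\<lambda>i. S i * (if i < m then coord_mat n (ds ! i) (pick (I i)) else A i)))"
    for m and I :: "nat \<Rightarrow> nat set" and A :: "nat \<Rightarrow> 'a mat"
  have "0 \<le> length ds" by simp
  then have "\<forall>I. (\<forall>i<0. I i \<in> P i) \<longrightarrow> pluecker_form ds n (\<Psi> 0 I)"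
  proof (induction rule: inc_induct)
    case base
    show ?case
    proof (intro allI impI)
      fix I assume "\<forall>i<length ds. I i \<in> P i"
      then have mono: "pluecker_form ds n (\<lambda>A :: nat \<Rightarrow> 'a mat. \<Prod>i<length ds. pluecker (A i) (I i))"
        by (intro pluecker_form_monomial) (auto simp: P_def)
      have "hcat N (\<lambda>i. S i * (if i < length ds then coord_mat n (ds ! i) (pick (I i)) else A i)) =
          hcat N (\<lambda>i. S i * coord_mat n (ds ! i) (pick (I i)))" for A
        by (rule hcat_cong) simp
      then show "pluecker_form ds n (\<Psi> (length ds) I)"
        using pluecker_form_scale[OF mono, of "det (hcat N (\<lambda>i. S i * coord_mat n (ds ! i) (pick (I i))))"]
        unfolding \<Psi>_def by (simp add: mult.commute)
    qed
  next
    case (step m)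
    show ?case
    proof (intro allI impI)
      fix I assume I: "\<forall>i<m. I i \<in> P i"
      have "pluecker_form ds n (\<lambda>A. \<Sum>J\<in>P m. \<Psi> (Suc m) (I(m := J)) A)"
      proof (rule pluecker_form_sum)
        fix J assume "J \<in> P m"
        then have "\<forall>i<Suc m. (I(m := J)) i \<in> P i" using I by (auto simp: less_Suc_eq)
        then show "pluecker_form ds n (\<Psi> (Suc m) (I(m := J)))" using step.IH by blast
      qed
      then show "pluecker_form ds n (\<Psi> m I)"
      proof (rule pluecker_form_cong)
        fix A :: "nat \<Rightarrow> 'a mat" assume A: "\<forall>i<length ds. A i \<in> carrier_mat n (ds ! i)"
        define A' where "A' i = (if i < m then coord_mat n (ds ! i) (pick (I i)) else A i)" for i
        have A': "A' i \<in> carrier_mat n (ds ! i)" if "i < length ds" for i using A that unfolding A'_def by simp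
        have upd: "A'(m := coord_mat n (ds ! m) (pick J)) =
            (\<lambda>i. if i < Suc m then coord_mat n (ds ! i) (pick ((I(m := J)) i)) else A i)" for J
          unfolding A'_def by (auto simp: less_Suc_eq)
        have "\<Psi> m I A = (\<Prod>i<m. pluecker (A i) (I i)) * det (hcat N (\<lambda>i. S i * A' i))"
          unfolding \<Psi>_def A'_def ..
        also have "det (hcat N (\<lambda>i. S i * A' i)) = (\<Sum>J\<in>P m. pluecker (A m) J *
            det (hcat N (\<lambda>i. S i * (A'(m := coord_mat n (ds ! m) (pick J))) i)))"
          using det_block_pluecker[of A' n S m] A' S step.hyps unfolding P_def by (simp add: A'_def)
        also have "(\<Prod>i<m. pluecker (A i) (I i)) * \<dots> = (\<Sum>J\<in>P m. \<Psi> (Suc m) (I(m := J)) A)"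
          unfolding sum_distrib_left upd \<Psi>_def by (intro sum.cong) (auto simp: mult.assoc)
        finally show "\<Psi> m I A = (\<Sum>J\<in>P m. \<Psi> (Suc m) (I(m := J)) A)" .
      qed
    qed
  qed
  then have "pluecker_form ds n (\<Psi> 0 (\<lambda>_. {}))" by blast
  then show ?thesis unfolding \<Psi>_def by simp
qed

section \<open>Invariants of four subspaces\<close>

text \<open>
A dense set meets the locus where a form does not vanish, provided that the form is nonzero at some tuple
of matrices with independent columns.
\<close>

lemma principal_open_if_form_nonzero:
  fixes \<Phi> :: "(nat \<Rightarrow> 'a :: field mat) \<Rightarrow> 'a"
  assumes form: "pluecker_form ds n \<Phi>" and A: "\<And>i. i < length ds \<Longrightarrow> A i \<in> carrier_mat n (ds ! i)"
    and inj: "\<And>i v. i < length ds \<Longrightarrow> v \<in> carrier_vec (ds ! i) \<Longrightarrow> A i *\<^sub>v v = 0\<^sub>v n \<Longrightarrow> v = 0\<^sub>v (ds ! i)"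
    and nz: "\<Phi> A \<noteq> 0"
    and dense: "Abstract_Topology.closure_of (zariski ds n) Orb = (Gr_product ds n :: (nat \<Rightarrow> 'a vec set) set)"
  shows "\<exists>W\<in>Orb. \<exists>B. (\<forall>i<length ds. basis_matrix (ds ! i) n (W i) (B i)) \<and> \<Phi> B \<noteq> 0"
proof -
  obtain f where f: "multihomogeneous ds n (\<lambda>_. 1) f"
    "\<forall>A. (\<forall>i<length ds. A i \<in> carrier_mat n (ds ! i)) \<longrightarrow> \<Phi> A = eval_mpoly (\<lambda>(i, I). pluecker (A i) I) f"
    using form unfolding pluecker_form_def by (elim exE conjE) (rule that)
  define W where "W = (\<lambda>i\<in>{..<length ds}. vec_space.col_space n (A i))"
  have basis: "basis_matrix (ds ! i) n (W i) (A i)" if "i < length ds" for i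
    using col_space_in_Grassmannian[OF A[OF that] inj[OF that]] A[OF that] that
    unfolding basis_matrix_def W_def by simp
  then have Gr: "W \<in> Gr_product ds n" unfolding Gr_product_def W_def basis_matrix_def by auto
  have "eval_mpoly (\<lambda>(i, I). pluecker (A i) I) f \<noteq> 0" using f(2) A nz by simp
  then have W: "W \<in> principal_open ds n f" unfolding principal_open_def using Gr basis by blast
  have "openin (zariski ds n) (principal_open ds n f)"
    unfolding zariski_def by (rule topology_generated_by_Basis) (use f(1) in blast)
  then obtain V where V: "V \<in> Orb" "V \<in> principal_open ds n f"
    using dense W Gr unfolding closure_of_def by blast
  then obtain B where B: "\<forall>i<length ds. basis_matrix (ds ! i) n (V i) (B i)"
      "eval_mpoly (\<lambda>(i, I). pluecker (B i) I) f \<noteq> 0"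
    unfolding principal_open_def by blast
  have "\<Phi> B \<noteq> 0" using f(2) B unfolding basis_matrix_def by simp
  then show ?thesis using V(1) B(1) by blast
qed

lemma orbit_basis_matrices:
  fixes W0 :: "nat \<Rightarrow> 'a :: field vec set"
  assumes W0: "W0 \<in> Gr_product ds n"
    and W: "W \<in> Group_Action.orbit (PGL n) (diagonal_action ds) W0"
    and W': "W' \<in> Group_Action.orbit (PGL n) (diagonal_action ds) W0"
    and A: "\<forall>i<length ds. basis_matrix (ds ! i) n (W i) (A i)"
    and A': "\<forall>i<length ds. basis_matrix (ds ! i) n (W' i) (A' i)"
  obtains g h where "g \<in> carrier_mat n n"
    "\<forall>i<length ds. h i \<in> carrier_mat (ds ! i) (ds ! i) \<and> A' i = g * A i * h i"
proof -
  have translate: "\<exists>g. g \<in> carrier_mat n n \<and> det g \<noteq> 0 \<and>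
      (\<forall>i<length ds. V i = PGL_image (scalar_mats n #>\<^bsub>GL n\<^esub> g) (W0 i))"
    if V: "V \<in> Group_Action.orbit (PGL n) (diagonal_action ds) W0" for V
  proof -
    obtain C where C: "C \<in> carrier (PGL n)" "V = diagonal_action ds C W0"
      using V unfolding Group_Action.orbit_def by blast
    obtain g where "g \<in> carrier (GL n)" "C = scalar_mats n #>\<^bsub>GL n\<^esub> g"
      using C(1) unfolding carrier_PGL by blast
    then show ?thesis using C(2) carrier_GL unfolding diagonal_action_def by (intro exI[of _ g]) auto
  qed
  obtain g where g: "g \<in> carrier_mat n n" "det g \<noteq> 0"
    "\<forall>i<length ds. W i = PGL_image (scalar_mats n #>\<^bsub>GL n\<^esub> g) (W0 i)"
    using translate[OF W] by (elim exE conjE) (rule that)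
  obtain g' where g': "g' \<in> carrier_mat n n" "det g' \<noteq> 0"
    "\<forall>i<length ds. W' i = PGL_image (scalar_mats n #>\<^bsub>GL n\<^esub> g') (W0 i)"
    using translate[OF W'] by (elim exE conjE) (rule that)
  obtain gi where gi: "gi \<in> carrier_mat n n" "gi * g = 1\<^sub>m n" using det_nonzero_inverse[OF g(1,2)] by metis
  have "\<exists>h. h \<in> carrier_mat (ds ! i) (ds ! i) \<and> A' i = g' * gi * A i * h" if i: "i < length ds" for i
  proof -
    have "W0 i \<in> Grassmannian (ds ! i) n" using W0 i unfolding Gr_product_def by auto
    then obtain B where B: "B \<in> carrier_mat n (ds ! i)" "vec_space.col_space n B = W0 i"
      by (rule Grassmannian_col_space)
    have Ai: "A i \<in> carrier_mat n (ds ! i)" "vec_space.col_space n (A i) = W i"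
      and A'i: "A' i \<in> carrier_mat n (ds ! i)" "vec_space.col_space n (A' i) = W' i"
      using A A' i unfolding basis_matrix_def by auto
    have gB: "g * B \<in> carrier_mat n (ds ! i)" and g'B: "g' * B \<in> carrier_mat n (ds ! i)" using g g' B by auto
    have Wi: "W i = vec_space.col_space n (g * B)" "W' i = vec_space.col_space n (g' * B)"
      using g g' i B PGL_image_col_space[OF B(1) g(1)] PGL_image_col_space[OF B(1) g'(1)] by auto
    have "vec_space.col_space n (g * B) \<subseteq> vec_space.col_space n (A i)" using Ai(2) Wi(1) by simp
    then obtain h where h: "h \<in> carrier_mat (ds ! i) (ds ! i)" "g * B = A i * h"
      by (rule col_space_mono[OF gB Ai(1)])
    have "vec_space.col_space n (A' i) \<subseteq> vec_space.col_space n (g' * B)" using A'i(2) Wi(2) by simp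
    then obtain h' where h': "h' \<in> carrier_mat (ds ! i) (ds ! i)" "A' i = g' * B * h'"
      by (rule col_space_mono[OF A'i(1) g'B])
    have "B = gi * (g * B)" using assoc_mult_mat[OF gi(1) g(1) B(1)] gi(2) B(1) by simp
    then have "B = gi * (A i * h)" using h(2) by simp
    also have "\<dots> = gi * A i * h" by (rule assoc_mult_mat[OF gi(1) Ai(1) h(1), symmetric])
    finally have Beq: "B = gi * A i * h" .
    have giA: "gi * A i \<in> carrier_mat n (ds ! i)" using gi Ai by simp
    have "g' * B = g' * (gi * A i) * h" unfolding Beq by (rule assoc_mult_mat[OF g'(1) giA h(1), symmetric])
    also have "g' * (gi * A i) = g' * gi * A i" by (rule assoc_mult_mat[OF g'(1) gi(1) Ai(1), symmetric])
    finally have "A' i = g' * gi * A i * h * h'" using h'(2) by simp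
    also have "\<dots> = g' * gi * A i * (h * h')"
      by (rule assoc_mult_mat[OF _ h(1) h'(1)]) (use g' gi Ai in auto)
    finally show ?thesis using h(1) h'(1) by (intro exI[of _ "h * h'"]) auto
  qed
  then obtain h where h: "\<forall>i<length ds. h i \<in> carrier_mat (ds ! i) (ds ! i) \<and> A' i = g' * gi * A i * h i" by metis
  show ?thesis by (rule that[OF mult_carrier_mat[OF g'(1) gi(1)] h])
qed


lemma mult_mat_zero_vec: "A \<in> carrier_mat p q \<Longrightarrow> A *\<^sub>v 0\<^sub>v q = 0\<^sub>v p"
  for A :: "'a :: field mat"
  by (intro eq_vecI) auto

context column_blocks
begin

lemma hcat_mult_vec:
  assumes X: "\<And>i. i < k \<Longrightarrow> X i \<in> carrier_mat m (d i)" and w: "w \<in> carrier_vec N" and r: "r < m"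
  shows "(hcat m X *\<^sub>v w) $ r = (\<Sum>i<k. (X i *\<^sub>v vec (d i) (\<lambda>c. w $ idx i c)) $ r)"
proof -
  have "(hcat m X *\<^sub>v w) $ r = (\<Sum>j<N. X (bi j) $$ (r, po j) * w $ idx (bi j) (po j))"
    using r w by (simp add: scalar_prod_def hcat_def lessThan_atLeast0 idx_inverse)
  also have "\<dots> = (\<Sum>i<k. \<Sum>c<d i. X i $$ (r, c) * w $ idx i c)" by (rule sum_columns)
  also have "\<dots> = (\<Sum>i<k. (X i *\<^sub>v vec (d i) (\<lambda>c. w $ idx i c)) $ r)"
  proof (rule sum.cong[OF refl])
    fix i assume "i \<in> {..<k}"
    then have "X i \<in> carrier_mat m (d i)" using X by simp
    then show "(\<Sum>c<d i. X i $$ (r, c) * w $ idx i c) = (X i *\<^sub>v vec (d i) (\<lambda>c. w $ idx i c)) $ r"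
      using r by (simp add: scalar_prod_def lessThan_atLeast0)
  qed
  finally show ?thesis .
qed

lemma block_kernel_zero:
  fixes A S :: "nat \<Rightarrow> 'a :: field mat"
  assumes A: "\<And>i. i < k \<Longrightarrow> A i \<in> carrier_mat n (d i)" and S: "\<And>i. i < k \<Longrightarrow> S i \<in> carrier_mat N n"
    and det: "det (hcat N (\<lambda>i. S i * A i)) \<noteq> 0"
    and l: "l < k" and v: "v \<in> carrier_vec (d l)" "A l *\<^sub>v v = 0\<^sub>v n"
  shows "v = 0\<^sub>v (d l)"
proof -
  define w where "w = vec N (\<lambda>j. if bi j = l then v $ po j else 0)"
  have w: "w \<in> carrier_vec N" unfolding w_def by simp
  have X: "S i * A i \<in> carrier_mat N (d i)" if "i < k" for i using A[OF that] S[OF that] by simp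
  have block: "(S i * A i) *\<^sub>v vec (d i) (\<lambda>c. w $ idx i c) = 0\<^sub>v N" if i: "i < k" for i
  proof (cases "i = l")
    case True
    then have "vec (d i) (\<lambda>c. w $ idx i c) = v" using v(1) idx[OF l] unfolding w_def by (intro eq_vecI) auto
    then show ?thesis using True assoc_mult_mat_vec[OF S[OF l] A[OF l] v(1)] v(2) S[OF l] by auto
  next
    case False
    then have "vec (d i) (\<lambda>c. w $ idx i c) = 0\<^sub>v (d i)" using idx[OF i] unfolding w_def by (intro eq_vecI) auto
    then show ?thesis using mult_mat_zero_vec[OF X[OF i]] by metis
  qed
  have "hcat N (\<lambda>i. S i * A i) *\<^sub>v w = 0\<^sub>v N"
  proof (rule eq_vecI)
    fix r assume "r < dim_vec (0\<^sub>v N :: 'a vec)"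
    then have r: "r < N" by simp
    have "(hcat N (\<lambda>i. S i * A i) *\<^sub>v w) $ r = (\<Sum>i<k. ((S i * A i) *\<^sub>v vec (d i) (\<lambda>c. w $ idx i c)) $ r)"
      by (rule hcat_mult_vec) (use X w r in auto)
    also have "\<dots> = (\<Sum>i<k. 0\<^sub>v N $ r)" by (rule sum.cong) (simp_all only: block lessThan_iff)
    finally show "(hcat N (\<lambda>i. S i * A i) *\<^sub>v w) $ r = 0\<^sub>v N $ r" using r by simp
  qed simp
  then have w0: "w = 0\<^sub>v N" using det det_0_iff_vec_prod_zero_field[OF hcat_carrier] w by blast
  show ?thesis
  proof (rule eq_vecI)
    fix c assume "c < dim_vec (0\<^sub>v (d l) :: 'a vec)"
    then have c: "c < d l" by simp
    have "w $ idx l c = 0" unfolding w0 using idx(1)[OF l c] by simp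
    then show "v $ c = 0\<^sub>v (d l) $ c" using idx[OF l c] c unfolding w_def by simp
  qed (use v in simp)
qed

end

subsection \<open>The pencil of semi-invariants\<close>

text \<open>
The pairs \<open>(pcoef i, qcoef \<mu> i)\<close> for \<open>i < 4\<close> are \<open>(1, 0)\<close>, \<open>(0, 1)\<close>, \<open>(1, 1)\<close>, \<open>(1, \<mu>)\<close>: four points of
the projective line, distinct for \<open>\<mu>\<close> different from \<open>0\<close> and \<open>1\<close>, with cross-ratio determined by \<open>\<mu>\<close>.
\<close>

definition pcoef :: "nat \<Rightarrow> 'a :: field" where
  "pcoef i = (if i = 1 then 0 else 1)"

definition qcoef :: "'a :: field \<Rightarrow> nat \<Rightarrow> 'a" where
  "qcoef \<mu> i = (if i = 0 then 0 else if i = 3 then \<mu> else 1)"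

text \<open>
Multiplying a block by this matrix puts its multiples by \<open>pcoef i\<close> and \<open>qcoef \<mu> i\<close> on top of each
other, which gives one block column of the matrix behind \<open>pencil_det\<close>.
\<close>

definition pencil :: "nat \<Rightarrow> 'a :: field \<Rightarrow> nat \<Rightarrow> 'a mat" where
  "pencil n \<mu> i = mat (2 * n) n (\<lambda>(r, c). if r = c then pcoef i else if r = c + n then qcoef \<mu> i else 0)"

lemma pencil_carrier [simp]: "pencil n \<mu> i \<in> carrier_mat (2 * n) n"
  unfolding pencil_def by simp

lemma pencil_dim [simp]: "dim_row (pencil n \<mu> i) = 2 * n" "dim_col (pencil n \<mu> i) = n"
  unfolding pencil_def by simp_all

lemma row_pencil:
  assumes "r < n"
  shows "row (pencil n \<mu> i) r = pcoef i \<cdot>\<^sub>v unit_vec n r" "row (pencil n \<mu> i) (r + n) = qcoef \<mu> i \<cdot>\<^sub>v unit_vec n r"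
  using assms unfolding pencil_def by (auto intro!: eq_vecI)

lemma pencil_mult:
  assumes B: "B \<in> carrier_mat n m" and rc: "r < n" "c < m"
  shows "(pencil n \<mu> i * B) $$ (r, c) = pcoef i * B $$ (r, c)"
    and "(pencil n \<mu> i * B) $$ (r + n, c) = qcoef \<mu> i * B $$ (r, c)"
proof -
  have "(pencil n \<mu> i * B) $$ (r, c) = pcoef i * (unit_vec n r \<bullet> col B c)"
    "(pencil n \<mu> i * B) $$ (r + n, c) = qcoef \<mu> i * (unit_vec n r \<bullet> col B c)"
    using rc B by (simp_all add: row_pencil)
  moreover have "unit_vec n r \<bullet> col B c = B $$ (r, c)" using rc B by (subst scalar_prod_left_unit) auto
  ultimately show "(pencil n \<mu> i * B) $$ (r, c) = pcoef i * B $$ (r, c)"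
    and "(pencil n \<mu> i * B) $$ (r + n, c) = qcoef \<mu> i * B $$ (r, c)" by simp_all
qed

lemma pencil_mult_vec:
  assumes B: "B \<in> carrier_mat n m" and v: "v \<in> carrier_vec m" and r: "r < n"
  shows "(pencil n \<mu> i * B *\<^sub>v v) $ r = pcoef i * (B *\<^sub>v v) $ r"
    and "(pencil n \<mu> i * B *\<^sub>v v) $ (r + n) = qcoef \<mu> i * (B *\<^sub>v v) $ r"
proof -
  have Bv: "B *\<^sub>v v \<in> carrier_vec n" using B v by simp
  have "unit_vec n r \<bullet> (B *\<^sub>v v) = (B *\<^sub>v v) $ r" using r Bv by (subst scalar_prod_left_unit) auto
  then show "(pencil n \<mu> i * B *\<^sub>v v) $ r = pcoef i * (B *\<^sub>v v) $ r"
    and "(pencil n \<mu> i * B *\<^sub>v v) $ (r + n) = qcoef \<mu> i * (B *\<^sub>v v) $ r"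
    using r smult_scalar_prod_distrib[OF unit_vec_carrier Bv, of _ r]
    unfolding assoc_mult_mat_vec[OF pencil_carrier B v] by (simp_all add: row_pencil)
qed

definition double_mat :: "nat \<Rightarrow> 'a :: field mat \<Rightarrow> 'a mat" where
  "double_mat n g = four_block_mat g (0\<^sub>m n n) (0\<^sub>m n n) g"

text \<open>
Scalar matrices commute with \<open>g\<close>.
\<close>

lemma double_mat_pencil:
  assumes g: "g \<in> carrier_mat n n"
  shows "pencil n \<mu> i * g = double_mat n g * pencil n \<mu> i" (is "?L = ?R")
proof -
  have G: "double_mat n g \<in> carrier_mat (2 * n) (2 * n)"
    using g unfolding double_mat_def mult_2 by (intro four_block_carrier_mat) auto
  have split: "pencil n \<mu> i = four_block_mat (pcoef i \<cdot>\<^sub>m 1\<^sub>m n) (0\<^sub>m n 0) (qcoef \<mu> i \<cdot>\<^sub>m 1\<^sub>m n) (0\<^sub>m n 0)"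
    unfolding pencil_def by (rule eq_matI) auto
  have "?R = four_block_mat (g * (pcoef i \<cdot>\<^sub>m 1\<^sub>m n) + 0\<^sub>m n n * (qcoef \<mu> i \<cdot>\<^sub>m 1\<^sub>m n)) (g * 0\<^sub>m n 0 + 0\<^sub>m n n * 0\<^sub>m n 0)
      (0\<^sub>m n n * (pcoef i \<cdot>\<^sub>m 1\<^sub>m n) + g * (qcoef \<mu> i \<cdot>\<^sub>m 1\<^sub>m n)) (0\<^sub>m n n * 0\<^sub>m n 0 + g * 0\<^sub>m n 0)"
    unfolding split double_mat_def by (rule mult_four_block_mat) (use g in auto)
  also have "g * (pcoef i \<cdot>\<^sub>m 1\<^sub>m n) + 0\<^sub>m n n * (qcoef \<mu> i \<cdot>\<^sub>m 1\<^sub>m n) = pcoef i \<cdot>\<^sub>m g"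
    using g mult_smult_distrib[OF g one_carrier_mat, of "pcoef i"] by auto
  also have "0\<^sub>m n n * (pcoef i \<cdot>\<^sub>m 1\<^sub>m n) + g * (qcoef \<mu> i \<cdot>\<^sub>m 1\<^sub>m n) = qcoef \<mu> i \<cdot>\<^sub>m g"
    using g mult_smult_distrib[OF g one_carrier_mat, of "qcoef \<mu> i"] by auto
  finally have R: "?R = four_block_mat (pcoef i \<cdot>\<^sub>m g) (g * 0\<^sub>m n 0 + 0\<^sub>m n n * 0\<^sub>m n 0)
      (qcoef \<mu> i \<cdot>\<^sub>m g) (0\<^sub>m n n * 0\<^sub>m n 0 + g * 0\<^sub>m n 0)" .
  show ?thesis
  proof (rule eq_matI)
    fix r c assume "r < dim_row ?R" "c < dim_col ?R"
    then have rc: "r < 2 * n" "c < n" using G by auto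
    show "?L $$ (r, c) = ?R $$ (r, c)"
    proof (cases "r < n")
      case True
      then show ?thesis using pencil_mult(1)[OF g True rc(2)] rc g unfolding R by auto
    next
      case False
      then obtain r' where r': "r = r' + n" "r' < n" using rc(1) by (metis add.commute le_add_diff_inverse mult_2 nat_add_left_cancel_less not_less)
      then show ?thesis using pencil_mult(2)[OF g r'(2) rc(2)] rc g unfolding R by auto
    qed
  qed (use g G in auto)
qed

locale four_blocks = column_blocks 4 d "2 * n" bi po
  for d :: "nat \<Rightarrow> nat" and n :: nat and bi po :: "nat \<Rightarrow> nat"
begin

text \<open>
The determinant of the block matrix with rows \<open>[A\<^sub>0, 0, A\<^sub>2, A\<^sub>3]\<close> and \<open>[0, A\<^sub>1, A\<^sub>2, \<mu> A\<^sub>3]\<close>. It vanishes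
iff there are vectors \<open>w\<^sub>i\<close>, not all zero, with \<open>\<Sum> pcoef i A\<^sub>i w\<^sub>i = 0 = \<Sum> qcoef \<mu> i A\<^sub>i w\<^sub>i\<close>.
\<close>

definition pencil_det :: "'a :: field \<Rightarrow> (nat \<Rightarrow> 'a mat) \<Rightarrow> 'a" where
  "pencil_det \<mu> A = det (hcat (2 * n) (\<lambda>i. pencil n \<mu> i * A i))"

text \<open>
The factor does not depend on \<open>\<mu>\<close>: all these determinants are semi-invariants of the same weight.
\<close>

lemma pencil_det_equivariant:
  fixes A A' :: "nat \<Rightarrow> 'a :: field mat"
  assumes A: "\<And>i. i < 4 \<Longrightarrow> A i \<in> carrier_mat n (d i)" and g: "g \<in> carrier_mat n n"
    and h: "\<And>i. i < 4 \<Longrightarrow> h i \<in> carrier_mat (d i) (d i)" and A': "\<And>i. i < 4 \<Longrightarrow> A' i = g * A i * h i"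
  shows "pencil_det \<mu> A' = det (double_mat n g) * det (bdiag h) * pencil_det \<mu> A"
proof -
  define G where "G = double_mat n g"
  have G: "G \<in> carrier_mat (2 * n) (2 * n)"
    using g unfolding G_def double_mat_def mult_2 by (intro four_block_carrier_mat) auto
  define X where "X i = pencil n \<mu> i * A i" for i
  have X: "X i \<in> carrier_mat (2 * n) (d i)" if "i < 4" for i 
    unfolding X_def by (rule mult_carrier_mat[OF pencil_carrier A[OF that]])
  have "hcat (2 * n) (\<lambda>i. pencil n \<mu> i * A' i) = hcat (2 * n) (\<lambda>i. G * X i * h i)"
  proof (rule hcat_cong)
    fix i :: nat assume i: "i < 4"
    note Ai = A[OF i] and hi = h[OF i]
    have gA: "g * A i \<in> carrier_mat n (d i)" using g Ai by simp
    have "pencil n \<mu> i * A' i = pencil n \<mu> i * (g * A i) * h i"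
      unfolding A'[OF i] by (rule assoc_mult_mat[OF pencil_carrier gA hi, symmetric])
    also have "pencil n \<mu> i * (g * A i) = pencil n \<mu> i * g * A i"
      by (rule assoc_mult_mat[OF pencil_carrier g Ai, symmetric])
    also have "\<dots> = G * X i"
      unfolding double_mat_pencil[OF g] G_def[symmetric] X_def by (rule assoc_mult_mat[OF G pencil_carrier Ai])
    finally show "pencil n \<mu> i * A' i = G * X i * h i" .
  qed
  also have "\<dots> = hcat (2 * n) (\<lambda>i. G * X i) * bdiag h"
    by (rule hcat_right[of "\<lambda>i. G * X i"]) (use G X h in auto)
  also have "hcat (2 * n) (\<lambda>i. G * X i) = G * hcat (2 * n) X"
    by (rule hcat_left[OF G]) (use X in auto)
  finally have "pencil_det \<mu> A' = det (G * hcat (2 * n) X * bdiag h)" unfolding pencil_det_def by simp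
  also have "\<dots> = det G * det (hcat (2 * n) X) * det (bdiag h)"
    using det_mult[of "G * hcat (2 * n) X" "2 * n" "bdiag h"] det_mult[OF G hcat_carrier[of "2 * n" X]] G by simp
  finally show ?thesis unfolding G_def pencil_det_def X_def by (simp add: mult_ac)
qed

lemma pencil_det_zero_iff:
  fixes A :: "nat \<Rightarrow> 'a :: field mat"
  assumes A: "\<And>i. i < 4 \<Longrightarrow> A i \<in> carrier_mat n (d i)"
  shows "pencil_det \<mu> A = 0 \<longleftrightarrow> (\<exists>w. w \<in> carrier_vec (2 * n) \<and> w \<noteq> 0\<^sub>v (2 * n) \<and>
    (\<forall>r<n. (\<Sum>i<4. pcoef i * (A i *\<^sub>v vec (d i) (\<lambda>c. w $ idx i c)) $ r) = 0 \<and>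
      (\<Sum>i<4. qcoef \<mu> i * (A i *\<^sub>v vec (d i) (\<lambda>c. w $ idx i c)) $ r) = 0))"
proof -
  define M where "M = hcat (2 * n) (\<lambda>i. pencil n \<mu> i * A i)"
  have M: "M \<in> carrier_mat (2 * n) (2 * n)" unfolding M_def by simp
  have X: "pencil n \<mu> i * A i \<in> carrier_mat (2 * n) (d i)" if "i < 4" for i
    by (rule mult_carrier_mat[OF pencil_carrier A[OF that]])
  have top: "(M *\<^sub>v w) $ r = (\<Sum>i<4. pcoef i * (A i *\<^sub>v vec (d i) (\<lambda>c. w $ idx i c)) $ r)"
    and bot: "(M *\<^sub>v w) $ (r + n) = (\<Sum>i<4. qcoef \<mu> i * (A i *\<^sub>v vec (d i) (\<lambda>c. w $ idx i c)) $ r)"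
    if w: "w \<in> carrier_vec (2 * n)" and r: "r < n" for w r
  proof -
    have r2: "r < 2 * n" "r + n < 2 * n" using r by auto
    show "(M *\<^sub>v w) $ r = (\<Sum>i<4. pcoef i * (A i *\<^sub>v vec (d i) (\<lambda>c. w $ idx i c)) $ r)"
    proof -
      have "(M *\<^sub>v w) $ r = (\<Sum>i<4. (pencil n \<mu> i * A i *\<^sub>v vec (d i) (\<lambda>c. w $ idx i c)) $ r)"
        unfolding M_def by (rule hcat_mult_vec[OF X w r2(1)])
      also have "\<dots> = (\<Sum>i<4. pcoef i * (A i *\<^sub>v vec (d i) (\<lambda>c. w $ idx i c)) $ r)"
        by (rule sum.cong[OF refl], rule pencil_mult_vec(1)[OF A]) (use r in auto)
      finally show ?thesis .
    qed
    show "(M *\<^sub>v w) $ (r + n) = (\<Sum>i<4. qcoef \<mu> i * (A i *\<^sub>v vec (d i) (\<lambda>c. w $ idx i c)) $ r)"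
    proof -
      have "(M *\<^sub>v w) $ (r + n) = (\<Sum>i<4. (pencil n \<mu> i * A i *\<^sub>v vec (d i) (\<lambda>c. w $ idx i c)) $ (r + n))"
        unfolding M_def by (rule hcat_mult_vec[OF X w r2(2)])
      also have "\<dots> = (\<Sum>i<4. qcoef \<mu> i * (A i *\<^sub>v vec (d i) (\<lambda>c. w $ idx i c)) $ r)"
        by (rule sum.cong[OF refl], rule pencil_mult_vec(2)[OF A]) (use r in auto)
      finally show ?thesis .
    qed
  qed
  have zero: "M *\<^sub>v w = 0\<^sub>v (2 * n) \<longleftrightarrow> (\<forall>r<n. (M *\<^sub>v w) $ r = 0 \<and> (M *\<^sub>v w) $ (r + n) = 0)" for w
  proof
    assume "\<forall>r<n. (M *\<^sub>v w) $ r = 0 \<and> (M *\<^sub>v w) $ (r + n) = 0"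
    then have all: "(M *\<^sub>v w) $ r = 0" if "r < 2 * n" for r
      using that by (cases "r < n") (auto dest: spec[of _ "r - n"])
    show "M *\<^sub>v w = 0\<^sub>v (2 * n)" by (rule eq_vecI) (use M all in auto)
  qed auto
  have key: "M *\<^sub>v w = 0\<^sub>v (2 * n) \<longleftrightarrow>
      (\<forall>r<n. (\<Sum>i<4. pcoef i * (A i *\<^sub>v vec (d i) (\<lambda>c. w $ idx i c)) $ r) = 0 \<and>
      (\<Sum>i<4. qcoef \<mu> i * (A i *\<^sub>v vec (d i) (\<lambda>c. w $ idx i c)) $ r) = 0)"
    if "w \<in> carrier_vec (2 * n)" for w
    unfolding zero using top[OF that] bot[OF that] by (simp cong: imp_cong)
  show ?thesis
    unfolding pencil_det_def M_def[symmetric] det_0_iff_vec_prod_zero_field[OF M]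
    by (intro ex_cong1 conj_cong refl key)
qed

end


context four_blocks
begin

definition offset :: "nat \<Rightarrow> nat" where
  "offset i = (\<Sum>i'<i. d i' - 1)"

text \<open>
The first columns are the four lines spanned by \<open>(1, 0)\<close>, \<open>(0, 1)\<close>, \<open>(1, 1)\<close>, \<open>(1, \<nu>)\<close> in the plane of the
first two coordinates. The remaining \<open>d i - 1\<close> columns of each block are coordinate vectors of the other
\<open>n - 2\<close> coordinates, dealt out cyclically, where block \<open>i\<close> starts at position \<open>offset i\<close>. Since there are
\<open>2 (n - 2)\<close> of them, each coordinate is used twice, and by different blocks because no block is longer
than \<open>n - 2\<close>.
\<close>

definition test_tuple :: "'a :: field \<Rightarrow> nat \<Rightarrow> 'a mat" where
  "test_tuple \<nu> i = mat n (d i) (\<lambda>(r, c).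
     if c = 0 then if r = 0 then pcoef i else if r = 1 then qcoef \<nu> i else 0
     else if r = 2 + (offset i + (c - 1)) mod (n - 2) then 1 else 0)"

lemma test_tuple_carrier [simp]: "test_tuple \<nu> i \<in> carrier_mat n (d i)"
  unfolding test_tuple_def by simp

lemma test_tuple_mult_vec:
  assumes "r < n" "v \<in> carrier_vec (d i)"
  shows "(test_tuple \<nu> i *\<^sub>v v) $ r = (\<Sum>c<d i. test_tuple \<nu> i $$ (r, c) * v $ c)"
  using assms unfolding test_tuple_def by (simp add: scalar_prod_def lessThan_atLeast0)

lemma test_tuple_low:
  assumes "n \<ge> 2" "d i \<ge> 1" "v \<in> carrier_vec (d i)"
  shows "(test_tuple \<nu> i *\<^sub>v v) $ 0 = pcoef i * v $ 0" "(test_tuple \<nu> i *\<^sub>v v) $ 1 = qcoef \<nu> i * v $ 0"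
proof -
  have "(test_tuple \<nu> i *\<^sub>v v) $ 0 = (\<Sum>c<d i. test_tuple \<nu> i $$ (0, c) * v $ c)"
    using assms by (intro test_tuple_mult_vec) auto
  also have "\<dots> = (\<Sum>c<d i. if c = 0 then pcoef i * v $ 0 else 0)"
    by (rule sum.cong[OF refl]) (use assms(1) in \<open>auto simp: test_tuple_def\<close>)
  finally have "(test_tuple \<nu> i *\<^sub>v v) $ 0 = (\<Sum>c<d i. if c = 0 then pcoef i * v $ 0 else 0)" .
  then show "(test_tuple \<nu> i *\<^sub>v v) $ 0 = pcoef i * v $ 0" using assms(2) by (simp add: sum.delta)
  have "(test_tuple \<nu> i *\<^sub>v v) $ 1 = (\<Sum>c<d i. test_tuple \<nu> i $$ (1, c) * v $ c)"
    using assms by (intro test_tuple_mult_vec) auto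
  also have "\<dots> = (\<Sum>c<d i. if c = 0 then qcoef \<nu> i * v $ 0 else 0)"
    by (rule sum.cong[OF refl]) (use assms(1) in \<open>auto simp: test_tuple_def\<close>)
  finally have "(test_tuple \<nu> i *\<^sub>v v) $ 1 = (\<Sum>c<d i. if c = 0 then qcoef \<nu> i * v $ 0 else 0)" .
  then show "(test_tuple \<nu> i *\<^sub>v v) $ 1 = qcoef \<nu> i * v $ 0" using assms(2) by (simp add: sum.delta)
qed

lemma test_tuple_high_miss:
  assumes "2 \<le> r" "r < n" "v \<in> carrier_vec (d i)"
    and "\<And>c. 0 < c \<Longrightarrow> c < d i \<Longrightarrow> r = 2 + (offset i + (c - 1)) mod (n - 2) \<Longrightarrow> v $ c = 0"
  shows "(test_tuple \<nu> i *\<^sub>v v) $ r = 0"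
  unfolding test_tuple_mult_vec[OF assms(2,3)]
proof (rule sum.neutral, rule ballI)
  fix c assume "c \<in> {..<d i}"
  then show "test_tuple \<nu> i $$ (r, c) * v $ c = 0"
    using assms(1,2) assms(4)[of c] unfolding test_tuple_def by (cases "c = 0") auto
qed

lemma offset_Suc: "offset (Suc i) = offset i + (d i - 1)"
  unfolding offset_def by simp

lemma offset_mono: "i \<le> j \<Longrightarrow> offset i \<le> offset j"
  unfolding offset_def by (intro sum_mono2) auto

lemma offset_total:
  assumes "\<And>i. i < 4 \<Longrightarrow> 1 \<le> d i"
  shows "offset 4 = 2 * (n - 2)"
proof -
  have "(\<Sum>i<4. d i - 1) + 4 = (\<Sum>i<4. (d i - 1) + 1)" by (simp only: sum.distrib) simp
  also have "\<dots> = (\<Sum>i<4. d i)"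
    by (rule sum.cong[OF refl]) (metis assms le_add_diff_inverse2 lessThan_iff)
  finally show ?thesis using N_eq unfolding offset_def by simp
qed

lemma position_cases:
  assumes d: "\<And>i. i < 4 \<Longrightarrow> 1 \<le> d i" and ic: "i < 4" "c < d i - 1" and \<rho>: "(offset i + c) mod (n - 2) = \<rho>"
  shows "offset i + c = \<rho> \<or> offset i + c = \<rho> + (n - 2)" "offset i + c < offset (Suc i)"
proof -
  show less: "offset i + c < offset (Suc i)" using ic(2) unfolding offset_Suc by simp
  have "offset (Suc i) \<le> offset 4" using ic(1) by (intro offset_mono) simp
  then have p: "offset i + c < 2 * (n - 2)" using less offset_total[OF d] by simp
  then have "(offset i + c) div (n - 2) < 2" by (simp add: less_mult_imp_div_less)
  then consider "(offset i + c) div (n - 2) = 0" | "(offset i + c) div (n - 2) = 1" by linarith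
  then show "offset i + c = \<rho> \<or> offset i + c = \<rho> + (n - 2)"
    using div_mult_mod_eq[of "offset i + c" "n - 2"] \<rho> by cases auto
qed

text \<open>
Block \<open>i\<close> contains the coordinate vector with index \<open>2 + \<rho>\<close>.
\<close>

definition hits :: "nat \<Rightarrow> nat \<Rightarrow> bool" where
  "hits i \<rho> \<longleftrightarrow> (\<exists>c<d i - 1. (offset i + c) mod (n - 2) = \<rho>)"

lemma at_most_two_hits:
  assumes d: "\<And>i. i < 4 \<Longrightarrow> 1 \<le> d i" and "a < b" "b < c" "c < 4"
  shows "\<not> (hits a \<rho> \<and> hits b \<rho> \<and> hits c \<rho>)"
proof
  assume "hits a \<rho> \<and> hits b \<rho> \<and> hits c \<rho>"
  then obtain x y z where x: "x < d a - 1" "(offset a + x) mod (n - 2) = \<rho>"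
    and y: "y < d b - 1" "(offset b + y) mod (n - 2) = \<rho>" and z: "z < d c - 1" "(offset c + z) mod (n - 2) = \<rho>"
    unfolding hits_def by blast
  have "a < 4" "b < 4" using assms by auto
  note X = position_cases[OF d \<open>a < 4\<close> x] and Y = position_cases[OF d \<open>b < 4\<close> y] and Z = position_cases[OF d \<open>c < 4\<close> z]
  have "offset (Suc a) \<le> offset b" "offset (Suc b) \<le> offset c" using assms by (auto intro: offset_mono)
  then have "offset a + x < offset b + y" "offset b + y < offset c + z" using X Y by auto
  then show False using X(1) Y(1) Z(1) by auto
qed

lemma sum_four: "(\<Sum>i<4. f i) = f 0 + f 1 + f 2 + f (3 :: nat)" for f :: "nat \<Rightarrow> 'a :: comm_monoid_add"
  by (simp add: eval_nat_numeral lessThan_Suc add_ac)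

lemma pencil_sums:
  fixes T :: "nat \<Rightarrow> 'a :: field"
  shows "(\<Sum>i<4. pcoef i * T i) = T 0 + T 2 + T 3" "(\<Sum>i<4. qcoef \<mu> i * T i) = T 1 + T 2 + \<mu> * T 3"
  unfolding sum_four pcoef_def qcoef_def by simp_all

text \<open>
Let \<open>w\<close> be in the kernel. On each coordinate from \<open>2\<close> on, at most two blocks contribute, and the two
equations have an invertible coefficient matrix because the points \<open>(pcoef i, qcoef \<mu> i)\<close> are distinct.
On the first two coordinates, the four equations for the multiples of the four lines combine to
\<open>(\<mu> - \<nu>) t\<^sub>3 = 0\<close>.
\<close>

lemma pencil_det_test_nonzero:
  fixes \<mu> \<nu> :: "'a :: field"
  assumes d: "\<And>i. i < 4 \<Longrightarrow> 1 \<le> d i \<and> d i \<le> n - 1" and ne: "\<mu> \<noteq> 0" "\<mu> \<noteq> 1" "\<mu> \<noteq> \<nu>"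
  shows "pencil_det \<mu> (test_tuple \<nu>) \<noteq> 0"
proof
  assume "pencil_det \<mu> (test_tuple \<nu>) = 0"
  then obtain w where w: "w \<in> carrier_vec (2 * n)" "w \<noteq> 0\<^sub>v (2 * n)"
    and eqs: "\<And>r. r < n \<Longrightarrow> (\<Sum>i<4. pcoef i * (test_tuple \<nu> i *\<^sub>v vec (d i) (\<lambda>c. w $ idx i c)) $ r) = 0"
      "\<And>r. r < n \<Longrightarrow> (\<Sum>i<4. qcoef \<mu> i * (test_tuple \<nu> i *\<^sub>v vec (d i) (\<lambda>c. w $ idx i c)) $ r) = 0"
    unfolding pencil_det_zero_iff[of "test_tuple \<nu>" \<mu>, OF test_tuple_carrier] by auto
  define u where "u i = vec (d i) (\<lambda>c. w $ idx i c)" for i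
  have u: "u i \<in> carrier_vec (d i)" for i unfolding u_def by simp
  define T where "T r i = (test_tuple \<nu> i *\<^sub>v u i) $ r" for r i
  have E: "T r 0 + T r 2 + T r 3 = 0" "T r 1 + T r 2 + \<mu> * T r 3 = 0" if "r < n" for r
    using eqs[OF that] unfolding u_def[symmetric] T_def[symmetric] pencil_sums by auto
  have n2: "n \<ge> 2" using d[of 0] by linarith
  have d1: "\<And>i. i < 4 \<Longrightarrow> 1 \<le> d i" using d by blast
  have first: "u i $ 0 = 0" if "i < 4" for i
  proof -
    have low: "T 0 i = pcoef i * u i $ 0" "T 1 i = qcoef \<nu> i * u i $ 0" if "i < 4" for i
      using test_tuple_low[OF n2 d1[OF that] u] unfolding T_def by auto
    have e: "u 0 $ 0 + u 2 $ 0 + u 3 $ 0 = 0" "u 2 $ 0 + \<mu> * u 3 $ 0 = 0"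
      "u 2 $ 0 + \<nu> * u 3 $ 0 = 0" "u 1 $ 0 + u 2 $ 0 + \<mu> * (\<nu> * u 3 $ 0) = 0"
      using E[of 0] E[of 1] n2 by (simp_all add: low low[unfolded One_nat_def] pcoef_def qcoef_def)
    have "(\<mu> - \<nu>) * u 3 $ 0 = 0" using e(2,3) by (simp add: algebra_simps add_eq_0_iff)
    then have "u 3 $ 0 = 0" using ne by simp
    moreover have "i = 0 \<or> i = 1 \<or> i = 2 \<or> i = 3" using that by auto
    ultimately show ?thesis using e by auto
  qed
  have later: "u i $ Suc c = 0" if ic: "i < 4" "Suc c < d i" for i c
  proof -
    define \<rho> where "\<rho> = (offset i + c) mod (n - 2)"
    define r where "r = 2 + \<rho>"
    have "n - 2 > 0" using ic d[OF ic(1)] by auto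
    then have "\<rho> < n - 2" unfolding \<rho>_def by (rule mod_less_divisor)
    then have r: "2 \<le> r" "r < n" unfolding r_def by auto
    have miss: "T r j = 0" if "\<not> hits j \<rho>" for j
      unfolding T_def
    proof (rule test_tuple_high_miss[OF r u])
      fix c assume "0 < c" "c < d j" "r = 2 + (offset j + (c - 1)) mod (n - 2)"
      then have "hits j \<rho>" unfolding hits_def r_def by (intro exI[of _ "c - 1"]) auto
      then show "u j $ c = 0" using that by blast
    qed
    have "T r i = 0"
    proof -
      have three: "\<not> (hits 0 \<rho> \<and> hits 1 \<rho> \<and> hits 2 \<rho>)" "\<not> (hits 0 \<rho> \<and> hits 1 \<rho> \<and> hits 3 \<rho>)"
        "\<not> (hits 0 \<rho> \<and> hits 2 \<rho> \<and> hits 3 \<rho>)" "\<not> (hits 1 \<rho> \<and> hits 2 \<rho> \<and> hits 3 \<rho>)"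
        by (rule at_most_two_hits[OF d1]; simp)+
      have e: "T r 0 + T r 2 + T r 3 = 0" "T r 1 + T r 2 + \<mu> * T r 3 = 0" using E r by auto
      have mul: "x + \<mu> * y = 0 \<Longrightarrow> x + y = 0 \<Longrightarrow> x = 0 \<and> y = 0" for x y :: 'a
      proof -
        assume "x + \<mu> * y = 0" "x + y = 0"
        then have "(\<mu> - 1) * y = 0" by (simp add: algebra_simps add_eq_0_iff)
        then show "x = 0 \<and> y = 0" using ne(2) \<open>x + y = 0\<close> by simp
      qed
      have "T r 0 = 0 \<and> T r 1 = 0 \<or> T r 0 = 0 \<and> T r 2 = 0 \<or> T r 0 = 0 \<and> T r 3 = 0 \<or>
          T r 1 = 0 \<and> T r 2 = 0 \<or> T r 1 = 0 \<and> T r 3 = 0 \<or> T r 2 = 0 \<and> T r 3 = 0"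
        using three miss by blast
      then have "T r 0 = 0 \<and> T r 1 = 0 \<and> T r 2 = 0 \<and> T r 3 = 0"
        using e mul[of "T r 2" "T r 3"] ne(1) by auto
      moreover have "i = 0 \<or> i = 1 \<or> i = 2 \<or> i = 3" using ic by auto
      ultimately show ?thesis by auto
    qed
    moreover have "T r i = u i $ Suc c"
    proof -
      have "T r i = (\<Sum>c'<d i. if c' = Suc c then u i $ Suc c else 0)"
        unfolding T_def test_tuple_mult_vec[OF r(2) u]
      proof (rule sum.cong[OF refl])
        fix c' assume c': "c' \<in> {..<d i}"
        have hit: "c' = Suc c" if "0 < c'" "r = 2 + (offset i + (c' - 1)) mod (n - 2)"
        proof -
          have "(offset i + (c' - 1)) mod (n - 2) = \<rho>" "c' - 1 < d i - 1" using that c' unfolding r_def by auto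
          then have "offset i + (c' - 1) = \<rho> \<or> offset i + (c' - 1) = \<rho> + (n - 2)"
            using position_cases(1)[OF d1 ic(1)] by blast
          moreover have "offset i + c = \<rho> \<or> offset i + c = \<rho> + (n - 2)"
            using position_cases(1)[OF d1 ic(1), of c \<rho>] ic(2) unfolding \<rho>_def by auto
          ultimately show ?thesis using that c' ic d[OF ic(1)] by auto
        qed
        have entry: "test_tuple \<nu> i $$ (r, c') = (if 0 < c' \<and> r = 2 + (offset i + (c' - 1)) mod (n - 2) then 1 else 0)"
          using r c' unfolding test_tuple_def by simp
        have "r = 2 + (offset i + (Suc c - 1)) mod (n - 2)" unfolding r_def \<rho>_def by simp
        then have iff: "(0 < c' \<and> r = 2 + (offset i + (c' - 1)) mod (n - 2)) \<longleftrightarrow> c' = Suc c"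
          using hit by blast
        show "test_tuple \<nu> i $$ (r, c') * u i $ c' = (if c' = Suc c then u i $ Suc c else 0)"
          unfolding entry iff by simp
      qed
      then show ?thesis using ic(2) by (simp add: sum.delta)
    qed
    ultimately show ?thesis by simp
  qed
  have "w = 0\<^sub>v (2 * n)"
  proof (rule eq_vecI)
    fix j assume "j < dim_vec (0\<^sub>v (2 * n) :: 'a vec)"
    then have j: "j < 2 * n" by simp
    have "u (bi j) $ po j = w $ j" unfolding u_def using po_less[OF j] idx_inverse[OF j] by simp
    moreover have "u (bi j) $ po j = 0"
      using first[OF bi_less[OF j]] later[OF bi_less[OF j], of "po j - 1"] po_less[OF j] by (cases "po j") auto
    ultimately show "w $ j = 0\<^sub>v (2 * n) $ j" using j by simp
  qed (use w in simp)
  then show False using w(2) by blast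
qed

text \<open>
For equal parameters the four equations on the first two coordinates have a nontrivial solution.
\<close>

lemma pencil_det_test_zero:
  fixes \<nu> :: "'a :: field"
  assumes d: "\<And>i. i < 4 \<Longrightarrow> 1 \<le> d i" and n2: "n \<ge> 2"
  shows "pencil_det \<nu> (test_tuple \<nu>) = 0"
proof -
  \<comment> \<open>the solution is determined up to scale by choosing \<open>1\<close> for the last line\<close>
  define t where "t i = (if i = 0 then \<nu> - 1 else if i = 1 then \<nu> - \<nu> * \<nu> else if i = 2 then - \<nu> else 1)" for i :: nat
  define w where "w = vec (2 * n) (\<lambda>j. if po j = 0 then t (bi j) else 0)"
  have w: "w \<in> carrier_vec (2 * n)" unfolding w_def by simp
  define u where "u i = vec (d i) (\<lambda>c. w $ idx i c)" for i
  have u: "u i \<in> carrier_vec (d i)" for i unfolding u_def by simp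
  have ui: "u i $ c = (if c = 0 then t i else 0)" if "i < 4" "c < d i" for i c
    unfolding u_def w_def using that(2) idx[OF that] by (cases "c = 0") auto
  have "w $ idx 3 0 = 1" using idx[of 3 0] d[of 3] unfolding w_def t_def by simp
  moreover have "idx 3 0 < 2 * n" using idx(1)[of 3 0] d[of 3] by simp
  ultimately have "w \<noteq> 0\<^sub>v (2 * n)" by auto
  moreover have "(\<Sum>i<4. pcoef i * (test_tuple \<nu> i *\<^sub>v u i) $ r) = 0 \<and>
      (\<Sum>i<4. qcoef \<nu> i * (test_tuple \<nu> i *\<^sub>v u i) $ r) = 0" if r: "r < n" for r
  proof -
    consider "r = 0" | "r = 1" | "2 \<le> r" by linarith
    then show ?thesis
    proof cases
      case 3
      have "(test_tuple \<nu> i *\<^sub>v u i) $ r = 0" if "i < 4" for i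
        by (rule test_tuple_high_miss[OF 3 r u]) (simp add: ui that)
      then show ?thesis by simp
    next
      case 1
      have "(test_tuple \<nu> i *\<^sub>v u i) $ r = pcoef i * t i" if "i < 4" for i
        unfolding 1 test_tuple_low(1)[OF n2 d[OF that] u] using ui[OF that, of 0] d[OF that] by simp
      then show ?thesis unfolding pencil_sums by (simp add: pcoef_def t_def)
    next
      case 2
      have "(test_tuple \<nu> i *\<^sub>v u i) $ r = qcoef \<nu> i * t i" if "i < 4" for i
        unfolding 2 test_tuple_low(2)[OF n2 d[OF that] u] using ui[OF that, of 0] d[OF that] by simp
      then show ?thesis unfolding pencil_sums by (simp add: qcoef_def t_def algebra_simps)
    qed
  qed
  ultimately show ?thesis
    unfolding pencil_det_zero_iff[of "test_tuple \<nu>" \<nu>, OF test_tuple_carrier] using w unfolding u_def by blast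
qed

end

text \<open>
If an orbit were dense, it would contain a point with a basis \<open>A\<close> at which the determinant with parameter
\<open>\<mu>\<close> does not vanish. The combination \<open>\<Theta>\<close> of the determinants with parameters \<open>\<mu>\<close> and \<open>\<nu>\<close> that
vanishes at \<open>A\<close> vanishes on the whole orbit by equivariance, but not at the tuple with parameter \<open>\<mu>\<close>.
\<close>

theorem sparse_if_defect_zero:
  assumes dv: "dimension_vector ds n" and len: "length ds = 4" and sum: "sum_list ds = 2 * n"
  shows "\<not> dense_dimension_vector TYPE('a :: alg_closed_field) ds n"
proof
  assume "dense_dimension_vector TYPE('a) ds n"
  then obtain W0 :: "nat \<Rightarrow> 'a vec set" where W0: "W0 \<in> Gr_product ds n"
    and dense: "Abstract_Topology.closure_of (zariski ds n) (Group_Action.orbit (PGL n) (diagonal_action ds) W0) = Gr_product ds n"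
    unfolding dense_dimension_vector_def by blast
  have sum4: "(\<Sum>i<4. ds ! i) = 2 * n" using sum len by (simp add: sum_list_sum_nth lessThan_atLeast0)
  obtain bi po where cb: "column_blocks 4 ((!) ds) (2 * n) bi po"
    using column_blocks_exist[of 4 "(!) ds"] unfolding sum4 by blast
  interpret four_blocks "(!) ds" n bi po using cb by (simp add: four_blocks_def)
  have d: "1 \<le> ds ! i \<and> ds ! i \<le> n - 1" if "i < 4" for i
    using dv that len unfolding dimension_vector_def by simp
  have n2: "n \<ge> 2" using d[of 0] by linarith
  obtain \<mu> :: 'a where \<mu>: "\<mu> \<notin> {0, 1}" using ex_new_if_finite[OF alg_closed_infinite, of "{0, 1}"] by auto
  obtain \<nu> :: 'a where \<nu>: "\<nu> \<notin> {0, 1, \<mu>}" using ex_new_if_finite[OF alg_closed_infinite, of "{0, 1, \<mu>}"] by auto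
  have form: "pluecker_form ds n (pencil_det \<kappa>)" for \<kappa> :: 'a
    unfolding pencil_det_def using pluecker_form_det[of ds "2 * n" bi po "pencil n \<kappa>" n] cb len by simp
  have nz: "pencil_det \<mu> (test_tuple \<nu>) \<noteq> 0" "pencil_det \<nu> (test_tuple \<mu>) \<noteq> 0"
    by (rule pencil_det_test_nonzero[OF d]; use \<mu> \<nu> in auto)+
  have z: "pencil_det \<mu> (test_tuple \<mu>) = 0" using d n2 by (intro pencil_det_test_zero) auto
  have inj: "v = 0\<^sub>v (ds ! i)" if "i < length ds" "v \<in> carrier_vec (ds ! i)" "test_tuple \<kappa> i *\<^sub>v v = 0\<^sub>v n"
    "pencil_det \<kappa>' (test_tuple \<kappa>) \<noteq> 0" for i v and \<kappa> \<kappa>' :: 'a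
    by (rule block_kernel_zero[OF test_tuple_carrier pencil_carrier _ _ that(2,3)])
      (use that len in \<open>auto simp: pencil_det_def\<close>)
  have "\<exists>W\<in>Group_Action.orbit (PGL n) (diagonal_action ds) W0. \<exists>B.
      (\<forall>i<length ds. basis_matrix (ds ! i) n (W i) (B i)) \<and> pencil_det \<mu> B \<noteq> 0"
    by (rule principal_open_if_form_nonzero[OF form test_tuple_carrier inj[OF _ _ _ nz(1)] nz(1) dense])
  then obtain W A where A: "W \<in> Group_Action.orbit (PGL n) (diagonal_action ds) W0"
      "\<forall>i<length ds. basis_matrix (ds ! i) n (W i) (A i)" "pencil_det \<mu> A \<noteq> 0"
    by blast
  define \<Theta> where "\<Theta> B = pencil_det \<nu> A * pencil_det \<mu> B + (- pencil_det \<mu> A) * pencil_det \<nu> B" for B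
  have form\<Theta>: "pluecker_form ds n \<Theta>"
    unfolding \<Theta>_def by (intro pluecker_form_add pluecker_form_scale form)
  have nz\<Theta>: "\<Theta> (test_tuple \<mu>) \<noteq> 0" unfolding \<Theta>_def using z nz(2) A(3) by simp
  have "\<exists>W\<in>Group_Action.orbit (PGL n) (diagonal_action ds) W0. \<exists>B.
      (\<forall>i<length ds. basis_matrix (ds ! i) n (W i) (B i)) \<and> \<Theta> B \<noteq> 0"
    by (rule principal_open_if_form_nonzero[OF form\<Theta> test_tuple_carrier inj[OF _ _ _ nz(2)] nz\<Theta> dense])
  then obtain W' A' where A': "W' \<in> Group_Action.orbit (PGL n) (diagonal_action ds) W0"
      "\<forall>i<length ds. basis_matrix (ds ! i) n (W' i) (A' i)" "\<Theta> A' \<noteq> 0"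
    by blast
  obtain g h where g: "g \<in> carrier_mat n n"
    and h: "\<forall>i<length ds. h i \<in> carrier_mat (ds ! i) (ds ! i) \<and> A' i = g * A i * h i"
    by (rule orbit_basis_matrices[OF W0 A(1) A'(1) A(2) A'(2)])
  have "pencil_det \<kappa> A' = det (double_mat n g) * det (bdiag h) * pencil_det \<kappa> A" for \<kappa>
    by (rule pencil_det_equivariant[OF _ g]) (use A(2) h len in \<open>auto simp: basis_matrix_def\<close>)
  then have "\<Theta> A' = 0" unfolding \<Theta>_def by (simp add: algebra_simps)
  then show False using A'(3) by blast
qed

theorem theorem5p1:
  fixes ds :: "nat list" and n :: nat
  assumes "dimension_vector ds n"
    and "length ds \<le> 4"
  shows "sparse_dimension_vector TYPE('a :: alg_closed_field) ds n \<longleftrightarrow>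
    length ds = 4 \<and> sum_list ds = 2 * n"
proof -
  have le: "ds ! i \<le> n" if "i < length ds" for i
    using assms(1) nth_mem[OF that] unfolding dimension_vector_def by fastforce
  have "dense_dimension_vector TYPE('a) ds n" if ne: "\<not> (length ds = 4 \<and> sum_list ds = 2 * n)"
  proof (rule dense_if_generic_orbit[OF assms(1)])
    show "generic_orbit TYPE('a) (length ds) n ((!) ds)"
    proof (cases "length ds = 4")
      case True
      then have "(\<Sum>i<4. ds ! i) \<noteq> 2 * n" using ne by (simp add: sum_list_sum_nth lessThan_atLeast0)
      then show ?thesis unfolding True using le True by (intro four_subspaces) auto
    next
      case False
      then show ?thesis using assms(2) le by (intro three_subspaces) auto
    qed
  qed
  then show ?thesis
    unfolding sparse_dimension_vector_def using sparse_if_defect_zero[OF assms(1)] by blast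
qed

end
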